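(* Let $G$ be a finite group and $H$ a normal subgroup of $G$. The $C^*$-algebra $\mathcal{A}=\overline{\bigcup_{n<m}A_{n,m}}$, i.e. the infinite iterated twisted tensor product $$\mathcal{A}=\cdots H\otimes_{R_{-2,-1}}\widehat{G}\otimes_{R_{-1,0}}H\otimes_{R_{0,1}}\widehat{G}\otimes_{R_{1,2}}H\otimes_{R_{2,3}}\widehat{G}\cdots,$$ is $C^*$-isomorphic to the observable algebra $\mathcal{A}_{(H,G)}$.
   Context: Let $G$ be a finite group with unit $e$ and $H$ a normal subgroup of $G$. Write $\delta_{a,b}=1$ if $a=b$ and $0$ otherwise. **The Hopf $C^*$-algebra $D(H;G)$.** It is the crossed product of $C(H)$ (complex functions on $H$) with the group algebra $\mathbb{C}G$ with respect to the adjoint action. It has linear basis $(h,g)$, $h\in H$, $g\in G$, and structure maps $(h_1,g_1)(h_2,g_2)=\delta_{h_1g_1,g_1h_2}(h_1,g_1g_2)$, $\ \Delta(h,g)=\sum_{t\in H}(t,g)\otimes(t^{-1}h,g)$, $\ \varepsilon(h,g)=\delta_{h,e}$, $\ S(h,g)=(g^{-1}h^{-1}g,g^{-1})$, $\ (h,g)^*=(g^{-1}hg,g^{-1})$. **The field algebra $\mathcal{F}_H$.** The local field algebra $\mathcal{F}_{H,\mathrm{loc}}$ is the associative algebra over $\mathbb{C}$ with unit $I$ generated by $\{\delta_g(x),\rho_h(l)\colon g\in G,\ h\in H,\ x\in\mathbb{Z},\ l\in\mathbb{Z}+\frac12\}$ subject to the relations (for all $x,x'\in\mathbb{Z}$,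 $l,l'\in\mathbb{Z}+\frac12$, $h,h_1,h_2\in H$, $g,g_1,g_2\in G$): - $\sum_{g\in G}\delta_g(x)=I=\rho_e(l)$; - $\delta_{g_1}(x)\delta_{g_2}(x)=\delta_{g_1,g_2}\delta_{g_1}(x)$; - $\rho_{h_1}(l)\rho_{h_2}(l)=\rho_{h_1h_2}(l)$; - $\delta_{g_1}(x)\delta_{g_2}(x')=\delta_{g_2}(x')\delta_{g_1}(x)$; - $\rho_h(l)\delta_g(x)=\delta_{hg}(x)\rho_h(l)$ if $l<x$, and $\rho_h(l)\delta_g(x)=\delta_g(x)\rho_h(l)$ if $l>x$; - $\rho_{h_1}(l)\rho_{h_2}(l')=\rho_{h_2}(l')\rho_{h_2^{-1}h_1h_2}(l)$ if $l>l'$, and $\rho_{h_1}(l)\rho_{h_2}(l')=\rho_{h_1h_2h_1^{-1}}(l')\rho_{h_1}(l)$ if $l<l'$. It is a unital $*$-algebra with $\delta_g(x)^*=\delta_g(x)$ and $\rho_h(l)^*=\rho_{h^{-1}}(l)$. It is the increasing union of the finite-dimensional $C^*$-algebras generated by the $\delta_g(x),\rho_h(l)$ with $x,l$ in a finite interval, and $\mathcal{F}_H$ denotes the $C^*$-inductive limit of these, i.e. the $C^*$-completion of $\mathcal{F}_{H,\mathrm{loc}}$. **The action and the observable algebra.** $D(H;G)$ acts on $\mathcal{F}_H$, making it a $D(H;G)$-module algebra (i.e. $a(FF')=\sum_{(a)}a_{(1)}(F)\,a_{(2)}(F')$ and $a(I)=\varepsilon(a)I$). On generators the action is $(h,g)\delta_f(x)=\delta_{h,e}\,\delta_{gf}(x)$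 for $f\in G$, and $(h,g)\rho_t(l)=\delta_{h,gtg^{-1}}\,\rho_h(l)$ for $t\in H$. It is extended to $\mathcal{F}_H$ by continuity. The observable algebra is the $C^*$-subalgebra $$\mathcal{A}_{(H,G)}=\{F\in\mathcal{F}_H\colon a(F)=\varepsilon(a)F\ \text{ for all } a\in D(H;G)\}\subseteq\mathcal{F}_H.$$ **The algebras $A_{n,m}$ and $\mathcal{A}$.** Here $H$ also denotes the group algebra $\mathbb{C}H$ (with $h^*=h^{-1}$), and $\widehat{G}$ the algebra of complex functions on $G$ under pointwise multiplication, with basis the indicator functions $\delta_g$, $g\in G$ (with $\delta_g^*=\delta_g$). For $i\in\mathbb{Z}$ put $A_i=H$ if $i$ is even and $A_i=\widehat{G}$ if $i$ is odd. For $i<j$ define linear maps $R_{i,j}\colon A_j\otimes A_i\to A_i\otimes A_j$ by - $R_{2n,2n+1}(\delta_g\otimes h)=h\otimes\delta_{h^{-1}g}$; - $R_{2n-1,2n}(h\otimes\delta_g)=\delta_{gh^{-1}}\otimes h$; - $R_{i,j}(x_j\otimes x_i)=x_i\otimes x_j$ if $j-i\ge2$. For $n<m$ the iterated twisted tensor product $$A_{n,m}=A_n\otimes_{R_{n,n+1}}A_{n+1}\otimes_{R_{n+1,n+2}}\cdots\otimes_{R_{m-1,m}}A_m$$ is the vector space $A_n\otimes\cdots\otimes A_m$ with the unique associative multiplication with the following properties. The natural inclusions $\iota_i\colon A_i\to A_{n,m}$ ($x\mapsto 1\otimes\cdots\otimes x\otimes\cdots\otimes1$, with $x$ in the slot of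 $A_i$) are unital algebra homomorphisms. One has $x_n\otimes\cdots\otimes x_m=\iota_n(x_n)\cdots\iota_m(x_m)$. For $i<j$, $\iota_j(y)\iota_i(x)=\sum\iota_i(x_R)\iota_j(y_R)$, where $R_{i,j}(y\otimes x)=\sum x_R\otimes y_R$. The involution on $A_{n,m}$ is the one for which every $\iota_i$ is a $*$-homomorphism; for instance, in $A_{0,2}$, $(h_1\otimes\delta_g\otimes h_2)^*=h_1^{-1}\otimes\delta_{h_1gh_2}\otimes h_2^{-1}$. With this structure $A_{n,m}$ is a finite-dimensional $C^*$-algebra. For $n\le n'<m'\le m$, $A_{n',m'}$ is regarded as a $C^*$-subalgebra of $A_{n,m}$ by inserting units in the additional tensor slots. $\mathcal{A}$ is the $C^*$-inductive limit $\overline{\bigcup_{n<m}A_{n,m}}$ of this system. *)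

theory Defs
  imports
    "HOL-Analysis.Analysis"
    "HOL-Algebra.QuotRing"
    "HOL-Algebra.Module"
    "HOL-Library.Poly_Mapping"
begin

section \<open>C*-algebras and *-algebras\<close>

text \<open>Unital complex C*-algebras as a type class; the library has complete normed algebras over the
  reals only.\<close>

class cstar_algebra = real_normed_algebra_1 + banach +
  fixes scaleC :: "complex \<Rightarrow> 'a \<Rightarrow> 'a"  (infixr "*\<^sub>C" 75)
    and star :: "'a \<Rightarrow> 'a"
  assumes scaleC_of_real: "complex_of_real r *\<^sub>C x = r *\<^sub>R x"
    and scaleC_add_left: "(c + d) *\<^sub>C x = c *\<^sub>C x + d *\<^sub>C x"
    and scaleC_add_right: "c *\<^sub>C (x + y) = c *\<^sub>C x + c *\<^sub>C y"
    and scaleC_scaleC: "c *\<^sub>C (d *\<^sub>C x) = (c * d) *\<^sub>C x"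
    and scaleC_mult_left: "(c *\<^sub>C x) * y = c *\<^sub>C (x * y)"
    and scaleC_mult_right: "x * (c *\<^sub>C y) = c *\<^sub>C (x * y)"
    and norm_scaleC: "norm (c *\<^sub>C x) = cmod c * norm x"
    and star_add: "star (x + y) = star x + star y"
    and star_scaleC: "star (c *\<^sub>C x) = cnj c *\<^sub>C star x"
    and star_mult: "star (x * y) = star y * star x"
    and star_star: "star (star x) = x"
    and cstar_identity: "norm (star x * x) = (norm x)\<^sup>2"

text \<open>Purely algebraic unital complex *-algebras, with an explicit carrier.\<close>

record 'a star_alg = "(complex, 'a) module" +
  adj :: "'a \<Rightarrow> 'a"

locale star_algebra = ring A for A :: "'a star_alg" (structure) +
  assumes smult_closed: "x \<in> carrier A \<Longrightarrow> c \<odot> x \<in> carrier A"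
    and smult_add_left: "x \<in> carrier A \<Longrightarrow> (c + d) \<odot> x = (c \<odot> x) \<oplus> (d \<odot> x)"
    and smult_add_right:
      "x \<in> carrier A \<Longrightarrow> y \<in> carrier A \<Longrightarrow> c \<odot> (x \<oplus> y) = (c \<odot> x) \<oplus> (c \<odot> y)"
    and smult_smult: "x \<in> carrier A \<Longrightarrow> c \<odot> (d \<odot> x) = (c * d) \<odot> x"
    and smult_1: "x \<in> carrier A \<Longrightarrow> 1 \<odot> x = x"
    and smult_mult_left:
      "x \<in> carrier A \<Longrightarrow> y \<in> carrier A \<Longrightarrow> (c \<odot> x) \<otimes> y = c \<odot> (x \<otimes> y)"
    and smult_mult_right:
      "x \<in> carrier A \<Longrightarrow> y \<in> carrier A \<Longrightarrow> x \<otimes> (c \<odot> y) = c \<odot> (x \<otimes> y)"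
    and adj_closed: "x \<in> carrier A \<Longrightarrow> adj A x \<in> carrier A"
    and adj_add: "x \<in> carrier A \<Longrightarrow> y \<in> carrier A \<Longrightarrow> adj A (x \<oplus> y) = adj A x \<oplus> adj A y"
    and adj_smult: "x \<in> carrier A \<Longrightarrow> adj A (c \<odot> x) = cnj c \<odot> adj A x"
    and adj_mult: "x \<in> carrier A \<Longrightarrow> y \<in> carrier A \<Longrightarrow> adj A (x \<otimes> y) = adj A y \<otimes> adj A x"
    and adj_adj: "x \<in> carrier A \<Longrightarrow> adj A (adj A x) = x"

text \<open>Unital *-homomorphisms between *-algebras, and from a *-algebra into a C*-algebra.\<close>

definition star_alg_hom :: "'a star_alg \<Rightarrow> 'b star_alg \<Rightarrow> ('a \<Rightarrow> 'b) \<Rightarrow> bool" where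
  "star_alg_hom A B \<phi> \<longleftrightarrow>
     \<phi> \<in> ring_hom A B \<and>
     (\<forall>c. \<forall>x\<in>carrier A. \<phi> (c \<odot>\<^bsub>A\<^esub> x) = c \<odot>\<^bsub>B\<^esub> \<phi> x) \<and>
     (\<forall>x\<in>carrier A. \<phi> (adj A x) = adj B (\<phi> x))"

definition cstar_rep :: "'a star_alg \<Rightarrow> ('a \<Rightarrow> 'c::cstar_algebra) \<Rightarrow> bool" where
  "cstar_rep A \<phi> \<longleftrightarrow>
     (\<forall>x\<in>carrier A. \<forall>y\<in>carrier A.
        \<phi> (x \<oplus>\<^bsub>A\<^esub> y) = \<phi> x + \<phi> y \<and> \<phi> (x \<otimes>\<^bsub>A\<^esub> y) = \<phi> x * \<phi> y) \<and>
     \<phi> \<one>\<^bsub>A\<^esub> = 1 \<and>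
     (\<forall>c. \<forall>x\<in>carrier A. \<phi> (c \<odot>\<^bsub>A\<^esub> x) = c *\<^sub>C \<phi> x) \<and>
     (\<forall>x\<in>carrier A. \<phi> (adj A x) = star (\<phi> x))"

text \<open>The type \<^typ>\<open>'c\<close>, together with \<^term>\<open>j\<close>, is a C*-completion of the *-algebra \<^term>\<open>A\<close>.  The
  norm that \<^term>\<open>A\<close> receives from \<^typ>\<open>'c\<close> is some C*-norm; if \<^term>\<open>A\<close> is an increasing
  union of finite-dimensional C*-algebras, it has only one.\<close>

definition cstar_completion :: "'a star_alg \<Rightarrow> ('a \<Rightarrow> 'c::cstar_algebra) \<Rightarrow> bool" where
  "cstar_completion A j \<longleftrightarrow>
     cstar_rep A j \<and> inj_on j (carrier A) \<and> closure (j ` carrier A) = UNIV"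

text \<open>The type \<^typ>\<open>'c\<close>, together with the maps \<^term>\<open>\<kappa> i\<close>, is the C*-inductive limit of the system of
  *-algebras \<^term>\<open>A i\<close> (\<^term>\<open>i \<in> I\<close>) with connecting maps \<^term>\<open>\<phi> i i'\<close> from \<^term>\<open>A i\<close> to
  \<^term>\<open>A i'\<close> for \<^term>\<open>below i i'\<close>.\<close>

definition cstar_inductive_limit ::
  "'i set \<Rightarrow> ('i \<Rightarrow> 'i \<Rightarrow> bool) \<Rightarrow> ('i \<Rightarrow> 'a star_alg) \<Rightarrow> ('i \<Rightarrow> 'i \<Rightarrow> 'a \<Rightarrow> 'a)
    \<Rightarrow> ('i \<Rightarrow> 'a \<Rightarrow> 'c::cstar_algebra) \<Rightarrow> bool" where
  "cstar_inductive_limit I below A \<phi> \<kappa> \<longleftrightarrow>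
     (\<forall>i\<in>I. cstar_rep (A i) (\<kappa> i) \<and> inj_on (\<kappa> i) (carrier (A i))) \<and>
     (\<forall>i\<in>I. \<forall>i'\<in>I. below i i' \<longrightarrow> (\<forall>x\<in>carrier (A i). \<kappa> i' (\<phi> i i' x) = \<kappa> i x)) \<and>
     closure (\<Union>i\<in>I. \<kappa> i ` carrier (A i)) = UNIV"

definition cstar_isomorphism ::
  "('a::cstar_algebra \<Rightarrow> 'b::cstar_algebra) \<Rightarrow> 'a set \<Rightarrow> 'b set \<Rightarrow> bool" where
  "cstar_isomorphism \<Phi> S T \<longleftrightarrow>
     bij_betw \<Phi> S T \<and>
     (\<forall>x\<in>S. \<forall>y\<in>S. \<Phi> (x + y) = \<Phi> x + \<Phi> y \<and> \<Phi> (x * y) = \<Phi> x * \<Phi> y) \<and>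
     \<Phi> 1 = 1 \<and>
     (\<forall>c. \<forall>x\<in>S. \<Phi> (c *\<^sub>C x) = c *\<^sub>C \<Phi> x) \<and>
     (\<forall>x\<in>S. \<Phi> (star x) = star (\<Phi> x) \<and> norm (\<Phi> x) = norm x)"


section \<open>The local field algebra\<close>

text \<open>Free complex algebras: with concatenation as addition of words, the convolution product of
  \<^typ>\<open>'a list \<Rightarrow>\<^sub>0 complex\<close> is the multiplication of noncommutative polynomials.\<close>

instantiation list :: (type) monoid_add
begin
definition zero_list :: "'a list" where "zero_list = []"
definition plus_list :: "'a list \<Rightarrow> 'a list \<Rightarrow> 'a list" where "plus_list xs ys = xs @ ys"
instance by standard (simp_all add: zero_list_def plus_list_def)
end

text \<open>\<^term>\<open>Delta g x\<close> and \<^term>\<open>Rho h l\<close> are the symbols $\delta_g(x)$ and $\rho_h(l)$.\<close>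

datatype 'g field_gen = Delta 'g int | Rho 'g rat

type_synonym 'g field_poly = "'g field_gen list \<Rightarrow>\<^sub>0 complex"

definition half_odd :: "rat set" where
  "half_odd = {l. l - 1 / 2 \<in> \<int>}"

definition field_gens :: "('g, 'z) monoid_scheme \<Rightarrow> 'g set \<Rightarrow> 'g field_gen set" where
  "field_gens G H = {Delta g x | g x. g \<in> carrier G} \<union> {Rho h l | h l. h \<in> H \<and> l \<in> half_odd}"

definition free_field :: "('g, 'z) monoid_scheme \<Rightarrow> 'g set \<Rightarrow> 'g field_poly ring" where
  "free_field G H =
     \<lparr>carrier = {p. \<forall>w \<in> Poly_Mapping.keys p. set w \<subseteq> field_gens G H},
      monoid.mult = (*), one = 1, zero = 0, add = (+)\<rparr>"

abbreviation dl :: "'g \<Rightarrow> int \<Rightarrow> 'g field_poly" where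
  "dl g x \<equiv> Poly_Mapping.single [Delta g x] 1"

abbreviation rh :: "'g \<Rightarrow> rat \<Rightarrow> 'g field_poly" where
  "rh h l \<equiv> Poly_Mapping.single [Rho h l] 1"

text \<open>The defining relations, each as the difference of its two sides.\<close>

definition field_relators :: "('g, 'z) monoid_scheme \<Rightarrow> 'g set \<Rightarrow> 'g field_poly set" where
  "field_relators G H =
     {(\<Sum>g\<in>carrier G. dl g x) - 1 | x. True}
   \<union> {rh \<one>\<^bsub>G\<^esub> l - 1 | l. l \<in> half_odd}
   \<union> {dl g1 x * dl g2 x - (if g1 = g2 then dl g1 x else 0) | g1 g2 x.
        g1 \<in> carrier G \<and> g2 \<in> carrier G}
   \<union> {rh h1 l * rh h2 l - rh (h1 \<otimes>\<^bsub>G\<^esub> h2) l | h1 h2 l. h1 \<in> H \<and> h2 \<in> H \<and> l \<in> half_odd}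
   \<union> {dl g1 x * dl g2 x' - dl g2 x' * dl g1 x | g1 g2 x x'. g1 \<in> carrier G \<and> g2 \<in> carrier G}
   \<union> {rh h l * dl g x - dl (h \<otimes>\<^bsub>G\<^esub> g) x * rh h l | h g l x.
        h \<in> H \<and> g \<in> carrier G \<and> l \<in> half_odd \<and> l < of_int x}
   \<union> {rh h l * dl g x - dl g x * rh h l | h g l x.
        h \<in> H \<and> g \<in> carrier G \<and> l \<in> half_odd \<and> l > of_int x}
   \<union> {rh h1 l * rh h2 l' - rh h2 l' * rh (inv\<^bsub>G\<^esub> h2 \<otimes>\<^bsub>G\<^esub> h1 \<otimes>\<^bsub>G\<^esub> h2) l | h1 h2 l l'.
        h1 \<in> H \<and> h2 \<in> H \<and> l \<in> half_odd \<and> l' \<in> half_odd \<and> l > l'}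
   \<union> {rh h1 l * rh h2 l' - rh (h1 \<otimes>\<^bsub>G\<^esub> h2 \<otimes>\<^bsub>G\<^esub> inv\<^bsub>G\<^esub> h1) l' * rh h1 l | h1 h2 l l'.
        h1 \<in> H \<and> h2 \<in> H \<and> l \<in> half_odd \<and> l' \<in> half_odd \<and> l < l'}"

definition field_ideal :: "('g, 'z) monoid_scheme \<Rightarrow> 'g set \<Rightarrow> 'g field_poly set" where
  "field_ideal G H = Idl\<^bsub>free_field G H\<^esub> (field_relators G H)"

primrec gen_adj :: "('g, 'z) monoid_scheme \<Rightarrow> 'g field_gen \<Rightarrow> 'g field_gen" where
  "gen_adj G (Delta g x) = Delta g x"
| "gen_adj G (Rho h l) = Rho (inv\<^bsub>G\<^esub> h) l"

definition poly_adj :: "('g, 'z) monoid_scheme \<Rightarrow> 'g field_poly \<Rightarrow> 'g field_poly" where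
  "poly_adj G p =
     (\<Sum>w\<in>Poly_Mapping.keys p.
        Poly_Mapping.single (rev (map (gen_adj G) w)) (cnj (Poly_Mapping.lookup p w)))"

definition field_class :: "('g, 'z) monoid_scheme \<Rightarrow> 'g set \<Rightarrow> 'g field_poly \<Rightarrow> 'g field_poly set"
  where "field_class G H p = field_ideal G H +>\<^bsub>free_field G H\<^esub> p"

text \<open>Scalar multiplication and involution of the quotient are set up like the multiplication of the
  library quotient ring: an operation on cosets is the union of its values on representatives.\<close>

definition field_loc :: "('g, 'z) monoid_scheme \<Rightarrow> 'g set \<Rightarrow> 'g field_poly set star_alg" where
  "field_loc G H =
     (let Q = free_field G H Quot field_ideal G H in
      \<lparr>carrier = carrier Q, monoid.mult = monoid.mult Q, one = one Q, zero = zero Q, add = add Q,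
       smult = (\<lambda>c X. \<Union>p\<in>X. field_class G H (Poly_Mapping.single [] c * p)),
       adj = (\<lambda>X. \<Union>p\<in>X. field_class G H (poly_adj G p))\<rparr>)"


section \<open>The double algebra, its action, and the observable algebra\<close>

text \<open>An element \<^term>\<open>a\<close> of $D(H;G)$ is given by its coefficients: \<^term>\<open>a (h, g)\<close> belongs to the
  basis vector $(h,g)$; elements of the tensor square have coefficients indexed by pairs of pairs.\<close>

definition double :: "('g, 'z) monoid_scheme \<Rightarrow> 'g set \<Rightarrow> ('g \<times> 'g \<Rightarrow> complex) set" where
  "double G H = {a. \<forall>p. p \<notin> H \<times> carrier G \<longrightarrow> a p = 0}"

definition double_basis :: "'g \<times> 'g \<Rightarrow> 'g \<times> 'g \<Rightarrow> complex" where
  "double_basis p = (\<lambda>q. if q = p then 1 else 0)"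

definition double_mult :: "('g, 'z) monoid_scheme \<Rightarrow> 'g set
    \<Rightarrow> ('g \<times> 'g \<Rightarrow> complex) \<Rightarrow> ('g \<times> 'g \<Rightarrow> complex) \<Rightarrow> ('g \<times> 'g \<Rightarrow> complex)" where
  "double_mult G H a b = (\<lambda>r. \<Sum>(h1, g1)\<in>H \<times> carrier G. \<Sum>(h2, g2)\<in>H \<times> carrier G.
     a (h1, g1) * b (h2, g2) *
     (if h1 \<otimes>\<^bsub>G\<^esub> g1 = g1 \<otimes>\<^bsub>G\<^esub> h2 then double_basis (h1, g1 \<otimes>\<^bsub>G\<^esub> g2) r else 0))"

definition double_unit :: "('g, 'z) monoid_scheme \<Rightarrow> 'g set \<Rightarrow> 'g \<times> 'g \<Rightarrow> complex" where
  "double_unit G H = (\<lambda>r. \<Sum>h\<in>H. double_basis (h, \<one>\<^bsub>G\<^esub>) r)"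

definition double_comult :: "('g, 'z) monoid_scheme \<Rightarrow> 'g set
    \<Rightarrow> ('g \<times> 'g \<Rightarrow> complex) \<Rightarrow> ('g \<times> 'g) \<times> ('g \<times> 'g) \<Rightarrow> complex" where
  "double_comult G H a = (\<lambda>(r, s). \<Sum>(h, g)\<in>H \<times> carrier G. a (h, g) *
     (\<Sum>t\<in>H. double_basis (t, g) r * double_basis (inv\<^bsub>G\<^esub> t \<otimes>\<^bsub>G\<^esub> h, g) s))"

definition double_counit :: "('g, 'z) monoid_scheme \<Rightarrow> 'g set \<Rightarrow> ('g \<times> 'g \<Rightarrow> complex) \<Rightarrow> complex"
  where
  "double_counit G H a = (\<Sum>(h, g)\<in>H \<times> carrier G. a (h, g) * (if h = \<one>\<^bsub>G\<^esub> then 1 else 0))"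

definition module_algebra :: "('g, 'z) monoid_scheme \<Rightarrow> 'g set
    \<Rightarrow> (('g \<times> 'g \<Rightarrow> complex) \<Rightarrow> 'f::cstar_algebra \<Rightarrow> 'f) \<Rightarrow> bool" where
  "module_algebra G H act \<longleftrightarrow>
     (\<forall>a\<in>double G H. \<forall>E F c. act a (E + F) = act a E + act a F \<and> act a (c *\<^sub>C F) = c *\<^sub>C act a F) \<and>
     (\<forall>a\<in>double G H. \<forall>b\<in>double G H. \<forall>c F.
        act (\<lambda>r. a r + b r) F = act a F + act b F \<and> act (\<lambda>r. c * a r) F = c *\<^sub>C act a F) \<and>
     (\<forall>a\<in>double G H. \<forall>b\<in>double G H. \<forall>F. act (double_mult G H a b) F = act a (act b F)) \<and>
     (\<forall>F. act (double_unit G H) F = F) \<and>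
     (\<forall>a\<in>double G H. \<forall>E F. act a (E * F) =
        (\<Sum>r\<in>H \<times> carrier G. \<Sum>s\<in>H \<times> carrier G.
           double_comult G H a (r, s) *\<^sub>C (act (double_basis r) E * act (double_basis s) F))) \<and>
     (\<forall>a\<in>double G H. act a 1 = double_counit G H a *\<^sub>C 1)"

text \<open>\<^term>\<open>act\<close> is the action of $D(H;G)$ on the field algebra, where \<^term>\<open>j\<close> embeds the local
  field algebra into its completion.  It is uniquely determined by these conditions.\<close>

definition field_action :: "('g, 'z) monoid_scheme \<Rightarrow> 'g set \<Rightarrow> ('g field_poly set \<Rightarrow> 'f::cstar_algebra)
    \<Rightarrow> (('g \<times> 'g \<Rightarrow> complex) \<Rightarrow> 'f \<Rightarrow> 'f) \<Rightarrow> bool" where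
  "field_action G H j act \<longleftrightarrow>
     module_algebra G H act \<and>
     (\<forall>h\<in>H. \<forall>g\<in>carrier G. \<forall>f\<in>carrier G. \<forall>x.
        act (double_basis (h, g)) (j (field_class G H (dl f x))) =
        (if h = \<one>\<^bsub>G\<^esub> then j (field_class G H (dl (g \<otimes>\<^bsub>G\<^esub> f) x)) else 0)) \<and>
     (\<forall>h\<in>H. \<forall>g\<in>carrier G. \<forall>t\<in>H. \<forall>l\<in>half_odd.
        act (double_basis (h, g)) (j (field_class G H (rh t l))) =
        (if h = g \<otimes>\<^bsub>G\<^esub> t \<otimes>\<^bsub>G\<^esub> inv\<^bsub>G\<^esub> g then j (field_class G H (rh h l)) else 0)) \<and>
     (\<forall>a\<in>double G H. continuous_on UNIV (act a))"

definition observable_algebra :: "('g, 'z) monoid_scheme \<Rightarrow> 'g set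
    \<Rightarrow> (('g \<times> 'g \<Rightarrow> complex) \<Rightarrow> 'f::cstar_algebra \<Rightarrow> 'f) \<Rightarrow> 'f set" where
  "observable_algebra G H act = {F. \<forall>a\<in>double G H. act a F = double_counit G H a *\<^sub>C F}"


section \<open>Iterated twisted tensor products\<close>

definition site_basis :: "('g, 'z) monoid_scheme \<Rightarrow> 'g set \<Rightarrow> int \<Rightarrow> 'g set" where
  "site_basis G H i = (if even i then H else carrier G)"

text \<open>The algebra $A_i$, in coordinates: for even \<^term>\<open>i\<close> the group algebra of \<^term>\<open>H\<close>, for odd
  \<^term>\<open>i\<close> the algebra of functions on the group.\<close>

definition site_alg :: "('g, 'z) monoid_scheme \<Rightarrow> 'g set \<Rightarrow> int \<Rightarrow> ('g \<Rightarrow> complex) star_alg" where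
  "site_alg G H i =
     \<lparr>carrier = {x. \<forall>k. k \<notin> site_basis G H i \<longrightarrow> x k = 0},
      monoid.mult = (\<lambda>x y k.
        if even i then \<Sum>(h1, h2)\<in>{(h1, h2) \<in> H \<times> H. h1 \<otimes>\<^bsub>G\<^esub> h2 = k}. x h1 * y h2 else x k * y k),
      one = (\<lambda>k. if even i then (if k = \<one>\<^bsub>G\<^esub> then 1 else 0) else (if k \<in> carrier G then 1 else 0)),
      zero = (\<lambda>k. 0), add = (\<lambda>x y k. x k + y k), smult = (\<lambda>c x k. c * x k),
      adj = (\<lambda>x k. if even i then (if k \<in> H then cnj (x (inv\<^bsub>G\<^esub> k)) else 0) else cnj (x k))\<rparr>"

definition site_vec :: "'g \<Rightarrow> 'g \<Rightarrow> complex" where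
  "site_vec b = (\<lambda>k. if k = b then 1 else 0)"

text \<open>The maps $R_{i,j}$ send tensors of basis vectors to tensors of basis vectors:
  \<^term>\<open>twist G i j p q = (r, s)\<close> means that $R_{i,j}$ sends
  \<^term>\<open>site_vec p\<close> $\otimes$ \<^term>\<open>site_vec q\<close> in $A_j\otimes A_i$ to
  \<^term>\<open>site_vec r\<close> $\otimes$ \<^term>\<open>site_vec s\<close> in $A_i\otimes A_j$.\<close>

definition twist :: "('g, 'z) monoid_scheme \<Rightarrow> int \<Rightarrow> int \<Rightarrow> 'g \<Rightarrow> 'g \<Rightarrow> 'g \<times> 'g" where
  "twist G i j p q =
     (if j = i + 1 then
        (if even i then (q, inv\<^bsub>G\<^esub> q \<otimes>\<^bsub>G\<^esub> p) else (q \<otimes>\<^bsub>G\<^esub> inv\<^bsub>G\<^esub> p, p))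
      else (q, p))"

text \<open>The vector space $A_n\otimes\cdots\otimes A_m$ in coordinates: functions on the product of the
  bases.\<close>

definition tensor_basis :: "('g, 'z) monoid_scheme \<Rightarrow> 'g set \<Rightarrow> int \<Rightarrow> int \<Rightarrow> (int \<Rightarrow> 'g) set" where
  "tensor_basis G H n m = PiE {n..m} (site_basis G H)"

definition pure_tensor :: "('g, 'z) monoid_scheme \<Rightarrow> 'g set \<Rightarrow> int \<Rightarrow> int
    \<Rightarrow> (int \<Rightarrow> 'g \<Rightarrow> complex) \<Rightarrow> (int \<Rightarrow> 'g) \<Rightarrow> complex" where
  "pure_tensor G H n m x =
     (\<lambda>b. if b \<in> tensor_basis G H n m then \<Prod>i\<in>{n..m}. x i (b i) else 0)"

definition slot :: "('g, 'z) monoid_scheme \<Rightarrow> 'g set \<Rightarrow> int \<Rightarrow> int \<Rightarrow> int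
    \<Rightarrow> ('g \<Rightarrow> complex) \<Rightarrow> (int \<Rightarrow> 'g) \<Rightarrow> complex" where
  "slot G H n m i x = pure_tensor G H n m ((\<lambda>k. one (site_alg G H k))(i := x))"

text \<open>\<^term>\<open>A\<close> is the *-algebra $A_{n,m}$.  The list product in the third condition is
  $\iota_n(x_n)\cdots\iota_m(x_m)$ in this order.  The exchange relation is stated for basis vectors
  only, both sides being bilinear.\<close>

definition twisted_tensor_product ::
  "('g, 'z) monoid_scheme \<Rightarrow> 'g set \<Rightarrow> int \<Rightarrow> int \<Rightarrow> ((int \<Rightarrow> 'g) \<Rightarrow> complex) star_alg \<Rightarrow> bool" where
  "twisted_tensor_product G H n m A \<longleftrightarrow>
     star_algebra A \<and>
     carrier A = {u. \<forall>b. b \<notin> tensor_basis G H n m \<longrightarrow> u b = 0} \<and>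
     zero A = (\<lambda>b. 0) \<and> add A = (\<lambda>u v b. u b + v b) \<and> smult A = (\<lambda>c u b. c * u b) \<and>
     (\<forall>i\<in>{n..m}. star_alg_hom (site_alg G H i) A (slot G H n m i)) \<and>
     (\<forall>x. (\<forall>i\<in>{n..m}. x i \<in> carrier (site_alg G H i)) \<longrightarrow>
        pure_tensor G H n m x = foldr (\<lambda>i u. slot G H n m i (x i) \<otimes>\<^bsub>A\<^esub> u) [n..m] \<one>\<^bsub>A\<^esub>) \<and>
     (\<forall>i\<in>{n..m}. \<forall>j\<in>{n..m}. i < j \<longrightarrow>
        (\<forall>p\<in>site_basis G H j. \<forall>q\<in>site_basis G H i.
           slot G H n m j (site_vec p) \<otimes>\<^bsub>A\<^esub> slot G H n m i (site_vec q) =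
           (let (r, s) = twist G i j p q
            in slot G H n m i (site_vec r) \<otimes>\<^bsub>A\<^esub> slot G H n m j (site_vec s))))"

text \<open>The inclusion of $A_{n',m'}$ into $A_{n,m}$ by units in the additional slots.\<close>

definition insert_units :: "('g, 'z) monoid_scheme \<Rightarrow> 'g set \<Rightarrow> int \<times> int \<Rightarrow> int \<times> int
    \<Rightarrow> ((int \<Rightarrow> 'g) \<Rightarrow> complex) \<Rightarrow> (int \<Rightarrow> 'g) \<Rightarrow> complex" where
  "insert_units G H = (\<lambda>(n', m') (n, m) u b.
     if b \<in> tensor_basis G H n m
     then u (restrict b {n'..m'}) * (\<Prod>i\<in>{n..m} - {n'..m'}. one (site_alg G H i) (b i))
     else 0)"

text \<open>The type \<^typ>\<open>'a\<close>, together with the embeddings \<^term>\<open>\<kappa> (n, m)\<close> of the algebras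
  \<^term>\<open>A (n, m)\<close>, is the infinite iterated twisted tensor product.\<close>

definition infinite_twisted_tensor_product ::
  "('g, 'z) monoid_scheme \<Rightarrow> 'g set \<Rightarrow> (int \<times> int \<Rightarrow> ((int \<Rightarrow> 'g) \<Rightarrow> complex) star_alg)
    \<Rightarrow> (int \<times> int \<Rightarrow> ((int \<Rightarrow> 'g) \<Rightarrow> complex) \<Rightarrow> 'a::cstar_algebra) \<Rightarrow> bool" where
  "infinite_twisted_tensor_product G H A \<kappa> \<longleftrightarrow>
     (\<forall>n m. n < m \<longrightarrow> twisted_tensor_product G H n m (A (n, m))) \<and>
     cstar_inductive_limit {(n, m). n < m} (\<lambda>(n', m') (n, m). n \<le> n' \<and> m' \<le> m)
       A (insert_units G H) \<kappa>"

end

theory Submission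
  imports Defs
begin

text \<open>Half-integer sites carry $\rho$ and integer sites carry $\delta$.  With
  $T_s(x)=\rho_s(x-\frac12)\rho_{s^{-1}}(x+\frac12)$, the elements
  $v_h(x)=\sum_f\delta_f(x)T_{fh^{-1}f^{-1}}(x)$ and $w_g(x)=\sum_f\delta_f(x)\delta_{fg}(x+1)$ are
  $D(H;G)$-invariant and satisfy the relations of the basis vectors of $A_{2x}$ and $A_{2x+1}$.  Ordered
  products of these elements are linearly independent, as an explicit representation of the field
  algebra on configurations shows, so both sides contain the same increasing union of finite-dimensional
  algebras.  Its C*-norm is unique, hence the identification is isometric and extends to the closures.
  The invariants are not larger than this closure: over the algebra generated by $v$ and $w$ the local
  field algebra is spanned by the $\delta_f(0)\rho_t(\frac12)$, and averaging over $G$ maps this span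
  back into the algebra.\<close>

section \<open>C*-algebras and isometric graphs\<close>

text \<open>Neither C*-algebra comes with a universal property: \<open>j\<close> and \<kappa> merely
  embed the local algebras injectively and with dense union, for some C*-norm. Sending generators to
  generators therefore yields no continuous map by itself. Isometry has to be extracted on each
  finite interval from linear independence on both sides, and the map is built as a relation closed
  under the operations.

  The form of the generators comes from configurations with values in the group. The symmetry
  translates all sites from the left by G and adds a grading by H; \<rho> translates a half-line
  from the left. In T the half-lines cancel beyond x, so a single site moves. Conjugating the
  parameter by the value f at that site turns this left translation into a right one, which commutes
  with all left translations; the parameter stays in H because H is normal. Likewise f^{-1} f' is
  the left-invariant combination of neighbouring values f and f', and w projects onto its
  value.\<close>

lemma scaleC_1 [simp]: "1 *\<^sub>C (x :: 'a::cstar_algebra) = x"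
  using scaleC_of_real[of 1 x] by simp

lemma scaleC_0_left [simp]: "0 *\<^sub>C (x :: 'a::cstar_algebra) = 0"
  using scaleC_of_real[of 0 x] by simp

lemma scaleC_minus_1: "(- 1) *\<^sub>C (x :: 'a::cstar_algebra) = - x"
  using scaleC_of_real[of "-1" x] by simp

lemma scaleC_0_right [simp]: "c *\<^sub>C (0 :: 'a::cstar_algebra) = 0"
  using scaleC_add_right[of c 0 "0 :: 'a"] by simp

lemma scaleC_sum: "c *\<^sub>C (\<Sum>i\<in>I. f i) = (\<Sum>i\<in>I. c *\<^sub>C (f i :: 'a::cstar_algebra))"
  by (induction I rule: infinite_finite_induct) (auto simp: scaleC_add_right)

lemma star_0 [simp]: "star (0 :: 'a::cstar_algebra) = 0"
  using star_add[of 0 "0 :: 'a"] by simp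

lemma star_sum: "star (\<Sum>i\<in>I. f i) = (\<Sum>i\<in>I. star (f i :: 'a::cstar_algebra))"
  by (induction I rule: infinite_finite_induct) (auto simp: star_add)

lemma star_1 [simp]: "star (1 :: 'a::cstar_algebra) = 1"
  by (metis mult_1_left mult_1_right star_mult star_star)

lemma star_diff: "star (x - y) = star x - star (y :: 'a::cstar_algebra)"
  by (metis add_diff_cancel diff_add_cancel star_add)

lemma norm_star [simp]: "norm (star x) = norm (x :: 'a::cstar_algebra)"
proof -
  have *: "norm y \<le> norm (star y)" for y :: 'a
  proof (cases "norm y = 0")
    case False
    have "norm y * norm y \<le> norm (star y) * norm y"
      using norm_mult_ineq[of "star y" y] by (simp add: cstar_identity power2_eq_square)
    with False show ?thesis by simp
  qed auto
  show ?thesis using *[of x] *[of "star x"] by (simp add: star_star)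
qed

lemma tendsto_star:
  fixes l :: "'a::cstar_algebra"
  assumes "(f \<longlongrightarrow> l) F"
  shows "((\<lambda>x. star (f x)) \<longlongrightarrow> star l) F"
proof -
  have "norm (star (f x) - star l) = norm (f x - l)" for x
    by (metis norm_star star_diff)
  with assms show ?thesis
    by (simp add: tendsto_iff dist_norm)
qed

lemma scaleC_diff_right: "c *\<^sub>C (x - y) = c *\<^sub>C x - c *\<^sub>C (y :: 'a::cstar_algebra)"
  by (metis add_diff_cancel diff_add_cancel scaleC_add_right)

lemma scaleC_diff_left: "(c - d) *\<^sub>C x = c *\<^sub>C x - d *\<^sub>C (x :: 'a::cstar_algebra)"
  by (metis add_diff_cancel diff_add_cancel scaleC_add_left)

lemma tendsto_scaleC:
  fixes l :: "'a::cstar_algebra"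
  assumes "(f \<longlongrightarrow> l) F"
  shows "((\<lambda>x. c *\<^sub>C f x) \<longlongrightarrow> c *\<^sub>C l) F"
proof (rule Lim_transform_bound[where g = "\<lambda>x. cmod c * norm (f x - l)", THEN Lim_null[THEN iffD2]])
  show "\<forall>\<^sub>F x in F. norm (c *\<^sub>C f x - c *\<^sub>C l) \<le> norm (cmod c * norm (f x - l))"
    by (simp add: norm_scaleC flip: scaleC_diff_right)
  have "((\<lambda>x. norm (f x - l)) \<longlongrightarrow> 0) F"
    using assms by (intro tendsto_norm_zero LIM_zero)
  then show "((\<lambda>x. cmod c * norm (f x - l)) \<longlongrightarrow> 0) F"
    by (rule tendsto_mult_right_zero)
qed

section \<open>Equivalence and uniqueness of C*-norms in finite dimension\<close>

lemma finite_simultaneous_subseq: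
  fixes c :: "nat \<Rightarrow> 'b \<Rightarrow> complex"
  assumes "finite B" and "\<And>n b. b \<in> B \<Longrightarrow> cmod (c n b) \<le> K"
  shows "\<exists>r l. strict_mono (r :: nat \<Rightarrow> nat) \<and> (\<forall>b\<in>B. (\<lambda>n. c (r n) b) \<longlonglongrightarrow> l b)"
  using assms
proof (induction B rule: finite_induct)
  case empty
  then show ?case by (intro exI[of _ id]) (auto simp: strict_mono_def)
next
  case (insert b B)
  then obtain r l where r: "strict_mono (r :: nat \<Rightarrow> nat)" "\<forall>b\<in>B. (\<lambda>n. c (r n) b) \<longlonglongrightarrow> l b"
    by auto
  have "bounded (range (\<lambda>n. c (r n) b))"
    using insert.prems by (auto intro!: boundedI[of _ K])
  then obtain m s where s: "strict_mono s" "((\<lambda>n. c (r n) b) \<circ> s) \<longlonglongrightarrow> m"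
    using bounded_imp_convergent_subsequence by blast
  have "(\<lambda>n. c ((r \<circ> s) n) b') \<longlonglongrightarrow> (l(b := m)) b'" if "b' \<in> insert b B" for b'
    using that s r(2) LIMSEQ_subseq_LIMSEQ[OF _ s(1), of "\<lambda>n. c (r n) b'" "l b'"]
    by (auto simp: o_def)
  moreover have "strict_mono (r \<circ> s)" using r s by (simp add: strict_mono_o)
  ultimately show ?case by blast
qed

definition complex_independent :: "'b set \<Rightarrow> ('b \<Rightarrow> 'a::cstar_algebra) \<Rightarrow> bool" where
  "complex_independent B e \<longleftrightarrow>
     (\<forall>c. (\<Sum>b\<in>B. c b *\<^sub>C e b) = 0 \<longrightarrow> (\<forall>b\<in>B. c b = 0))"

text \<open>Compactness of the unit sphere of coefficient vectors: if no \<open>K\<close> worked,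
  normalised coefficients with sums tending to 0 would have a limit of total modulus 1 whose sum
  vanishes, against independence.\<close>

lemma independent_coefficients_bounded:
  fixes e :: "'b \<Rightarrow> 'a::cstar_algebra"
  assumes "finite B" and ind: "complex_independent B e"
  shows "\<exists>K. \<forall>c. (\<Sum>b\<in>B. cmod (c b)) \<le> K * norm (\<Sum>b\<in>B. c b *\<^sub>C e b)"
proof (rule ccontr)
  define N where "N c = (\<Sum>b\<in>B. cmod (c b))" for c :: "'b \<Rightarrow> complex"
  define V where "V c = (\<Sum>b\<in>B. c b *\<^sub>C e b)" for c
  assume "\<not> ?thesis"
  then have "\<forall>n::nat. \<exists>c. N c > real (Suc n) * norm (V c)"
    by (auto simp: not_le N_def V_def)
  then obtain c where c: "\<And>n. N (c n) > real (Suc n) * norm (V (c n))"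
    by metis
  have Npos: "N (c n) > 0" for n
    by (rule le_less_trans[OF _ c[of n]]) auto
  \<comment> \<open>Scaling to total modulus 1 keeps the coefficients bounded and makes the norms of
    the sums at most \<open>1 / Suc n\<close>.\<close>
  define d where "d n b = of_real (1 / N (c n)) * c n b" for n b
  have Nd: "N (d n) = 1" for n
  proof -
    have "cmod (d n b) = cmod (c n b) / N (c n)" for b
      using Npos[of n] by (simp add: d_def norm_mult norm_divide)
    then have "N (d n) = N (c n) / N (c n)"
      unfolding N_def[of "d n"] by (simp add: N_def flip: sum_divide_distrib)
    then show ?thesis using Npos[of n] by simp
  qed
  have Vd: "V (d n) = of_real (1 / N (c n)) *\<^sub>C V (c n)" for n
    unfolding V_def d_def by (simp add: scaleC_sum scaleC_scaleC)
  have Vd_le: "norm (V (d n)) \<le> 1 / real (Suc n)" for n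
  proof -
    have "norm (V (d n)) = norm (V (c n)) / N (c n)"
      using Npos[of n] unfolding Vd by (simp add: norm_scaleC norm_divide)
    also have "\<dots> \<le> 1 / real (Suc n)"
      using c[of n] Npos[of n] by (simp add: field_simps)
    finally show ?thesis .
  qed
  have "cmod (d n b) \<le> 1" if "b \<in> B" for n b
    using member_le_sum[of b B "\<lambda>b. cmod (d n b)"] that assms(1) Nd[of n] by (simp add: N_def)
  then obtain r l where r: "strict_mono (r :: nat \<Rightarrow> nat)"
    and l: "\<And>b. b \<in> B \<Longrightarrow> (\<lambda>n. d (r n) b) \<longlonglongrightarrow> l b"
    using finite_simultaneous_subseq[OF assms(1), of d 1] by blast
  have "(\<lambda>n. N (d (r n))) \<longlonglongrightarrow> N l"
    unfolding N_def by (intro tendsto_sum tendsto_norm l)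
  then have "N l = 1" using Nd by (simp add: LIMSEQ_const_iff)
  have lim: "(\<lambda>n. d (r n) b *\<^sub>C e b) \<longlonglongrightarrow> l b *\<^sub>C e b" if "b \<in> B" for b
  proof (rule Lim_null[THEN iffD2], rule tendsto_norm_zero_cancel)
    have "(\<lambda>n. cmod (d (r n) b - l b) * norm (e b)) \<longlonglongrightarrow> 0"
      by (intro tendsto_mult_left_zero tendsto_norm_zero LIM_zero l[OF that])
    then show "(\<lambda>n. norm (d (r n) b *\<^sub>C e b - l b *\<^sub>C e b)) \<longlonglongrightarrow> 0"
      by (simp add: scaleC_diff_left[symmetric] norm_scaleC)
  qed
  have "(\<lambda>n. V (d (r n))) \<longlonglongrightarrow> V l"
    unfolding V_def by (intro tendsto_sum lim)
  moreover have "(\<lambda>n. V (d (r n))) \<longlonglongrightarrow> 0"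
  proof (rule tendsto_norm_zero_cancel, rule Lim_null_comparison)
    show "\<forall>\<^sub>F n in sequentially. norm (norm (V (d (r n)))) \<le> 1 / real (Suc (r n))"
      using Vd_le by simp
    show "(\<lambda>n. 1 / real (Suc (r n))) \<longlonglongrightarrow> 0"
      using LIMSEQ_subseq_LIMSEQ[OF LIMSEQ_Suc[OF lim_1_over_n] r] by (simp add: o_def)
  qed
  ultimately have "V l = 0" using LIMSEQ_unique by blast
  then have "\<forall>b\<in>B. l b = 0" using ind by (auto simp: complex_independent_def V_def)
  then show False using \<open>N l = 1\<close> by (simp add: N_def)
qed

text \<open>Roots of order \<open>2 ^ n\<close> remove the constant \<open>C\<close>: a ratio a/b
  above 1 has powers beyond every bound. Exponents that are powers of two suffice because k \<le>
  \<open>2 ^ k\<close>; for \<open>b = 0\<close> exponent 1 decides.\<close>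

lemma norm_le_of_power_bound:
  fixes a b C :: real
  assumes "a \<ge> 0" "b \<ge> 0" and pow: "\<And>n. a ^ (2 ^ n) \<le> C * b ^ (2 ^ n)"
  shows "a \<le> b"
proof (rule ccontr)
  assume "\<not> a \<le> b"
  then have ab: "b < a" by simp
  show False
  proof (cases "b = 0")
    case True
    then show False using pow[of 0] ab by simp
  next
    case False
    with assms ab have b: "b > 0" by simp
    then have "1 < a / b" using ab by simp
    then obtain k where k: "C < (a / b) ^ k" using real_arch_pow by blast
    have "(a / b) ^ k \<le> (a / b) ^ (2 ^ k)"
      using \<open>1 < a / b\<close> by (intro power_increasing) (auto intro: less_imp_le)
    also have "\<dots> \<le> C" using pow[of k] b by (simp add: power_divide divide_le_eq)
    finally show False using k by simp
  qed
qed

text \<open>For self-adjoint elements the C*-identity says that squaring an element squares its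
  norm, and powers stay self-adjoint, so squaring can be iterated.\<close>

lemma norm_power_self_adjoint:
  fixes x :: "'a::cstar_algebra"
  assumes "star x = x"
  shows "norm (x ^ (2 ^ n)) = norm x ^ (2 ^ n)"
proof (induction n)
  case (Suc n)
  have "star (x ^ k) = x ^ k" for k
    by (induction k) (auto simp: star_mult assms power_commutes)
  then have "norm (x ^ (2 ^ n) * x ^ (2 ^ n)) = (norm (x ^ (2 ^ n)))\<^sup>2"
    using cstar_identity[of "x ^ (2 ^ n)"] by simp
  also have "x ^ (2 ^ n) * x ^ (2 ^ n) = x ^ (2 ^ Suc n)"
    by (simp flip: power_add add: mult_2)
  finally show ?case by (simp add: Suc power_even_eq)
qed simp

text \<open>On a self-adjoint element a C*-norm is recovered from its values on the powers
  \<open>2 ^ n\<close> up to a multiplicative constant, so two equivalent C*-norms agree.\<close>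

lemma equivalent_cstar_norms_eq:
  fixes S :: "('a::cstar_algebra \<times> 'b::cstar_algebra) set"
  assumes mult: "\<And>x y x' y'. (x, y) \<in> S \<Longrightarrow> (x', y') \<in> S \<Longrightarrow> (x * x', y * y') \<in> S"
    and star: "\<And>x y. (x, y) \<in> S \<Longrightarrow> (star x, star y) \<in> S"
    and le1: "\<And>x y. (x, y) \<in> S \<Longrightarrow> norm x \<le> C * norm y"
    and le2: "\<And>x y. (x, y) \<in> S \<Longrightarrow> norm y \<le> D * norm x"
    and xy: "(x, y) \<in> S"
  shows "norm x = norm y"
proof -
  \<comment> \<open>The power argument is for self-adjoint elements; \<open>star x * x\<close> is
    one, and the C*-identity gives back the norm of \<open>x\<close>.\<close>
  define h k where "h = star x * x" and "k = star y * y"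
  have hk: "(h, k) \<in> S" using xy star mult by (simp add: h_def k_def)
  have sa: "star h = h" "star k = k" by (auto simp: h_def k_def star_mult star_star)
  \<comment> \<open>\<open>S\<close> is closed under products, so the induction starts at exponent
    1; the positive exponents cover every \<open>2 ^ n\<close>.\<close>
  have "(h ^ Suc n, k ^ Suc n) \<in> S" for n
    by (induction n) (use hk mult in auto)
  then have pow: "(h ^ (2 ^ n), k ^ (2 ^ n)) \<in> S" for n
    by (metis Suc_diff_1 zero_less_numeral zero_less_power)
  have "norm h \<le> norm k"
  proof (rule norm_le_of_power_bound)
    show "norm h ^ 2 ^ n \<le> C * norm k ^ 2 ^ n" for n
      using le1[OF pow, of n] by (simp only: norm_power_self_adjoint sa)
  qed simp_all
  moreover have "norm k \<le> norm h"
  proof (rule norm_le_of_power_bound)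
    show "norm k ^ 2 ^ n \<le> D * norm h ^ 2 ^ n" for n
      using le2[OF pow, of n] by (simp only: norm_power_self_adjoint sa)
  qed simp_all
  ultimately have "norm h = norm k" by simp
  then show ?thesis by (simp add: h_def k_def cstar_identity)
qed

text \<open>An isometric partial map with dense domain extends by completeness. It is given as a
  relation: single-valuedness and injectivity both follow from \<open>norm\<close> applied to
  differences. Completeness of the target gives the extension, completeness of the source makes the
  image all of the closure.\<close>

lemma isometric_graph_closure:
  fixes Gr :: "('a::cstar_algebra \<times> 'b::cstar_algebra) set"
  assumes one: "(1, 1) \<in> Gr"
    and add: "\<And>x y x' y'. (x, y) \<in> Gr \<Longrightarrow> (x', y') \<in> Gr \<Longrightarrow> (x + x', y + y') \<in> Gr"
    and mult: "\<And>x y x' y'. (x, y) \<in> Gr \<Longrightarrow> (x', y') \<in> Gr \<Longrightarrow> (x * x', y * y') \<in> Gr"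
    and scale: "\<And>c x y. (x, y) \<in> Gr \<Longrightarrow> (c *\<^sub>C x, c *\<^sub>C y) \<in> Gr"
    and star: "\<And>x y. (x, y) \<in> Gr \<Longrightarrow> (star x, star y) \<in> Gr"
    and norm: "\<And>x y. (x, y) \<in> Gr \<Longrightarrow> norm x = norm y"
    and dense: "closure (fst ` Gr) = UNIV"
  shows "\<exists>\<Phi>. cstar_isomorphism \<Phi> (UNIV :: 'a set) (closure (snd ` Gr))"
proof -
  \<comment> \<open>The closure of the graph, described by sequences so that limits are taken in
    both coordinates at once.\<close>
  define Q where "Q x y \<longleftrightarrow> (\<exists>X Y. (\<forall>n. (X n, Y n) \<in> Gr) \<and> X \<longlonglongrightarrow> x \<and> Y \<longlonglongrightarrow> y)" for x y
  have Qadd: "Q (x + x') (y + y')" if q: "Q x y" "Q x' y'" for x y x' y'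
  proof -
    obtain X Y where "\<forall>n. (X n, Y n) \<in> Gr" "X \<longlonglongrightarrow> x" "Y \<longlonglongrightarrow> y"
      using q(1) unfolding Q_def by blast
    moreover obtain X' Y' where "\<forall>n. (X' n, Y' n) \<in> Gr" "X' \<longlonglongrightarrow> x'" "Y' \<longlonglongrightarrow> y'"
      using q(2) unfolding Q_def by blast
    ultimately show ?thesis unfolding Q_def
      by (intro exI[of _ "\<lambda>n. X n + X' n"] exI[of _ "\<lambda>n. Y n + Y' n"] conjI allI tendsto_add add) auto
  qed
  have Qmult: "Q (x * x') (y * y')" if q: "Q x y" "Q x' y'" for x y x' y'
  proof -
    obtain X Y where "\<forall>n. (X n, Y n) \<in> Gr" "X \<longlonglongrightarrow> x" "Y \<longlonglongrightarrow> y"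
      using q(1) unfolding Q_def by blast
    moreover obtain X' Y' where "\<forall>n. (X' n, Y' n) \<in> Gr" "X' \<longlonglongrightarrow> x'" "Y' \<longlonglongrightarrow> y'"
      using q(2) unfolding Q_def by blast
    ultimately show ?thesis unfolding Q_def
      by (intro exI[of _ "\<lambda>n. X n * X' n"] exI[of _ "\<lambda>n. Y n * Y' n"] conjI allI tendsto_mult mult) auto
  qed
  have Qscale: "Q (c *\<^sub>C x) (c *\<^sub>C y)" if q: "Q x y" for c x y
  proof -
    obtain X Y where "\<forall>n. (X n, Y n) \<in> Gr" "X \<longlonglongrightarrow> x" "Y \<longlonglongrightarrow> y"
      using q unfolding Q_def by blast
    then show ?thesis unfolding Q_def
      by (intro exI[of _ "\<lambda>n. c *\<^sub>C X n"] exI[of _ "\<lambda>n. c *\<^sub>C Y n"] conjI allI tendsto_scaleC scale) auto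
  qed
  have Qstar: "Q (star x) (star y)" if q: "Q x y" for x y
  proof -
    obtain X Y where "\<forall>n. (X n, Y n) \<in> Gr" "X \<longlonglongrightarrow> x" "Y \<longlonglongrightarrow> y"
      using q unfolding Q_def by blast
    then show ?thesis unfolding Q_def
      by (intro exI[of _ "\<lambda>n. star (X n)"] exI[of _ "\<lambda>n. star (Y n)"] conjI allI tendsto_star star) auto
  qed
  have Qone: "Q 1 1"
    unfolding Q_def using one by (intro exI[of _ "\<lambda>_. 1"]) auto
  have Qnorm: "norm x = norm y" if "Q x y" for x y
  proof -
    obtain X Y where XY: "\<And>n. (X n, Y n) \<in> Gr" and lim: "X \<longlonglongrightarrow> x" "Y \<longlonglongrightarrow> y"
      using \<open>Q x y\<close> unfolding Q_def by blast
    have "(\<lambda>n. norm (X n)) \<longlonglongrightarrow> norm x" "(\<lambda>n. norm (Y n)) \<longlonglongrightarrow> norm y"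
      using lim by (auto intro: tendsto_norm)
    then show ?thesis using norm[OF XY] LIMSEQ_unique by auto
  qed
  have Qdiff: "Q (x - x') (y - y')" if "Q x y" "Q x' y'" for x y x' y'
    using Qadd[OF that(1) Qscale[OF that(2), of "-1"]] by (simp add: scaleC_minus_1)
  have Cauchy_iff: "Cauchy X \<longleftrightarrow> Cauchy Y" if XY: "\<And>n. (X n, Y n) \<in> Gr" for X Y
  proof -
    have "norm (X m - X n) = norm (Y m - Y n)" for m n
      using norm[OF add[OF XY scale[OF XY, of "-1"]], of m n] by (simp add: scaleC_minus_1)
    then show ?thesis by (simp add: Cauchy_def dist_norm)
  qed
  have total: "\<exists>y. Q x y" for x
  proof -
    have "x \<in> closure (fst ` Gr)" using dense by simp
    then obtain X where X: "\<And>n. X n \<in> fst ` Gr" "X \<longlonglongrightarrow> x"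
      unfolding closure_sequential by blast
    then have "\<forall>n. \<exists>y. (X n, y) \<in> Gr" by force
    then obtain Y where XY: "\<And>n. (X n, Y n) \<in> Gr" by metis
    have "Cauchy X" using X(2) by (rule LIMSEQ_imp_Cauchy)
    then have "Cauchy Y" using Cauchy_iff[of X Y] XY by simp
    then obtain y where "Y \<longlonglongrightarrow> y"
      unfolding Cauchy_convergent_iff convergent_def by blast
    then show ?thesis using XY X(2) unfolding Q_def by blast
  qed
  have onto: "\<exists>x. Q x y" if y: "y \<in> closure (snd ` Gr)" for y
  proof -
    obtain Y where Y: "\<And>n. Y n \<in> snd ` Gr" "Y \<longlonglongrightarrow> y"
      using y unfolding closure_sequential by blast
    then have "\<forall>n. \<exists>x. (x, Y n) \<in> Gr" by force
    then obtain X where XY: "\<And>n. (X n, Y n) \<in> Gr" by metis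
    have "Cauchy Y" using Y(2) by (rule LIMSEQ_imp_Cauchy)
    then have "Cauchy X" using Cauchy_iff[of X Y] XY by simp
    then obtain x where "X \<longlonglongrightarrow> x"
      unfolding Cauchy_convergent_iff convergent_def by blast
    then show ?thesis using XY Y(2) unfolding Q_def by blast
  qed
  have uniq: "y = y'" if "Q x y" "Q x y'" for x y y'
    using Qnorm[OF Qdiff[OF that]] by simp
  have inj: "x = x'" if "Q x y" "Q x' y" for x x' y
    using Qnorm[OF Qdiff[OF that]] by simp
  have range: "y \<in> closure (snd ` Gr)" if q: "Q x y" for x y
  proof -
    obtain X Y where "\<forall>n. (X n, Y n) \<in> Gr" "Y \<longlonglongrightarrow> y"
      using q unfolding Q_def by blast
    then show ?thesis
      unfolding closure_sequential by (metis image_eqI snd_conv)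
  qed
  obtain \<Phi> where \<Phi>: "\<And>x. Q x (\<Phi> x)" using total by metis
  have \<Phi>_eq: "\<Phi> x = y" if "Q x y" for x y using uniq \<Phi> that by blast
  have "bij_betw \<Phi> UNIV (closure (snd ` Gr))"
    unfolding bij_betw_def
  proof
    show "inj \<Phi>" by (metis injI inj \<Phi>)
    show "range \<Phi> = closure (snd ` Gr)" using range \<Phi> onto \<Phi>_eq by blast
  qed
  moreover have "\<Phi> (x + y) = \<Phi> x + \<Phi> y" "\<Phi> (x * y) = \<Phi> x * \<Phi> y" for x y
    by (intro \<Phi>_eq Qadd Qmult \<Phi>)+
  moreover have "\<Phi> 1 = 1" "\<Phi> (c *\<^sub>C x) = c *\<^sub>C \<Phi> x" "\<Phi> (star x) = star (\<Phi> x)" for c x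
    by (intro \<Phi>_eq Qone Qscale Qstar \<Phi>)+
  moreover have "norm (\<Phi> x) = norm x" for x using Qnorm[OF \<Phi>] by simp
  ultimately have "cstar_isomorphism \<Phi> UNIV (closure (snd ` Gr))"
    unfolding cstar_isomorphism_def by blast
  then show ?thesis by blast
qed


section \<open>Families with the twisted exchange relations\<close>

locale finite_normal = normal H G for H :: "'g set" and G :: "('g, 'z) monoid_scheme" (structure) +
  assumes finite_carrier: "finite (carrier G)"
begin

lemma H_carrier: "h \<in> H \<Longrightarrow> h \<in> carrier G"
  using subset by blast

lemma finite_H: "finite H"
  using finite_subset[OF subset finite_carrier] .

lemma conj_H: "g \<in> carrier G \<Longrightarrow> h \<in> H \<Longrightarrow> g \<otimes> h \<otimes> inv g \<in> H"
  using inv_op_closed2 by simp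

lemma conj_H': "g \<in> carrier G \<Longrightarrow> h \<in> H \<Longrightarrow> inv g \<otimes> h \<otimes> g \<in> H"
  using inv_op_closed1 by simp

lemma site_basis_carrier: "p \<in> site_basis G H i \<Longrightarrow> p \<in> carrier G"
  by (auto simp: site_basis_def H_carrier split: if_splits)

lemma finite_site_basis: "finite (site_basis G H i)"
  by (simp add: site_basis_def finite_H finite_carrier)

lemma finite_tensor_basis: "finite (tensor_basis G H n m)"
  unfolding tensor_basis_def by (intro finite_PiE finite_site_basis) simp

lemma twist_closed:
  assumes "p \<in> site_basis G H j" "q \<in> site_basis G H i"
  shows "fst (twist G i j p q) \<in> site_basis G H i" "snd (twist G i j p q) \<in> site_basis G H j"
  using assms by (auto simp: twist_def site_basis_def H_carrier)

end

text \<open>The relations between basis vectors of the algebras A_i, stated for elements of an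
  arbitrary C*-algebra. They are verified once in the tensor product and once in the field algebra;
  the multiplication of ordered products is then handled for both together.\<close>

definition twisted_family ::
  "('g, 'z) monoid_scheme \<Rightarrow> 'g set \<Rightarrow> (int \<Rightarrow> 'g \<Rightarrow> 'c::cstar_algebra) \<Rightarrow> bool" where
  "twisted_family G H u \<longleftrightarrow>
     (\<forall>i. even i \<longrightarrow> u i \<one>\<^bsub>G\<^esub> = 1) \<and>
     (\<forall>i. odd i \<longrightarrow> (\<Sum>g\<in>carrier G. u i g) = 1) \<and>
     (\<forall>i. \<forall>p\<in>site_basis G H i. \<forall>q\<in>site_basis G H i.
        u i p * u i q = (if even i then u i (p \<otimes>\<^bsub>G\<^esub> q) else if p = q then u i p else 0)) \<and>
     (\<forall>i. \<forall>p\<in>site_basis G H i. star (u i p) = (if even i then u i (inv\<^bsub>G\<^esub> p) else u i p)) \<and>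
     (\<forall>i j. i < j \<longrightarrow> (\<forall>p\<in>site_basis G H j. \<forall>q\<in>site_basis G H i.
        u j p * u i q = u i (fst (twist G i j p q)) * u j (snd (twist G i j p q))))"

lemma
  assumes "twisted_family G H u"
  shows twisted_family_one: "even i \<Longrightarrow> u i \<one>\<^bsub>G\<^esub> = 1"
    and twisted_family_sum: "odd i \<Longrightarrow> (\<Sum>g\<in>carrier G. u i g) = 1"
    and twisted_family_mult: "p \<in> site_basis G H i \<Longrightarrow> q \<in> site_basis G H i \<Longrightarrow>
      u i p * u i q = (if even i then u i (p \<otimes>\<^bsub>G\<^esub> q) else if p = q then u i p else 0)"
    and twisted_family_star: "p \<in> site_basis G H i \<Longrightarrow>
      star (u i p) = (if even i then u i (inv\<^bsub>G\<^esub> p) else u i p)"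
    and twisted_family_exchange: "i < j \<Longrightarrow> p \<in> site_basis G H j \<Longrightarrow> q \<in> site_basis G H i \<Longrightarrow>
      u j p * u i q = u i (fst (twist G i j p q)) * u j (snd (twist G i j p q))"
  using assms by (simp_all only: twisted_family_def not_False_eq_True)

definition ordered_product :: "(int \<Rightarrow> 'g \<Rightarrow> 'c::cstar_algebra) \<Rightarrow> int \<Rightarrow> int \<Rightarrow> (int \<Rightarrow> 'g) \<Rightarrow> 'c" where
  "ordered_product u n m b = foldr (\<lambda>i z. u i (b i) * z) [n..m] 1"

lemma ordered_product_empty: "m < n \<Longrightarrow> ordered_product u n m b = 1"
  by (simp add: ordered_product_def)

lemma ordered_product_rec:
  "n \<le> m \<Longrightarrow> ordered_product u n m b = u n (b n) * ordered_product u (n + 1) m b"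
  by (simp add: ordered_product_def upto_rec1)

lemma ordered_product_cong:
  "(\<And>i. i \<in> {n..m} \<Longrightarrow> b i = b' i) \<Longrightarrow> ordered_product u n m b = ordered_product u n m b'"
  unfolding ordered_product_def by (rule foldr_cong) auto

text \<open>Two families are carried side by side, so that each rewriting of a product uses the same
  group elements in both algebras. The only link between \<open>u\<close> and \<open>v\<close> is
  that they obey the same relations.\<close>

locale twisted_pair = finite_normal H G
  for H :: "'g set" and G :: "('g, 'z) monoid_scheme" (structure) +
  fixes u :: "int \<Rightarrow> 'g \<Rightarrow> 'a::cstar_algebra" and v :: "int \<Rightarrow> 'g \<Rightarrow> 'b::cstar_algebra"
  assumes family_u: "twisted_family G H u" and family_v: "twisted_family G H v"
begin

text \<open>The graph of the isomorphism over one interval.  Showing that it is closed under the algebra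
  operations avoids computing coordinates of products.\<close>

definition product_pairs :: "int \<Rightarrow> int \<Rightarrow> ('a \<times> 'b) set" where
  "product_pairs n m =
     range (\<lambda>c. (\<Sum>b\<in>tensor_basis G H n m. c b *\<^sub>C ordered_product u n m b,
                 \<Sum>b\<in>tensor_basis G H n m. c b *\<^sub>C ordered_product v n m b))"

lemma pairs_add:
  assumes "(x, y) \<in> product_pairs n m" "(x', y') \<in> product_pairs n m"
  shows "(x + x', y + y') \<in> product_pairs n m"
proof -
  obtain c d where "x = (\<Sum>b\<in>tensor_basis G H n m. c b *\<^sub>C ordered_product u n m b)"
    "y = (\<Sum>b\<in>tensor_basis G H n m. c b *\<^sub>C ordered_product v n m b)"
    "x' = (\<Sum>b\<in>tensor_basis G H n m. d b *\<^sub>C ordered_product u n m b)"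
    "y' = (\<Sum>b\<in>tensor_basis G H n m. d b *\<^sub>C ordered_product v n m b)"
    using assms unfolding product_pairs_def by auto
  then show ?thesis
    unfolding product_pairs_def
    by (intro image_eqI[of _ _ "\<lambda>b. c b + d b"]) (auto simp: scaleC_add_left sum.distrib)
qed

lemma pairs_scale:
  assumes "(x, y) \<in> product_pairs n m"
  shows "(a *\<^sub>C x, a *\<^sub>C y) \<in> product_pairs n m"
proof -
  obtain c where "x = (\<Sum>b\<in>tensor_basis G H n m. c b *\<^sub>C ordered_product u n m b)"
    "y = (\<Sum>b\<in>tensor_basis G H n m. c b *\<^sub>C ordered_product v n m b)"
    using assms unfolding product_pairs_def by auto
  then show ?thesis
    unfolding product_pairs_def
    by (intro image_eqI[of _ _ "\<lambda>b. a * c b"]) (auto simp: scaleC_scaleC scaleC_sum)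
qed

lemma pairs_zero: "(0, 0) \<in> product_pairs n m"
  unfolding product_pairs_def by (intro image_eqI[of _ _ "\<lambda>_. 0"]) auto

lemma pairs_sum:
  assumes "\<And>i. i \<in> I \<Longrightarrow> (f i, g i) \<in> product_pairs n m"
  shows "(sum f I, sum g I) \<in> product_pairs n m"
  using assms by (induction I rule: infinite_finite_induct) (auto intro: pairs_zero pairs_add)

text \<open>Only the values of \<open>b\<close> on the interval matter, so \<open>b\<close> may be
  changed at single sites by function update; the restriction is its extensional representative in
  the index set.\<close>

lemma pairs_product:
  assumes "\<And>i. i \<in> {n..m} \<Longrightarrow> b i \<in> site_basis G H i"
  shows "(ordered_product u n m b, ordered_product v n m b) \<in> product_pairs n m"
proof -
  let ?b = "restrict b {n..m}"
  have b: "?b \<in> tensor_basis G H n m"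
    using assms by (auto simp: tensor_basis_def)
  have eq: "ordered_product w n m b = ordered_product w n m ?b" for w :: "int \<Rightarrow> 'g \<Rightarrow> 'c::cstar_algebra"
    by (rule ordered_product_cong) auto
  have sum: "(\<Sum>b\<in>tensor_basis G H n m. (if b = ?b then 1 else 0) *\<^sub>C f b) = f ?b"
    for f :: "(int \<Rightarrow> 'g) \<Rightarrow> 'c::cstar_algebra"
    using b sum.remove[OF finite_tensor_basis b, of "\<lambda>b. (if b = ?b then 1 else 0) *\<^sub>C f b"]
    by (simp add: sum.neutral)
  show ?thesis
    unfolding product_pairs_def eq
    by (rule image_eqI[of _ _ "\<lambda>b. if b = ?b then 1 else 0"]) (simp_all only: sum UNIV_I)
qed

text \<open>The closure properties below are additive and homogeneous in the pair, so this reduces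
  them to pairs of single ordered products with the same index.\<close>

lemma pairs_induct [consumes 1, case_names product zero add scale]:
  assumes "(x, y) \<in> product_pairs n m"
    and product: "\<And>b. b \<in> tensor_basis G H n m \<Longrightarrow> Q (ordered_product u n m b) (ordered_product v n m b)"
    and zero: "Q 0 0"
    and add: "\<And>x y x' y'. Q x y \<Longrightarrow> Q x' y' \<Longrightarrow> Q (x + x') (y + y')"
    and scale: "\<And>c x y. Q x y \<Longrightarrow> Q (c *\<^sub>C x) (c *\<^sub>C y)"
  shows "Q x y"
proof -
  obtain c where xy: "x = (\<Sum>b\<in>tensor_basis G H n m. c b *\<^sub>C ordered_product u n m b)"
    "y = (\<Sum>b\<in>tensor_basis G H n m. c b *\<^sub>C ordered_product v n m b)"
    using assms(1) unfolding product_pairs_def by auto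
  have "Q (\<Sum>b\<in>B. c b *\<^sub>C ordered_product u n m b) (\<Sum>b\<in>B. c b *\<^sub>C ordered_product v n m b)"
    if "B \<subseteq> tensor_basis G H n m" for B
    using finite_subset[OF that finite_tensor_basis] that
    by (induction B rule: finite_induct) (auto intro: zero add scale product)
  then show ?thesis by (simp add: xy)
qed

lemmas mult_u = twisted_family_mult[OF family_u] and mult_v = twisted_family_mult[OF family_v]
lemmas exchange_u = twisted_family_exchange[OF family_u]
  and exchange_v = twisted_family_exchange[OF family_v]
lemmas star_u = twisted_family_star[OF family_u] and star_v = twisted_family_star[OF family_v]

text \<open>The generator travels to the right by the exchange relation until it meets the factor of
  its own site, which absorbs or annihilates it. Neither step creates a sum, so the outcome is one
  ordered product or 0; labels are computed by group operations alone, so \<open>u\<close> and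
  \<open>v\<close> share the outcome.\<close>

lemma generator_mult_product:
  assumes "n \<le> k" "k \<le> m" "q \<in> site_basis G H k" "\<And>i. i \<in> {n..m} \<Longrightarrow> b i \<in> site_basis G H i"
  shows "(\<exists>b'. (\<forall>i\<in>{n..m}. b' i \<in> site_basis G H i) \<and>
             u k q * ordered_product u n m b = ordered_product u n m b' \<and>
             v k q * ordered_product v n m b = ordered_product v n m b') \<or>
         u k q * ordered_product u n m b = 0 \<and> v k q * ordered_product v n m b = 0"
  using assms
proof (induction n arbitrary: q rule: int_le_induct[where k = k, case_names base step])
  case base
  have bk: "b k \<in> site_basis G H k" using base by auto
  have upd: "ordered_product w (k + 1) m (b(k := p)) = ordered_product w (k + 1) m b"
    for p and w :: "int \<Rightarrow> 'g \<Rightarrow> 'c::cstar_algebra"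
    by (rule ordered_product_cong) auto
  have u: "u k q * ordered_product u k m b = (u k q * u k (b k)) * ordered_product u (k + 1) m b"
    and v: "v k q * ordered_product v k m b = (v k q * v k (b k)) * ordered_product v (k + 1) m b"
    using base by (simp_all add: ordered_product_rec mult.assoc)
  show ?case
  \<comment> \<open>Group elements multiply to a group element, whereas indicator functions multiply
    to 0 unless they coincide.\<close>
  proof (cases "even k \<or> q = b k")
    case True
    define p where "p = (if even k then q \<otimes> b k else q)"
    have "p \<in> site_basis G H k"
      using base(2) bk by (auto simp: p_def site_basis_def)
    moreover have "u k q * u k (b k) = u k p" "v k q * v k (b k) = v k p"
      using True mult_u[OF base(2) bk] mult_v[OF base(2) bk] by (auto simp: p_def)
    ultimately show ?thesis
      using base unfolding u v
      by (intro disjI1 exI[of _ "b(k := p)"]) (simp_all add: ordered_product_rec upd del: fun_upd_apply, simp)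
  next
    case False
    then show ?thesis
      unfolding u v using mult_u[OF base(2) bk] mult_v[OF base(2) bk] by simp
  qed
next
  case (step n)
  \<comment> \<open>Passing the factor at \<open>n - 1\<close> changes the label \<open>q\<close> to
    \<open>?s\<close> but leaves the generator at site \<open>k\<close>; hence the label is
    arbitrary in the induction.\<close>
  let ?r = "fst (twist G (n - 1) k q (b (n - 1)))" and ?s = "snd (twist G (n - 1) k q (b (n - 1)))"
  have nk: "n - 1 < k" "n - 1 \<le> m" using step by auto
  have bn: "b (n - 1) \<in> site_basis G H (n - 1)" using step nk by auto
  have r: "?r \<in> site_basis G H (n - 1)" and s: "?s \<in> site_basis G H k"
    using twist_closed[OF step.prems(2) bn] by auto
  have u: "u k q * ordered_product u (n - 1) m b = u (n - 1) ?r * (u k ?s * ordered_product u n m b)"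
    using nk exchange_u[OF nk(1) step.prems(2) bn]
    by (simp add: ordered_product_rec flip: mult.assoc)
  have v: "v k q * ordered_product v (n - 1) m b = v (n - 1) ?r * (v k ?s * ordered_product v n m b)"
    using nk exchange_v[OF nk(1) step.prems(2) bn]
    by (simp add: ordered_product_rec flip: mult.assoc)
  have IH: "(\<exists>b'. (\<forall>i\<in>{n..m}. b' i \<in> site_basis G H i) \<and>
             u k ?s * ordered_product u n m b = ordered_product u n m b' \<and>
             v k ?s * ordered_product v n m b = ordered_product v n m b') \<or>
         u k ?s * ordered_product u n m b = 0 \<and> v k ?s * ordered_product v n m b = 0"
    using step s by (intro step.IH) auto
  then show ?case
  proof (elim disjE exE conjE)
    fix b' assume b': "\<forall>i\<in>{n..m}. b' i \<in> site_basis G H i"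
      "u k ?s * ordered_product u n m b = ordered_product u n m b'"
      "v k ?s * ordered_product v n m b = ordered_product v n m b'"
    have upd: "ordered_product w n m (b'(n - 1 := ?r)) = ordered_product w n m b'"
      for w :: "int \<Rightarrow> 'g \<Rightarrow> 'c::cstar_algebra"
      by (rule ordered_product_cong) auto
    show ?thesis
      unfolding u v b'(2,3) using nk b'(1) r
      by (intro disjI1 exI[of _ "b'(n - 1 := ?r)"]) (simp_all add: ordered_product_rec upd del: fun_upd_apply, simp)
  qed (simp add: u v)
qed

lemma pairs_generator:
  assumes "(x, y) \<in> product_pairs n m" "k \<in> {n..m}" "q \<in> site_basis G H k"
  shows "(u k q * x, v k q * y) \<in> product_pairs n m"
  using assms(1)
proof (induction rule: pairs_induct)
  case (product b)
  then have "\<And>i. i \<in> {n..m} \<Longrightarrow> b i \<in> site_basis G H i"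
    by (auto simp: tensor_basis_def)
  then have "(\<exists>b'. (\<forall>i\<in>{n..m}. b' i \<in> site_basis G H i) \<and>
             u k q * ordered_product u n m b = ordered_product u n m b' \<and>
             v k q * ordered_product v n m b = ordered_product v n m b') \<or>
         u k q * ordered_product u n m b = 0 \<and> v k q * ordered_product v n m b = 0"
    using assms(2,3) by (intro generator_mult_product) auto
  then show ?case
    by (elim disjE exE conjE) (auto intro: pairs_product pairs_zero)
qed (auto simp: distrib_left scaleC_mult_right intro: pairs_zero pairs_add pairs_scale)

text \<open>The factors are multiplied in one by one with \<open>pairs_generator\<close>. The
  product may live on a smaller interval than the pair, which is what enlarging intervals requires;
  \<open>n = m + 1\<close> is the empty product.\<close>

lemma pairs_product_mult:
  assumes "n \<le> m + 1" "N \<le> n" "m \<le> M" "(x, y) \<in> product_pairs N M"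
    and "\<And>i. i \<in> {n..m} \<Longrightarrow> b i \<in> site_basis G H i"
  shows "(ordered_product u n m b * x, ordered_product v n m b * y) \<in> product_pairs N M"
  using assms
proof (induction n rule: int_le_induct[where k = "m + 1", case_names base step])
  case (step n)
  have "(u (n - 1) (b (n - 1)) * (ordered_product u n m b * x),
         v (n - 1) (b (n - 1)) * (ordered_product v n m b * y)) \<in> product_pairs N M"
    using step by (intro pairs_generator step.IH) auto
  then show ?case using step by (simp add: ordered_product_rec mult.assoc)
qed (auto simp: ordered_product_empty)

text \<open>The adjoint of an ordered product has its factors in reverse order. Letting it act on a
  pair avoids reordering: the adjoint of the leftmost original factor acts on the pair first, so the
  pair varies in the induction.\<close>

lemma pairs_star_product_mult:
  assumes "n \<le> m + 1" "N \<le> n" "m \<le> M" "(x, y) \<in> product_pairs N M"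
    and "\<And>i. i \<in> {n..m} \<Longrightarrow> b i \<in> site_basis G H i"
  shows "(star (ordered_product u n m b) * x, star (ordered_product v n m b) * y) \<in> product_pairs N M"
  using assms
proof (induction n arbitrary: x y rule: int_le_induct[where k = "m + 1", case_names base step])
  case (step n)
  have b: "b (n - 1) \<in> site_basis G H (n - 1)" using step by auto
  define p where "p = (if even (n - 1) then inv (b (n - 1)) else b (n - 1))"
  have p: "p \<in> site_basis G H (n - 1)"
    using b by (auto simp: p_def site_basis_def)
  have su: "star (u (n - 1) (b (n - 1))) = u (n - 1) p"
    and sv: "star (v (n - 1) (b (n - 1))) = v (n - 1) p"
    using star_u[OF b] star_v[OF b] by (simp_all add: p_def)
  have "(star (ordered_product u n m b) * (u (n - 1) p * x),
         star (ordered_product v n m b) * (v (n - 1) p * y)) \<in> product_pairs N M"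
    using step p by (intro step.IH pairs_generator) auto
  then show ?case
    using step by (simp add: ordered_product_rec star_mult su sv mult.assoc)
qed (auto simp: ordered_product_empty)

text \<open>At an odd site the unit is the sum of all indicator functions, so in general it is not a
  single ordered product. The interval is extended to the left one site at a time, inserting the
  unit of each new site.\<close>

lemma pairs_one:
  assumes "n \<le> m + 1"
  shows "(1, 1) \<in> product_pairs n m"
  using assms
proof (induction n rule: int_le_induct[where k = "m + 1", case_names base step])
  case base
  then show ?case using pairs_product[of "m + 1" m] by (simp add: ordered_product_empty)
next
  case (step n)
  have ext: "(u (n - 1) q * x, v (n - 1) q * y) \<in> product_pairs (n - 1) m"
    if "(x, y) \<in> product_pairs n m" and q: "q \<in> site_basis G H (n - 1)" for q x y
    using that(1)
  proof (induction rule: pairs_induct)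
    case (product b)
    have upd: "ordered_product w n m (b(n - 1 := q)) = ordered_product w n m b"
      for w :: "int \<Rightarrow> 'g \<Rightarrow> 'c::cstar_algebra"
      by (rule ordered_product_cong) auto
    have "(ordered_product u (n - 1) m (b(n - 1 := q)), ordered_product v (n - 1) m (b(n - 1 := q)))
      \<in> product_pairs (n - 1) m"
      using product q by (intro pairs_product) (auto simp: tensor_basis_def)
    then show ?case using step(1) by (simp add: ordered_product_rec upd)
  qed (auto simp: distrib_left scaleC_mult_right intro: pairs_zero pairs_add pairs_scale)
  show ?case
  proof (cases "even (n - 1)")
    case True
    then have "u (n - 1) \<one> = 1" "v (n - 1) \<one> = 1"
      using twisted_family_one[OF family_u] twisted_family_one[OF family_v] by blast+
    then show ?thesis
      using ext[OF step.IH, of \<one>] step True by (simp add: site_basis_def)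
  next
    case False
    then have "(\<Sum>g\<in>carrier G. u (n - 1) g) = 1" "(\<Sum>g\<in>carrier G. v (n - 1) g) = 1"
      using twisted_family_sum[OF family_u] twisted_family_sum[OF family_v] by blast+
    moreover have "(\<Sum>g\<in>carrier G. u (n - 1) g * 1, \<Sum>g\<in>carrier G. v (n - 1) g * 1)
        \<in> product_pairs (n - 1) m"
      using False step by (intro pairs_sum ext step.IH) (auto simp: site_basis_def)
    ultimately show ?thesis by simp
  qed
qed

lemma pairs_mult:
  assumes "n \<le> m + 1" "(x, y) \<in> product_pairs n m" "(x', y') \<in> product_pairs n m"
  shows "(x * x', y * y') \<in> product_pairs n m"
  using assms(2)
proof (induction rule: pairs_induct)
  case (product b)
  then show ?case
    using assms by (intro pairs_product_mult) (auto simp: tensor_basis_def)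
qed (auto simp: distrib_right scaleC_mult_left intro: pairs_zero pairs_add pairs_scale)

lemma pairs_star:
  assumes "n \<le> m + 1" "(x, y) \<in> product_pairs n m"
  shows "(star x, star y) \<in> product_pairs n m"
  using assms(2)
proof (induction rule: pairs_induct)
  case (product b)
  then have "(star (ordered_product u n m b) * 1, star (ordered_product v n m b) * 1) \<in> product_pairs n m"
    using assms(1) by (intro pairs_star_product_mult pairs_one) (auto simp: tensor_basis_def)
  then show ?case by simp
qed (auto simp: star_add star_scaleC intro: pairs_zero pairs_add pairs_scale)

text \<open>The product over the small interval is applied to the unit pair of the large one, the
  counterpart of inserting units in the additional slots.\<close>

lemma pairs_mono:
  assumes "n \<le> m + 1" "N \<le> n" "m \<le> M" "(x, y) \<in> product_pairs n m"
  shows "(x, y) \<in> product_pairs N M"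
  using assms(4)
proof (induction rule: pairs_induct)
  case (product b)
  then have "(ordered_product u n m b * 1, ordered_product v n m b * 1) \<in> product_pairs N M"
    using assms by (intro pairs_product_mult pairs_one) (auto simp: tensor_basis_def)
  then show ?case by simp
qed (auto intro: pairs_zero pairs_add pairs_scale)

definition all_pairs :: "('a \<times> 'b) set" where
  "all_pairs = (\<Union>(n, m)\<in>{(n, m). n < m}. product_pairs n m)"

lemma all_pairs_common:
  assumes "z \<in> all_pairs" "z' \<in> all_pairs"
  obtains n m where "n < m" "z \<in> product_pairs n m" "z' \<in> product_pairs n m"
proof -
  obtain n m n' m' where *: "n < m" "z \<in> product_pairs n m" "n' < m'" "z' \<in> product_pairs n' m'"
    using assms unfolding all_pairs_def by auto
  have "z \<in> product_pairs (min n n') (max m m')" "z' \<in> product_pairs (min n n') (max m m')"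
    using * pairs_mono[of n m "min n n'" "max m m'" "fst z" "snd z"]
      pairs_mono[of n' m' "min n n'" "max m m'" "fst z'" "snd z'"] by auto
  then show ?thesis using * by (intro that[of "min n n'" "max m m'"]) auto
qed

lemma all_pairsI: "n < m \<Longrightarrow> z \<in> product_pairs n m \<Longrightarrow> z \<in> all_pairs"
  unfolding all_pairs_def by blast

text \<open>Over one interval, independence bounds the coefficients by the norm on either side, so
  the two norms are equivalent there, with constants depending on the interval. The C*-identity
  makes them equal, and equality survives the union over all intervals.\<close>

theorem isomorphism_of_independent_families:
  assumes "\<And>n m. n < m \<Longrightarrow> complex_independent (tensor_basis G H n m) (ordered_product u n m)"
    and "\<And>n m. n < m \<Longrightarrow> complex_independent (tensor_basis G H n m) (ordered_product v n m)"
    and "closure (fst ` all_pairs) = UNIV"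
  shows "\<exists>\<Phi>. cstar_isomorphism \<Phi> (UNIV :: 'a set) (closure (snd ` all_pairs))"
proof (rule isometric_graph_closure)
  show "(1, 1) \<in> all_pairs"
    by (rule all_pairsI[of 0 1]) (auto intro: pairs_one)
  show "closure (fst ` all_pairs) = UNIV" by fact
  fix x y assume xy: "(x, y) \<in> all_pairs"
  then obtain n m where nm: "n < m" "(x, y) \<in> product_pairs n m"
    unfolding all_pairs_def by auto
  show "(c *\<^sub>C x, c *\<^sub>C y) \<in> all_pairs" for c
    using nm by (blast intro: all_pairsI pairs_scale)
  show "(star x, star y) \<in> all_pairs"
    using nm by (auto intro!: all_pairsI pairs_star)
  \<comment> \<open>Independence of \<open>w'\<close> bounds the coefficients by the norm of its
    sum, and the triangle inequality bounds the sum over \<open>w\<close> by the coefficients. This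
    is used with the two families in both orders.\<close>
  have bound: "\<exists>C. \<forall>c. norm (\<Sum>b\<in>tensor_basis G H n m. c b *\<^sub>C ordered_product w n m b)
      \<le> C * norm (\<Sum>b\<in>tensor_basis G H n m. c b *\<^sub>C ordered_product w' n m b)"
    if ind: "complex_independent (tensor_basis G H n m) (ordered_product w' n m)"
    for w :: "int \<Rightarrow> 'g \<Rightarrow> 'c::cstar_algebra" and w' :: "int \<Rightarrow> 'g \<Rightarrow> 'd::cstar_algebra"
  proof -
    obtain K where K: "\<And>c. (\<Sum>b\<in>tensor_basis G H n m. cmod (c b)) \<le>
        K * norm (\<Sum>b\<in>tensor_basis G H n m. c b *\<^sub>C ordered_product w' n m b)"
      using independent_coefficients_bounded[OF finite_tensor_basis ind] by blast
    define L where "L = (\<Sum>b\<in>tensor_basis G H n m. norm (ordered_product w n m b))"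
    have "norm (\<Sum>b\<in>tensor_basis G H n m. c b *\<^sub>C ordered_product w n m b)
        \<le> (L * K) * norm (\<Sum>b\<in>tensor_basis G H n m. c b *\<^sub>C ordered_product w' n m b)" for c
    proof -
      have "norm (\<Sum>b\<in>tensor_basis G H n m. c b *\<^sub>C ordered_product w n m b)
          \<le> (\<Sum>b\<in>tensor_basis G H n m. cmod (c b) * norm (ordered_product w n m b))"
        by (rule norm_sum[THEN order_trans]) (simp add: norm_scaleC)
      also have "\<dots> \<le> (\<Sum>b\<in>tensor_basis G H n m. cmod (c b) * L)"
        unfolding L_def
        by (intro sum_mono mult_left_mono member_le_sum finite_tensor_basis) auto
      also have "\<dots> = L * (\<Sum>b\<in>tensor_basis G H n m. cmod (c b))"
        by (simp add: mult.commute[of _ L] flip: sum_distrib_left)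
      also have "\<dots> \<le> L * (K * norm (\<Sum>b\<in>tensor_basis G H n m. c b *\<^sub>C ordered_product w' n m b))"
        by (intro mult_left_mono K) (simp add: L_def sum_nonneg)
      finally show ?thesis by (simp add: mult.assoc)
    qed
    then show ?thesis by blast
  qed
  obtain C where C: "\<And>x y. (x, y) \<in> product_pairs n m \<Longrightarrow> norm x \<le> C * norm y"
    using bound[OF assms(2)[OF nm(1)], of u] unfolding product_pairs_def by auto
  obtain D where D: "\<And>x y. (x, y) \<in> product_pairs n m \<Longrightarrow> norm y \<le> D * norm x"
    using bound[OF assms(1)[OF nm(1)], of v] unfolding product_pairs_def by auto
  show "norm x = norm y"
    by (rule equivalent_cstar_norms_eq[of "product_pairs n m" C D, OF _ _ C D nm(2)])
       (use nm(1) in \<open>auto intro: pairs_mult pairs_star\<close>)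
  fix x' y' assume "(x', y') \<in> all_pairs"
  with xy obtain n m where "n < m" "(x, y) \<in> product_pairs n m" "(x', y') \<in> product_pairs n m"
    by (rule all_pairs_common)
  then show "(x + x', y + y') \<in> all_pairs" "(x * x', y * y') \<in> all_pairs"
    by (auto intro!: all_pairsI pairs_add pairs_mult)
qed

end


section \<open>The local field algebra as a quotient of a free algebra\<close>

text \<open>Only monomials occurring in \<open>p\<close> have to be treated, so facts about the
  letters of \<open>p\<close> remain available in the base case.\<close>

lemma poly_mapping_single_induct [case_names single zero add]:
  assumes "\<And>w c. w \<in> Poly_Mapping.keys p \<Longrightarrow> Q (Poly_Mapping.single w c)"
    and "Q 0" and "\<And>a b. Q a \<Longrightarrow> Q b \<Longrightarrow> Q (a + b)"
  shows "Q (p :: 'b \<Rightarrow>\<^sub>0 'c::comm_monoid_add)"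
proof -
  have "p = (\<Sum>w\<in>Poly_Mapping.keys p. Poly_Mapping.single w (Poly_Mapping.lookup p w))"
    by (intro poly_mapping_eqI) (auto simp: lookup_sum lookup_single when_def in_keys_iff)
  moreover have "Q (\<Sum>w\<in>W. Poly_Mapping.single w (Poly_Mapping.lookup p w))"
    if "W \<subseteq> Poly_Mapping.keys p" for W
    using finite_subset[OF that finite_keys] that
    by (induction W rule: finite_induct) (auto intro: assms)
  ultimately show ?thesis by force
qed

lemma poly_adj_single:
  "poly_adj G (Poly_Mapping.single w c) = Poly_Mapping.single (rev (map (gen_adj G) w)) (cnj c)"
  by (simp add: poly_adj_def)

lemma poly_adj_zero: "poly_adj G 0 = 0"
  by (simp add: poly_adj_def)

lemma poly_adj_add: "poly_adj G (p + q) = poly_adj G p + poly_adj G q"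
  unfolding poly_adj_def by (rule setsum_keys_plus_distrib) (auto simp: single_add)

lemma poly_adj_mult: "poly_adj G (p * q) = poly_adj G q * poly_adj G p"
proof (induction p rule: poly_mapping_single_induct)
  case (single w c)
  show ?case
    by (induction q rule: poly_mapping_single_induct)
       (auto simp: poly_adj_zero poly_adj_add poly_adj_single mult_single plus_list_def algebra_simps)
qed (auto simp: poly_adj_zero poly_adj_add algebra_simps)

lemma single_Nil_one: "Poly_Mapping.single ([] :: 'b list) (1 :: complex) = 1"
  by (metis single_one zero_list_def)

lemma poly_adj_one: "poly_adj G 1 = 1"
  using poly_adj_single[of G "[]" 1] by (simp add: single_Nil_one)

lemma poly_adj_sum: "poly_adj G (\<Sum>i\<in>I. f i) = (\<Sum>i\<in>I. poly_adj G (f i))"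
  by (induction I rule: infinite_finite_induct) (auto simp: poly_adj_zero poly_adj_add)

lemma poly_adj_minus: "poly_adj G (- p) = - poly_adj G p"
  using poly_adj_add[of G p "- p"] by (simp add: poly_adj_zero eq_neg_iff_add_eq_0 add.commute)

lemma poly_adj_diff: "poly_adj G (p - q) = poly_adj G p - poly_adj G q"
  using poly_adj_add[of G p "- q"] by (simp add: poly_adj_minus)

section \<open>The ideal of relations and the quotient by it\<close>

context finite_normal
begin

abbreviation "field_free \<equiv> carrier (free_field G H)"

lemma field_free_iff: "p \<in> field_free \<longleftrightarrow> (\<forall>w\<in>Poly_Mapping.keys p. set w \<subseteq> field_gens G H)"
  by (simp add: free_field_def)

lemma free_field_ops [simp]:
  "p \<otimes>\<^bsub>free_field G H\<^esub> q = p * q" "p \<oplus>\<^bsub>free_field G H\<^esub> q = p + q"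
  "\<one>\<^bsub>free_field G H\<^esub> = 1" "\<zero>\<^bsub>free_field G H\<^esub> = 0"
  by (simp_all add: free_field_def)

lemma field_free_single: "set w \<subseteq> field_gens G H \<Longrightarrow> Poly_Mapping.single w c \<in> field_free"
  by (simp add: field_free_iff)

lemma field_free_zero: "0 \<in> field_free"
  by (simp add: field_free_iff)

lemma field_free_one: "1 \<in> field_free"
  by (simp add: field_free_iff zero_list_def)

lemma field_free_add: "p \<in> field_free \<Longrightarrow> q \<in> field_free \<Longrightarrow> p + q \<in> field_free"
  unfolding field_free_iff using keys_add[of p q] by blast

lemma field_free_mult:
  assumes "p \<in> field_free" "q \<in> field_free"
  shows "p * q \<in> field_free"
  unfolding field_free_iff
proof
  fix w assume "w \<in> Poly_Mapping.keys (p * q)"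
  then obtain a b where "w = a @ b" "a \<in> Poly_Mapping.keys p" "b \<in> Poly_Mapping.keys q"
    using keys_mult[of p q] by (auto simp: plus_list_def)
  then show "set w \<subseteq> field_gens G H"
    using assms by (auto simp: field_free_iff)
qed

lemma field_free_uminus: "p \<in> field_free \<Longrightarrow> - p \<in> field_free"
  by (simp add: field_free_iff in_keys_iff)

lemma field_free_diff: "p \<in> field_free \<Longrightarrow> q \<in> field_free \<Longrightarrow> p - q \<in> field_free"
  using field_free_add[of p "- q"] field_free_uminus by simp

lemma field_free_sum: "(\<And>i. i \<in> I \<Longrightarrow> f i \<in> field_free) \<Longrightarrow> sum f I \<in> field_free"
  by (induction I rule: infinite_finite_induct) (auto intro: field_free_zero field_free_add)

lemma field_free_dl: "g \<in> carrier G \<Longrightarrow> dl g x \<in> field_free"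
  by (auto intro!: field_free_single simp: field_gens_def)

lemma field_free_rh: "h \<in> H \<Longrightarrow> l \<in> half_odd \<Longrightarrow> rh h l \<in> field_free"
  by (auto intro!: field_free_single simp: field_gens_def)

lemmas field_free_intros = field_free_zero field_free_one field_free_add field_free_mult
  field_free_uminus field_free_diff field_free_sum field_free_dl field_free_rh

lemma field_free_adj:
  assumes "p \<in> field_free"
  shows "poly_adj G p \<in> field_free"
proof -
  have "gen_adj G a \<in> field_gens G H" if "a \<in> field_gens G H" for a
    using that by (auto simp: field_gens_def)
  then show ?thesis
    using assms unfolding poly_adj_def field_free_iff[of p]
    by (intro field_free_sum field_free_single) auto
qed

lemma ring_free_field: "ring (free_field G H)"
proof (rule ringI)
  show "abelian_group (free_field G H)"
  proof (rule abelian_groupI)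
    fix x assume "x \<in> field_free"
    then show "\<exists>y\<in>field_free. y \<oplus>\<^bsub>free_field G H\<^esub> x = \<zero>\<^bsub>free_field G H\<^esub>"
      by (intro bexI[of _ "- x"]) (auto intro: field_free_intros)
  qed (auto intro: field_free_intros simp: add_ac)
  show "Group.monoid (free_field G H)"
    by (rule monoidI) (auto intro: field_free_intros simp: mult.assoc)
qed (auto simp: algebra_simps)

text \<open>Closure under negation comes from multiplication by the element -1 of the free
  algebra.\<close>

lemma ideal_freeI:
  assumes "J \<subseteq> field_free" "0 \<in> J" "\<And>p q. p \<in> J \<Longrightarrow> q \<in> J \<Longrightarrow> p + q \<in> J"
    and l: "\<And>p q. p \<in> J \<Longrightarrow> q \<in> field_free \<Longrightarrow> q * p \<in> J"
    and r: "\<And>p q. p \<in> J \<Longrightarrow> q \<in> field_free \<Longrightarrow> p * q \<in> J"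
  shows "ideal J (free_field G H)"
proof (rule idealI[OF ring_free_field])
  interpret F: ring "free_field G H" by (rule ring_free_field)
  have inv: "\<ominus>\<^bsub>free_field G H\<^esub> p = - p" if "p \<in> field_free" for p
    using that by (intro F.minus_equality) (auto intro: field_free_intros)
  show "subgroup J (add_monoid (free_field G H))"
  proof (rule group.subgroupI[OF F.a_group])
    fix p assume "p \<in> J"
    then have "- 1 * p \<in> J" using l by (blast intro: field_free_intros)
    then show "inv\<^bsub>add_monoid (free_field G H)\<^esub> p \<in> J"
      using inv[of p] assms(1) \<open>p \<in> J\<close> by (auto simp: a_inv_def)
  qed (use assms in auto)
qed (use assms in auto)

lemma relators_subset: "field_relators G H \<subseteq> field_free"
  unfolding field_relators_def
  by (auto intro!: field_free_intros simp: H_carrier conj_H conj_H')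

sublocale field: ideal "field_ideal G H" "free_field G H"
  unfolding field_ideal_def by (intro ring.genideal_ideal ring_free_field relators_subset)

lemma relator_in_ideal: "p \<in> field_relators G H \<Longrightarrow> p \<in> field_ideal G H"
  unfolding field_ideal_def
  using ring.genideal_self[OF ring_free_field relators_subset] by blast

lemma field_ideal_minimal:
  "ideal J (free_field G H) \<Longrightarrow> field_relators G H \<subseteq> J \<Longrightarrow> field_ideal G H \<subseteq> J"
  unfolding field_ideal_def by (rule ring.genideal_minimal[OF ring_free_field])

lemma field_ideal_zero: "0 \<in> field_ideal G H"
  using additive_subgroup.zero_closed[OF field.is_additive_subgroup] by simp

lemma field_ideal_add:
  "p \<in> field_ideal G H \<Longrightarrow> q \<in> field_ideal G H \<Longrightarrow> p + q \<in> field_ideal G H"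
  using additive_subgroup.a_closed[OF field.is_additive_subgroup] by simp

lemma field_ideal_uminus: "p \<in> field_ideal G H \<Longrightarrow> - p \<in> field_ideal G H"
  using field.I_l_closed[of p "- 1"] by (simp add: field_free_intros)

lemma relator_sum: "(\<Sum>g\<in>carrier G. dl g x) - 1 \<in> field_relators G H"
  unfolding field_relators_def by (rule UnI1[OF UnI1[OF UnI1[OF UnI1[OF UnI1[OF UnI1[OF UnI1[OF UnI1]]]]]]]) auto

lemma relator_one: "l \<in> half_odd \<Longrightarrow> rh \<one> l - 1 \<in> field_relators G H"
  unfolding field_relators_def by (rule UnI1[OF UnI1[OF UnI1[OF UnI1[OF UnI1[OF UnI1[OF UnI1[OF UnI2]]]]]]]) auto

lemma relator_dd: "g1 \<in> carrier G \<Longrightarrow> g2 \<in> carrier G \<Longrightarrow>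
      dl g1 x * dl g2 x - (if g1 = g2 then dl g1 x else 0) \<in> field_relators G H"
  unfolding field_relators_def by (rule UnI1[OF UnI1[OF UnI1[OF UnI1[OF UnI1[OF UnI1[OF UnI2]]]]]]) auto

lemma relator_rr: "h1 \<in> H \<Longrightarrow> h2 \<in> H \<Longrightarrow> l \<in> half_odd \<Longrightarrow>
      rh h1 l * rh h2 l - rh (h1 \<otimes> h2) l \<in> field_relators G H"
  unfolding field_relators_def by (rule UnI1[OF UnI1[OF UnI1[OF UnI1[OF UnI1[OF UnI2]]]]]) auto

lemma relator_dd': "g1 \<in> carrier G \<Longrightarrow> g2 \<in> carrier G \<Longrightarrow>
      dl g1 x * dl g2 x' - dl g2 x' * dl g1 x \<in> field_relators G H"
  unfolding field_relators_def by (rule UnI1[OF UnI1[OF UnI1[OF UnI1[OF UnI2]]]]) auto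

lemma relator_rd_less: "h \<in> H \<Longrightarrow> g \<in> carrier G \<Longrightarrow> l \<in> half_odd \<Longrightarrow> l < of_int x \<Longrightarrow>
      rh h l * dl g x - dl (h \<otimes> g) x * rh h l \<in> field_relators G H"
  unfolding field_relators_def by (rule UnI1[OF UnI1[OF UnI1[OF UnI2]]]) auto

lemma relator_rd_greater: "h \<in> H \<Longrightarrow> g \<in> carrier G \<Longrightarrow> l \<in> half_odd \<Longrightarrow> l > of_int x \<Longrightarrow>
      rh h l * dl g x - dl g x * rh h l \<in> field_relators G H"
  unfolding field_relators_def by (rule UnI1[OF UnI1[OF UnI2]]) auto

lemma relator_rr_greater: "h1 \<in> H \<Longrightarrow> h2 \<in> H \<Longrightarrow> l \<in> half_odd \<Longrightarrow> l' \<in> half_odd \<Longrightarrow> l > l' \<Longrightarrow>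
      rh h1 l * rh h2 l' - rh h2 l' * rh (inv h2 \<otimes> h1 \<otimes> h2) l \<in> field_relators G H"
  unfolding field_relators_def by (rule UnI1[OF UnI2]) auto

lemma relator_rr_less: "h1 \<in> H \<Longrightarrow> h2 \<in> H \<Longrightarrow> l \<in> half_odd \<Longrightarrow> l' \<in> half_odd \<Longrightarrow> l < l' \<Longrightarrow>
      rh h1 l * rh h2 l' - rh (h1 \<otimes> h2 \<otimes> inv h1) l' * rh h1 l \<in> field_relators G H"
  unfolding field_relators_def by (rule UnI2) auto

lemma poly_adj_dl: "poly_adj G (dl g x) = dl g x" and poly_adj_rh: "poly_adj G (rh h l) = rh (inv h) l"
  by (simp_all add: poly_adj_single)

text \<open>Adjoints of relators are relators up to sign: the two exchange relations between \<rho>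
  at different positions are interchanged, those between \<rho> and \<delta> return negated with h
  replaced by its inverse, and the others keep their type.\<close>

lemma poly_adj_relator:
  assumes "p \<in> field_relators G H"
  shows "poly_adj G p \<in> field_ideal G H"
proof -
  note adj = poly_adj_dl poly_adj_rh poly_adj_diff poly_adj_mult poly_adj_sum poly_adj_one poly_adj_zero
  have neg: "q - p \<in> field_ideal G H" if "p - q \<in> field_relators G H" for p q
    using field_ideal_uminus[OF relator_in_ideal[OF that]] by simp
  note carr = H_carrier
  have "poly_adj G ((\<Sum>g\<in>carrier G. dl g x) - 1) \<in> field_ideal G H" for x
    using relator_in_ideal[OF relator_sum] by (simp add: adj)
  moreover have "poly_adj G (rh \<one> l - 1) \<in> field_ideal G H" if "l \<in> half_odd" for l
    using that relator_in_ideal[OF relator_one] by (simp add: adj)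
  moreover have "poly_adj G (dl g1 x * dl g2 x - (if g1 = g2 then dl g1 x else 0)) \<in> field_ideal G H"
    if "g1 \<in> carrier G" "g2 \<in> carrier G" for g1 g2 x
    using that relator_in_ideal[OF relator_dd[of g2 g1 x]] by (simp add: adj split: if_splits)
  moreover have "poly_adj G (rh h1 l * rh h2 l - rh (h1 \<otimes> h2) l) \<in> field_ideal G H"
    if "h1 \<in> H" "h2 \<in> H" "l \<in> half_odd" for h1 h2 l
    using that relator_in_ideal[OF relator_rr[of "inv h2" "inv h1" l]]
    by (simp add: adj carr inv_mult_group)
  moreover have "poly_adj G (dl g1 x * dl g2 x' - dl g2 x' * dl g1 x) \<in> field_ideal G H"
    if "g1 \<in> carrier G" "g2 \<in> carrier G" for g1 g2 x x'
    using that relator_in_ideal[OF relator_dd'[of g2 g1 x' x]] by (simp add: adj)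
  moreover have "poly_adj G (rh h l * dl g x - dl (h \<otimes> g) x * rh h l) \<in> field_ideal G H"
    if "h \<in> H" "g \<in> carrier G" "l \<in> half_odd" "l < of_int x" for h g l x
  proof -
    have "inv h \<otimes> (h \<otimes> g) = g" using that carr by (simp add: m_assoc[symmetric])
    then show ?thesis
      using that neg[OF relator_rd_less[of "inv h" "h \<otimes> g" l x]] carr by (simp add: adj)
  qed
  moreover have "poly_adj G (rh h l * dl g x - dl g x * rh h l) \<in> field_ideal G H"
    if "h \<in> H" "g \<in> carrier G" "l \<in> half_odd" "of_int x < l" for h g l x
    using that neg[OF relator_rd_greater[of "inv h" g l x]] by (simp add: adj)
  moreover have "poly_adj G (rh h1 l * rh h2 l' - rh h2 l' * rh (inv h2 \<otimes> h1 \<otimes> h2) l)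
      \<in> field_ideal G H"
    if "h1 \<in> H" "h2 \<in> H" "l \<in> half_odd" "l' \<in> half_odd" "l' < l" for h1 h2 l l'
  proof -
    have "inv (inv h2 \<otimes> h1 \<otimes> h2) = inv h2 \<otimes> inv h1 \<otimes> inv (inv h2)"
      using that carr by (simp add: inv_mult_group m_assoc)
    then show ?thesis
      using that relator_in_ideal[OF relator_rr_less[of "inv h2" "inv h1" l' l]] by (simp add: adj)
  qed
  moreover have "poly_adj G (rh h1 l * rh h2 l' - rh (h1 \<otimes> h2 \<otimes> inv h1) l' * rh h1 l)
      \<in> field_ideal G H"
    if "h1 \<in> H" "h2 \<in> H" "l \<in> half_odd" "l' \<in> half_odd" "l < l'" for h1 h2 l l'
  proof -
    have "inv (h1 \<otimes> h2 \<otimes> inv h1) = inv (inv h1) \<otimes> inv h2 \<otimes> inv h1"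
      using that carr by (simp add: inv_mult_group m_assoc)
    then show ?thesis
      using that relator_in_ideal[OF relator_rr_greater[of "inv h2" "inv h1" l' l]] by (simp add: adj)
  qed
  ultimately show ?thesis
    using assms unfolding field_relators_def by (elim UnE CollectE exE conjE) simp_all
qed

text \<open>The elements whose adjoint lies in the ideal form an ideal themselves, because the
  adjoint swaps left and right factors; it contains the relators, so minimality applies.\<close>

lemma poly_adj_ideal: "p \<in> field_ideal G H \<Longrightarrow> poly_adj G p \<in> field_ideal G H"
proof -
  define J where "J = {p \<in> field_free. poly_adj G p \<in> field_ideal G H}"
  have "ideal J (free_field G H)"
  proof (rule ideal_freeI)
    fix p q assume "p \<in> J"
    then show "p + q \<in> J" if "q \<in> J"
      using that field_ideal_add[of "poly_adj G p" "poly_adj G q"]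
      by (auto simp: J_def poly_adj_add intro: field_free_intros)
    show "q * p \<in> J" if "q \<in> field_free"
      using \<open>p \<in> J\<close> that field.I_r_closed[of "poly_adj G p" "poly_adj G q"]
      by (auto simp: J_def poly_adj_mult intro: field_free_intros field_free_adj)
    show "p * q \<in> J" if "q \<in> field_free"
      using \<open>p \<in> J\<close> that field.I_l_closed[of "poly_adj G p" "poly_adj G q"]
      by (auto simp: J_def poly_adj_mult intro: field_free_intros field_free_adj)
  qed (use field_ideal_zero in \<open>auto simp: J_def poly_adj_zero intro: field_free_intros\<close>)
  moreover have "field_relators G H \<subseteq> J"
    using relators_subset poly_adj_relator by (auto simp: J_def)
  ultimately show "p \<in> field_ideal G H \<Longrightarrow> poly_adj G p \<in> field_ideal G H"
    using field_ideal_minimal by (auto simp: J_def)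
qed

lemma field_class_eq:
  assumes "p \<in> field_free" "q \<in> field_free" "p - q \<in> field_ideal G H"
  shows "field_class G H p = field_class G H q"
proof -
  have "p \<in> field_class G H q"
    unfolding field_class_def a_r_coset_def' using assms(3)
    by (auto intro!: bexI[of _ "p - q"])
  then show ?thesis
    unfolding field_class_def using assms by (metis field.a_repr_independence')
qed

lemma field_classD:
  assumes "q \<in> field_class G H p" "p \<in> field_free"
  shows "q \<in> field_free" "q - p \<in> field_ideal G H"
proof -
  obtain i where i: "i \<in> field_ideal G H" "q = i + p"
    using assms(1) unfolding field_class_def a_r_coset_def' by auto
  then show "q \<in> field_free" "q - p \<in> field_ideal G H"
    using assms(2) field.a_Hcarr[of i] by (auto intro: field_free_intros)
qed

lemma field_class_self: "p \<in> field_free \<Longrightarrow> p \<in> field_class G H p"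
  unfolding field_class_def a_r_coset_def'
  using field_ideal_zero by (auto intro!: bexI[of _ 0])

text \<open>Scalar multiplication and adjoint of the quotient are unions over representatives; such
  a union collapses to one coset once \<open>f\<close> respects congruence modulo the ideal.\<close>

lemma field_class_Union:
  assumes "p \<in> field_free" "\<And>q. q \<in> field_free \<Longrightarrow> f q \<in> field_free"
    and "\<And>q. q \<in> field_free \<Longrightarrow> q - p \<in> field_ideal G H \<Longrightarrow> f q - f p \<in> field_ideal G H"
  shows "(\<Union>q\<in>field_class G H p. field_class G H (f q)) = field_class G H (f p)"
proof -
  have "field_class G H (f q) = field_class G H (f p)" if "q \<in> field_class G H p" for q
    using field_classD[OF that assms(1)] assms by (intro field_class_eq) auto
  then show ?thesis using field_class_self[OF assms(1)] by blast
qed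

lemma field_loc_simps:
  "carrier (field_loc G H) = field_class G H ` field_free"
  "\<one>\<^bsub>field_loc G H\<^esub> = field_class G H 1"
  "p \<in> field_free \<Longrightarrow> q \<in> field_free \<Longrightarrow>
     field_class G H p \<otimes>\<^bsub>field_loc G H\<^esub> field_class G H q = field_class G H (p * q)"
  "p \<in> field_free \<Longrightarrow> q \<in> field_free \<Longrightarrow>
     field_class G H p \<oplus>\<^bsub>field_loc G H\<^esub> field_class G H q = field_class G H (p + q)"
  "p \<in> field_free \<Longrightarrow>
     c \<odot>\<^bsub>field_loc G H\<^esub> field_class G H p = field_class G H (Poly_Mapping.single [] c * p)"
  "p \<in> field_free \<Longrightarrow> adj (field_loc G H) (field_class G H p) = field_class G H (poly_adj G p)"
proof -
  show "carrier (field_loc G H) = field_class G H ` field_free"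
    by (auto simp: field_loc_def Let_def FactRing_def A_RCOSETS_def' field_class_def)
  show "\<one>\<^bsub>field_loc G H\<^esub> = field_class G H 1"
    by (simp add: field_loc_def Let_def FactRing_def field_class_def)
  assume p: "p \<in> field_free"
  show "c \<odot>\<^bsub>field_loc G H\<^esub> field_class G H p = field_class G H (Poly_Mapping.single [] c * p)"
  proof -
    have "(\<Union>q\<in>field_class G H p. field_class G H (Poly_Mapping.single [] c * q)) =
        field_class G H (Poly_Mapping.single [] c * p)"
    proof (rule field_class_Union[OF p])
    fix q assume "q \<in> field_free"
    then show "Poly_Mapping.single [] c * q \<in> field_free"
      by (intro field_free_mult field_free_single) auto
    assume "q - p \<in> field_ideal G H"
    then have "Poly_Mapping.single [] c * (q - p) \<in> field_ideal G H"
      using field.I_l_closed[of "q - p" "Poly_Mapping.single [] c"] field_free_single[of "[]" c] by simp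
    then show "Poly_Mapping.single [] c * q - Poly_Mapping.single [] c * p \<in> field_ideal G H"
      by (simp add: right_diff_distrib)
    qed
    then show ?thesis by (simp add: field_loc_def Let_def)
  qed
  show "adj (field_loc G H) (field_class G H p) = field_class G H (poly_adj G p)"
    unfolding field_loc_def Let_def
  proof (simp, rule field_class_Union[OF p, where f = "poly_adj G"])
    fix q assume "q \<in> field_free" "q - p \<in> field_ideal G H"
    then show "poly_adj G q - poly_adj G p \<in> field_ideal G H"
      using poly_adj_ideal[of "q - p"] by (simp add: poly_adj_diff)
  qed (rule field_free_adj)
  assume q: "q \<in> field_free"
  show "field_class G H p \<otimes>\<^bsub>field_loc G H\<^esub> field_class G H q = field_class G H (p * q)"
    using field.rcoset_mult_add[of p q] p q
    by (simp add: field_loc_def Let_def FactRing_def field_class_def)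
  show "field_class G H p \<oplus>\<^bsub>field_loc G H\<^esub> field_class G H q = field_class G H (p + q)"
    using field.a_rcos_sum[of p q] p q
    by (simp add: field_loc_def Let_def FactRing_def field_class_def)
qed

end

locale field_completion = finite_normal H G
  for H :: "'g set" and G :: "('g, 'z) monoid_scheme" (structure) +
  fixes j :: "'g field_poly set \<Rightarrow> 'f::cstar_algebra"
  assumes completion: "cstar_completion (field_loc G H) j"
begin

text \<open>Evaluation of noncommutative polynomials in the completion. On the free algebra it is a
  star homomorphism with the ideal of relations as kernel, which lets representatives replace cosets
  in the computations.\<close>

definition val :: "'g field_poly \<Rightarrow> 'f" where
  "val p = j (field_class G H p)"

lemma
  assumes "p \<in> field_free"
  shows val_add: "q \<in> field_free \<Longrightarrow> val (p + q) = val p + val q"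
    and val_mult: "q \<in> field_free \<Longrightarrow> val (p * q) = val p * val q"
    and val_scale: "val (Poly_Mapping.single [] c * p) = c *\<^sub>C val p"
    and val_adj: "val (poly_adj G p) = star (val p)"
  using completion assms field_loc_simps(1)
  unfolding val_def cstar_completion_def cstar_rep_def
  by (simp_all flip: field_loc_simps(3-6))

lemma val_one: "val 1 = 1"
  using completion field_loc_simps(2)
  unfolding val_def cstar_completion_def cstar_rep_def by simp

lemma val_zero: "val 0 = 0"
  using val_add[of 0 0] by (simp add: field_free_zero)

lemma val_diff:
  assumes "p \<in> field_free" "q \<in> field_free"
  shows "val (p - q) = val p - val q"
  using val_add[of "p - q" q] assms by (simp add: field_free_intros)

lemma val_sum: "(\<And>i. i \<in> I \<Longrightarrow> f i \<in> field_free) \<Longrightarrow> val (\<Sum>i\<in>I. f i) = (\<Sum>i\<in>I. val (f i))"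
  by (induction I rule: infinite_finite_induct) (auto simp: val_zero val_add field_free_sum)

text \<open>Injectivity of \<open>j\<close> gives the forward direction, through which identities in
  the completion are carried over to any representation that kills the relations.\<close>

lemma val_eq_zero_iff:
  assumes "p \<in> field_free"
  shows "val p = 0 \<longleftrightarrow> p \<in> field_ideal G H"
proof
  assume "val p = 0"
  then have "field_class G H p = field_class G H 0"
    using completion assms field_free_zero field_loc_simps(1) val_zero
    unfolding val_def cstar_completion_def inj_on_def by auto
  then have "p \<in> field_class G H 0" using field_class_self[OF assms] by simp
  then show "p \<in> field_ideal G H" using field_classD(2)[of p 0] field_free_zero by simp
next
  assume "p \<in> field_ideal G H"
  then have "field_class G H p = field_class G H 0"
    using assms by (intro field_class_eq) (auto intro: field_free_zero)
  then show "val p = 0" by (simp add: val_def val_zero[unfolded val_def])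
qed

lemma val_dense: "closure (val ` field_free) = UNIV"
  using completion by (simp add: cstar_completion_def field_loc_simps(1) image_image val_def)

lemma val_relator:
  "p \<in> field_free \<Longrightarrow> q \<in> field_free \<Longrightarrow> p - q \<in> field_relators G H \<Longrightarrow> val p = val q"
  using val_eq_zero_iff[of "p - q"] relator_in_ideal[of "p - q"]
  by (simp add: val_diff field_free_diff)

end


section \<open>Observable generators\<close>

context finite_normal
begin

lemma cancel_inv: "x \<in> carrier G \<Longrightarrow> y \<in> carrier G \<Longrightarrow> x \<otimes> (inv x \<otimes> y) = y"
  "x \<in> carrier G \<Longrightarrow> y \<in> carrier G \<Longrightarrow> inv x \<otimes> (x \<otimes> y) = y"
  by (simp_all add: m_assoc[symmetric])

lemmas group_word = m_assoc inv_mult_group cancel_inv H_carrier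

lemma sum_right_translate:
  assumes "h \<in> carrier G"
  shows "(\<Sum>f\<in>carrier G. F (f \<otimes> h)) = (\<Sum>f\<in>carrier G. F f)"
  by (rule sum.reindex_bij_witness[of _ "\<lambda>f. f \<otimes> inv h" "\<lambda>f. f \<otimes> h"]) (use assms in \<open>auto simp: group_word\<close>)

lemma sum_left_translate:
  assumes "h \<in> carrier G"
  shows "(\<Sum>f\<in>carrier G. F (h \<otimes> f)) = (\<Sum>f\<in>carrier G. F f)"
  by (rule sum.reindex_bij_witness[of _ "\<lambda>f. inv h \<otimes> f" "\<lambda>f. h \<otimes> f"]) (use assms in \<open>auto simp: group_word\<close>)

end

lemma half_odd_iff: "l \<in> half_odd \<longleftrightarrow> (\<exists>k::int. l = of_int k + 1 / 2)"
  unfolding half_odd_def Ints_def by (auto simp: algebra_simps)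

lemma half_odd_of_int: "of_int k + 1 / 2 \<in> half_odd"
  by (auto simp: half_odd_iff)

lemma half_odd_less_of_int: "(of_int k + 1 / 2 :: rat) < of_int x \<longleftrightarrow> k < x"
proof
  assume "k < x"
  then have "(of_int k + 1 :: rat) \<le> of_int x" by linarith
  then show "(of_int k + 1 / 2 :: rat) < of_int x" by simp
next
  assume "(of_int k + 1 / 2 :: rat) < of_int x"
  then have "(of_int k :: rat) < of_int x" by linarith
  then show "k < x" by simp
qed

lemma of_int_less_half_odd: "of_int x < (of_int k + 1 / 2 :: rat) \<longleftrightarrow> x \<le> k"
proof
  assume "x \<le> k"
  then have "(of_int x :: rat) \<le> of_int k" by simp
  then show "of_int x < (of_int k + 1 / 2 :: rat)" by simp
next
  assume *: "of_int x < (of_int k + 1 / 2 :: rat)"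
  show "x \<le> k"
  proof (rule ccontr)
    assume "\<not> x \<le> k"
    then have "(of_int k + 1 / 2 :: rat) < of_int x" by (simp add: half_odd_less_of_int)
    with * show False by simp
  qed
qed

section \<open>Relations between generators inside the completion\<close>

context field_completion
begin

text \<open>Half-integers are represented by their floor: \<open>R h k\<close> is the image of $\rho_h(k+\frac12)$.\<close>

definition D :: "'g \<Rightarrow> int \<Rightarrow> 'f" where "D g x = val (dl g x)"
definition R :: "'g \<Rightarrow> int \<Rightarrow> 'f" where "R h k = val (rh h (of_int k + 1 / 2))"

lemma R_free: "h \<in> H \<Longrightarrow> rh h (of_int k + 1 / 2) \<in> field_free"
  by (intro field_free_rh half_odd_of_int)

lemmas val_free = field_free_dl R_free field_free_mult field_free_sum field_free_one field_free_zero

lemma D_sum: "(\<Sum>g\<in>carrier G. D g x) = 1"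
  unfolding D_def
  by (subst val_sum[symmetric])
     (auto intro!: val_free val_relator[OF _ _ relator_sum, THEN trans] val_one)

lemma R_one: "R \<one> k = 1"
  unfolding R_def
  by (rule val_relator[OF _ _ relator_one, THEN trans]) (auto intro!: val_free val_one half_odd_of_int)

lemma D_mult:
  assumes "g1 \<in> carrier G" "g2 \<in> carrier G"
  shows "D g1 x * D g2 x = (if g1 = g2 then D g1 x else 0)"
  using val_relator[OF _ _ relator_dd[OF assms, of x]] assms
  by (auto simp: D_def val_mult val_free val_zero split: if_splits)

lemma R_mult:
  assumes "h1 \<in> H" "h2 \<in> H"
  shows "R h1 k * R h2 k = R (h1 \<otimes> h2) k"
  using val_relator[OF _ _ relator_rr[OF assms half_odd_of_int]] assms
  by (simp add: R_def val_mult val_free)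

lemma D_comm:
  assumes "g1 \<in> carrier G" "g2 \<in> carrier G"
  shows "D g1 x * D g2 y = D g2 y * D g1 x"
  using val_relator[OF _ _ relator_dd'[OF assms, of x y]] assms
  by (simp add: D_def val_mult val_free)

lemma R_D_less:
  assumes "h \<in> H" "g \<in> carrier G" "k < x"
  shows "R h k * D g x = D (h \<otimes> g) x * R h k"
  using val_relator[OF _ _ relator_rd_less[OF assms(1,2) half_odd_of_int, of k x]] assms
  by (simp add: D_def R_def val_mult val_free half_odd_less_of_int H_carrier)

lemma R_D_ge:
  assumes "h \<in> H" "g \<in> carrier G" "x \<le> k"
  shows "R h k * D g x = D g x * R h k"
  using val_relator[OF _ _ relator_rd_greater[OF assms(1,2) half_odd_of_int, of x k]] assms
  by (simp add: D_def R_def val_mult val_free of_int_less_half_odd)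

lemma R_R_less:
  assumes "h1 \<in> H" "h2 \<in> H" "k < k'"
  shows "R h1 k * R h2 k' = R (h1 \<otimes> h2 \<otimes> inv h1) k' * R h1 k"
  using val_relator[OF _ _ relator_rr_less[OF assms(1,2) half_odd_of_int half_odd_of_int, of k k']] assms
  by (simp add: R_def val_mult val_free)

lemma R_R_greater:
  assumes "h1 \<in> H" "h2 \<in> H" "k' < k"
  shows "R h1 k * R h2 k' = R h2 k' * R (inv h2 \<otimes> h1 \<otimes> h2) k"
  using val_relator[OF _ _ relator_rr_greater[OF assms(1,2) half_odd_of_int half_odd_of_int, of k' k]] assms
  by (simp add: R_def val_mult val_free)

lemma D_star: "g \<in> carrier G \<Longrightarrow> star (D g x) = D g x"
  using val_adj[OF field_free_dl, of g x] by (simp add: D_def poly_adj_dl)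

lemma R_star: "h \<in> H \<Longrightarrow> star (R h k) = R (inv h) k"
  using val_adj[OF R_free, of h k] by (simp add: R_def poly_adj_rh)

text \<open>The left translation of the single site \<open>x\<close> by \<open>s\<close>: the first
  factor translates all sites from \<open>x\<close> on, the second undoes this from
  \<open>x + 1\<close> on. The argument \<open>x - 1\<close> is the floor of
  \<open>x - 1/2\<close>.\<close>

definition T :: "'g \<Rightarrow> int \<Rightarrow> 'f" where "T s x = R s (x - 1) * R (inv s) x"

lemma T_one: "T \<one> x = 1"
  by (simp add: T_def R_one)

lemma T_mult:
  assumes "s \<in> H" "t \<in> H"
  shows "T s x * T t x = T (s \<otimes> t) x"
proof -
  have "T s x * T t x = R s (x - 1) * (R (inv s) x * R t (x - 1)) * R (inv t) x"
    by (simp add: T_def mult.assoc)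
  also have "R (inv s) x * R t (x - 1) = R t (x - 1) * R (inv t \<otimes> inv s \<otimes> t) x"
    using assms by (intro R_R_greater) auto
  also have "R s (x - 1) * (R t (x - 1) * R (inv t \<otimes> inv s \<otimes> t) x) * R (inv t) x
      = (R s (x - 1) * R t (x - 1)) * (R (inv t \<otimes> inv s \<otimes> t) x * R (inv t) x)"
    by (simp add: mult.assoc)
  also have "\<dots> = T (s \<otimes> t) x"
    using assms by (simp add: R_mult T_def group_word)
  finally show ?thesis .
qed

lemma T_star:
  assumes "s \<in> H"
  shows "star (T s x) = T (inv s) x"
proof -
  have "star (T s x) = R s x * R (inv s) (x - 1)"
    using assms by (simp add: T_def star_mult R_star H_carrier)
  also have "\<dots> = R (inv s) (x - 1) * R (inv (inv s) \<otimes> s \<otimes> inv s) x"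
    using assms by (intro R_R_greater) auto
  finally show ?thesis
    using assms by (simp add: T_def group_word)
qed

lemma T_D_same:
  assumes "s \<in> H" "g \<in> carrier G"
  shows "T s x * D g x = D (s \<otimes> g) x * T s x"
  unfolding T_def mult.assoc using assms
  by (subst R_D_ge) (auto simp: R_D_less H_carrier simp flip: mult.assoc)

text \<open>Beyond \<open>x\<close> the two factors move a site by \<open>s\<close> and by its
  inverse, which cancel; before \<open>x\<close> neither factor moves it.\<close>

lemma T_D_other:
  assumes "s \<in> H" "g \<in> carrier G" "y \<noteq> x"
  shows "T s x * D g y = D g y * T s x"
proof (cases "y < x")
  case True
  then have "y \<le> x - 1" "y \<le> x" by auto
  then show ?thesis
    unfolding T_def mult.assoc using assms
    by (subst R_D_ge) (auto simp: R_D_ge H_carrier simp flip: mult.assoc)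
next
  case False
  then have "x - 1 < y" "x < y" using assms by auto
  then show ?thesis
    unfolding T_def mult.assoc using assms
    by (subst R_D_less) (auto simp: R_D_less group_word simp flip: mult.assoc)
qed

text \<open>A translation of the half-line beyond \<open>k\<close> moves the site \<open>x\<close>
  as well, so passing it conjugates the parameter \<open>s\<close> by \<open>t\<close>.\<close>

lemma T_R_less:
  assumes "s \<in> H" "t \<in> H" "k < x"
  shows "T s x * R t k = R t k * T (inv t \<otimes> s \<otimes> t) x"
proof -
  have 1: "T s x * R t k = R s (x - 1) * R t k * R (inv t \<otimes> inv s \<otimes> t) x"
    using assms by (simp add: T_def mult.assoc R_R_greater)
  have 2: "R s (x - 1) * R t k = R t k * R (inv t \<otimes> s \<otimes> t) (x - 1)"
  \<comment> \<open>For \<open>k = x - 1\<close> both factors sit at the same half-integer, where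
    they multiply instead of exchanging.\<close>
  proof (cases "k < x - 1")
    case True
    then show ?thesis using assms by (simp add: R_R_greater)
  next
    case False
    then have "k = x - 1" using assms by simp
    then show ?thesis using assms by (simp add: R_mult conj_H' group_word)
  qed
  have "T s x * R t k = R t k * (R (inv t \<otimes> s \<otimes> t) (x - 1) * R (inv t \<otimes> inv s \<otimes> t) x)"
    unfolding 1 2 by (simp add: mult.assoc)
  then show ?thesis
    using assms by (simp add: T_def group_word)
qed

lemma T_R_ge:
  assumes "s \<in> H" "t \<in> H" "x \<le> k"
  shows "T s x * R t k = R t k * T s x"
proof (cases "k = x")
  case True
  have "R t x * T s x = (R t x * R s (x - 1)) * R (inv s) x"
    by (simp add: T_def mult.assoc)
  also have "R t x * R s (x - 1) = R s (x - 1) * R (inv s \<otimes> t \<otimes> s) x"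
    using assms by (intro R_R_greater) auto
  also have "\<dots> * R (inv s) x = T s x * R t x"
    using assms by (simp add: T_def mult.assoc R_mult group_word)
  finally show ?thesis using True by simp
next
  case False
  then have k: "x < k" "x - 1 < k" using assms by auto
  have "T s x * R t k = R s (x - 1) * (R (inv s) x * R t k)"
    by (simp add: T_def mult.assoc)
  also have "R (inv s) x * R t k = R (inv s \<otimes> t \<otimes> inv (inv s)) k * R (inv s) x"
    using assms k by (intro R_R_less) auto
  also have "R s (x - 1) * (R (inv s \<otimes> t \<otimes> inv (inv s)) k * R (inv s) x)
      = R s (x - 1) * R (inv s \<otimes> t \<otimes> inv (inv s)) k * R (inv s) x"
    by (simp add: mult.assoc)
  also have "R s (x - 1) * R (inv s \<otimes> t \<otimes> inv (inv s)) k =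
      R (s \<otimes> (inv s \<otimes> t \<otimes> inv (inv s)) \<otimes> inv s) k * R s (x - 1)"
    using assms k by (intro R_R_less) auto
  finally show ?thesis
    using assms by (simp add: T_def mult.assoc group_word)
qed

text \<open>The observable generators: \<open>V h x\<close> translates the site \<open>x\<close> by \<open>inv h\<close> from the right,
  \<open>W g x\<close> projects onto the value \<open>g\<close> of the quotient of the sites \<open>x\<close> and \<open>x + 1\<close>.\<close>

definition V :: "'g \<Rightarrow> int \<Rightarrow> 'f" where
  "V h x = (\<Sum>f\<in>carrier G. D f x * T (f \<otimes> inv h \<otimes> inv f) x)"

definition W :: "'g \<Rightarrow> int \<Rightarrow> 'f" where
  "W g x = (\<Sum>f\<in>carrier G. D f x * D (f \<otimes> g) (x + 1))"

text \<open>A projection at \<open>x\<close> selects one summand of an element written as a sum over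
  the values at \<open>x\<close>; this evaluates \<open>V\<close> and \<open>W\<close> on a fixed
  value \<open>f\<close>.\<close>

lemma D_mult_sum:
  assumes "g \<in> carrier G"
  shows "D g x * (\<Sum>f\<in>carrier G. D f x * F f) = D g x * F g"
proof -
  have "D g x * (\<Sum>f\<in>carrier G. D f x * F f) = (\<Sum>f\<in>carrier G. if g = f then D g x * F g else 0)"
    unfolding sum_distrib_left
    by (rule sum.cong) (auto simp: D_mult assms simp flip: mult.assoc)
  also have "\<dots> = D g x * F g" using assms finite_carrier by simp
  finally show ?thesis .
qed

lemma D_V: "f \<in> carrier G \<Longrightarrow> D f x * V h x = D f x * T (f \<otimes> inv h \<otimes> inv f) x"
  unfolding V_def by (rule D_mult_sum)

lemma D_W: "f \<in> carrier G \<Longrightarrow> D f x * W g x = D f x * D (f \<otimes> g) (x + 1)"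
  unfolding W_def by (rule D_mult_sum)

lemma conj_inv_H: "f \<in> carrier G \<Longrightarrow> h \<in> H \<Longrightarrow> f \<otimes> inv h \<otimes> inv f \<in> H"
  by (simp add: conj_H)

lemma V_one: "V \<one> x = 1"
  by (simp add: V_def T_one D_sum)

lemma V_D_same:
  assumes "h \<in> H" "g \<in> carrier G"
  shows "V h x * D g x = D (g \<otimes> inv h) x * V h x"
proof -
  have "V h x * D g x = (\<Sum>f\<in>carrier G. if g \<otimes> inv h = f then D f x * T (f \<otimes> inv h \<otimes> inv f) x else 0)"
    unfolding V_def sum_distrib_right
  proof (rule sum.cong)
    fix f assume f: "f \<in> carrier G"
    \<comment> \<open>The shift of the projection by \<open>T\<close> depends on \<open>f\<close>;
      solving for \<open>f\<close> leaves a single nonzero term.\<close>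
    have eq: "f = f \<otimes> inv h \<otimes> inv f \<otimes> g \<longleftrightarrow> g \<otimes> inv h = f"
    proof
      assume "f = f \<otimes> inv h \<otimes> inv f \<otimes> g"
      then have "f \<otimes> h \<otimes> inv f \<otimes> f = f \<otimes> h \<otimes> inv f \<otimes> (f \<otimes> inv h \<otimes> inv f \<otimes> g)" by simp
      then have "f \<otimes> h = g" using assms f by (simp add: group_word)
      then show "g \<otimes> inv h = f" using assms f by (auto simp: group_word)
    qed (use assms f in \<open>auto simp: group_word\<close>)
    have "D f x * T (f \<otimes> inv h \<otimes> inv f) x * D g x =
        D f x * D (f \<otimes> inv h \<otimes> inv f \<otimes> g) x * T (f \<otimes> inv h \<otimes> inv f) x"
      using f assms by (simp add: mult.assoc T_D_same conj_inv_H)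
    also have "\<dots> = (if g \<otimes> inv h = f then D f x * T (f \<otimes> inv h \<otimes> inv f) x else 0)"
      using eq f assms by (subst D_mult) (auto simp: H_carrier)
    finally show "D f x * T (f \<otimes> inv h \<otimes> inv f) x * D g x = \<dots>" .
  qed simp
  also have "\<dots> = D (g \<otimes> inv h) x * T (g \<otimes> inv h \<otimes> inv h \<otimes> inv (g \<otimes> inv h)) x"
    using assms finite_carrier by (simp add: H_carrier)
  also have "\<dots> = D (g \<otimes> inv h) x * V h x"
    using assms by (simp add: D_V H_carrier)
  finally show ?thesis .
qed

lemma V_D_other:
  assumes "h \<in> H" "g \<in> carrier G" "y \<noteq> x"
  shows "V h x * D g y = D g y * V h x"
  unfolding V_def sum_distrib_left sum_distrib_right
proof (rule sum.cong)
  fix f assume f: "f \<in> carrier G"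
  have "D f x * T (f \<otimes> inv h \<otimes> inv f) x * D g y = D f x * D g y * T (f \<otimes> inv h \<otimes> inv f) x"
    using f assms by (simp add: mult.assoc T_D_other conj_inv_H)
  then show "D f x * T (f \<otimes> inv h \<otimes> inv f) x * D g y = D g y * (D f x * T (f \<otimes> inv h \<otimes> inv f) x)"
    using f assms by (simp add: D_comm[of f g x y] mult.assoc)
qed simp

text \<open>Right translations commute with left ones. If the half-line of \<rho> contains
  \<open>x\<close>, the value \<open>f\<close> is shifted by \<open>inv t\<close> and the parameter
  of \<open>T\<close> is conjugated accordingly, so the summands are only permuted; otherwise each
  summand commutes.\<close>

lemma V_R:
  assumes "h \<in> H" "t \<in> H"
  shows "V h x * R t k = R t k * V h x"
proof (cases "k < x")
  case True
  have t: "inv t \<in> carrier G" using assms by (simp add: H_carrier)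
  have "V h x * R t k = (\<Sum>f\<in>carrier G. R t k * (D (inv t \<otimes> f) x *
      T ((inv t \<otimes> f) \<otimes> inv h \<otimes> inv (inv t \<otimes> f)) x))"
    unfolding V_def sum_distrib_right
  proof (rule sum.cong)
    fix f assume f: "f \<in> carrier G"
    have "D f x * T (f \<otimes> inv h \<otimes> inv f) x * R t k =
        D f x * R t k * T (inv t \<otimes> (f \<otimes> inv h \<otimes> inv f) \<otimes> t) x"
      using f assms True by (simp add: mult.assoc T_R_less conj_inv_H)
    also have "D f x * R t k = R t k * D (inv t \<otimes> f) x"
      using f assms True by (simp add: R_D_less group_word)
    also have "inv t \<otimes> (f \<otimes> inv h \<otimes> inv f) \<otimes> t = (inv t \<otimes> f) \<otimes> inv h \<otimes> inv (inv t \<otimes> f)"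
      using f assms by (simp add: group_word)
    finally show "D f x * T (f \<otimes> inv h \<otimes> inv f) x * R t k = R t k * (D (inv t \<otimes> f) x *
      T ((inv t \<otimes> f) \<otimes> inv h \<otimes> inv (inv t \<otimes> f)) x)" by (simp add: mult.assoc)
  qed simp
  also have "\<dots> = R t k * V h x"
    unfolding V_def sum_distrib_left
    by (rule sum_left_translate[OF t, of "\<lambda>f. R t k * (D f x * T (f \<otimes> inv h \<otimes> inv f) x)"])
  finally show ?thesis .
next
  case False
  show ?thesis
    unfolding V_def sum_distrib_left sum_distrib_right
  proof (rule sum.cong)
    fix f assume f: "f \<in> carrier G"
    have "D f x * T (f \<otimes> inv h \<otimes> inv f) x * R t k = D f x * R t k * T (f \<otimes> inv h \<otimes> inv f) x"
      using f assms False by (simp add: mult.assoc T_R_ge conj_inv_H)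
    then show "D f x * T (f \<otimes> inv h \<otimes> inv f) x * R t k = R t k * (D f x * T (f \<otimes> inv h \<otimes> inv f) x)"
      using f assms False by (simp add: R_D_ge flip: mult.assoc)
  qed simp
qed

lemma V_T:
  assumes "h \<in> H" "t \<in> H"
  shows "V h x * T t y = T t y * V h x"
proof -
  have "V h x * T t y = R t (y - 1) * V h x * R (inv t) y"
    using assms by (simp add: T_def V_R flip: mult.assoc)
  then show ?thesis using assms by (simp add: T_def V_R mult.assoc)
qed

text \<open>\<open>V h x\<close> carries the value \<open>f\<close> to
  \<open>f \<otimes> inv h\<close>, and the sum is reindexed at the shifted value. The inverse of
  \<open>h\<close> in the definition of \<open>V\<close> makes the parameters come out in the order
  \<open>h \<otimes> k\<close>.\<close>

lemma V_mult:
  assumes "h \<in> H" "k \<in> H"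
  shows "V h x * V k x = V (h \<otimes> k) x"
proof -
  have h: "h \<in> carrier G" "inv h \<in> carrier G" using assms by (auto simp: H_carrier)
  define F where "F f = D f x * T (f \<otimes> inv (h \<otimes> k) \<otimes> inv f) x" for f
  have "V h x * V k x = (\<Sum>f\<in>carrier G. F (f \<otimes> inv h))"
    unfolding V_def[of k] sum_distrib_left
  proof (rule sum.cong)
    fix f assume f: "f \<in> carrier G"
    then have fh: "f \<otimes> inv h \<in> carrier G" using h by simp
    have "V h x * (D f x * T (f \<otimes> inv k \<otimes> inv f) x) =
        D (f \<otimes> inv h) x * V h x * T (f \<otimes> inv k \<otimes> inv f) x"
      using assms f by (simp add: V_D_same flip: mult.assoc)
    also have "\<dots> = D (f \<otimes> inv h) x *
        (T (f \<otimes> inv h \<otimes> inv h \<otimes> inv (f \<otimes> inv h)) x * T (f \<otimes> inv k \<otimes> inv f) x)"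
      by (simp add: D_V[OF fh] mult.assoc)
    also have "T (f \<otimes> inv h \<otimes> inv h \<otimes> inv (f \<otimes> inv h)) x * T (f \<otimes> inv k \<otimes> inv f) x =
        T ((f \<otimes> inv h \<otimes> inv h \<otimes> inv (f \<otimes> inv h)) \<otimes> (f \<otimes> inv k \<otimes> inv f)) x"
      using assms f fh by (intro T_mult conj_inv_H)
    also have "(f \<otimes> inv h \<otimes> inv h \<otimes> inv (f \<otimes> inv h)) \<otimes> (f \<otimes> inv k \<otimes> inv f) =
        (f \<otimes> inv h) \<otimes> inv (h \<otimes> k) \<otimes> inv (f \<otimes> inv h)"
      using assms f by (simp add: group_word)
    finally show "V h x * (D f x * T (f \<otimes> inv k \<otimes> inv f) x) = F (f \<otimes> inv h)"
      by (simp add: F_def)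
  qed simp
  also have "\<dots> = (\<Sum>f\<in>carrier G. F f)" by (rule sum_right_translate[OF h(2)])
  finally show ?thesis by (simp add: F_def V_def)
qed

lemma V_V_other:
  assumes "h \<in> H" "k \<in> H" "x \<noteq> y"
  shows "V h x * V k y = V k y * V h x"
  unfolding V_def[of k] sum_distrib_left sum_distrib_right
proof (rule sum.cong)
  fix f assume f: "f \<in> carrier G"
  have "V h x * (D f y * T (f \<otimes> inv k \<otimes> inv f) y) = D f y * (V h x * T (f \<otimes> inv k \<otimes> inv f) y)"
    using f assms by (simp add: V_D_other flip: mult.assoc)
  also have "V h x * T (f \<otimes> inv k \<otimes> inv f) y = T (f \<otimes> inv k \<otimes> inv f) y * V h x"
    using f assms by (intro V_T conj_inv_H)
  finally show "V h x * (D f y * T (f \<otimes> inv k \<otimes> inv f) y) = D f y * T (f \<otimes> inv k \<otimes> inv f) y * V h x"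
    by (simp add: mult.assoc)
qed simp

lemma V_star:
  assumes "h \<in> H"
  shows "star (V h x) = V (inv h) x"
proof -
  have h: "h \<in> carrier G" using assms by (simp add: H_carrier)
  define F where "F f = D f x * T (f \<otimes> h \<otimes> inv f) x" for f
  have "star (V h x) = (\<Sum>f\<in>carrier G. F (f \<otimes> h))"
    unfolding V_def star_sum
  proof (rule sum.cong)
    fix f assume f: "f \<in> carrier G"
    have "star (D f x * T (f \<otimes> inv h \<otimes> inv f) x) = T (f \<otimes> h \<otimes> inv f) x * D f x"
      using f assms by (simp add: star_mult D_star T_star conj_inv_H) (simp add: group_word)
    also have "\<dots> = D (f \<otimes> h \<otimes> inv f \<otimes> f) x * T (f \<otimes> h \<otimes> inv f) x"
      using f assms by (intro T_D_same conj_H)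
    also have "f \<otimes> h \<otimes> inv f \<otimes> f = f \<otimes> h"
      using f h by (simp add: group_word)
    also have "f \<otimes> h \<otimes> inv f = (f \<otimes> h) \<otimes> h \<otimes> inv (f \<otimes> h)"
      using f h by (simp add: group_word)
    finally show "star (D f x * T (f \<otimes> inv h \<otimes> inv f) x) = F (f \<otimes> h)" by (simp add: F_def)
  qed simp
  also have "\<dots> = (\<Sum>f\<in>carrier G. F f)" by (rule sum_right_translate[OF h])
  finally show ?thesis using h by (simp add: F_def V_def)
qed

lemma W_D:
  assumes "g \<in> carrier G" "k \<in> carrier G"
  shows "W g x * D k y = D k y * W g x"
  unfolding W_def sum_distrib_left sum_distrib_right
  by (rule sum.cong) (use assms in \<open>auto simp: D_comm mult.assoc[symmetric]\<close>,
    metis D_comm m_closed mult.assoc)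

lemma W_W:
  assumes "g \<in> carrier G" "k \<in> carrier G"
  shows "W g x * W k y = W k y * W g x"
  unfolding W_def[of k] sum_distrib_left sum_distrib_right
  by (rule sum.cong) (use assms in \<open>auto simp: W_D mult.assoc[symmetric]\<close>,
    metis W_D m_closed mult.assoc)

lemma W_mult:
  assumes "g \<in> carrier G" "k \<in> carrier G"
  shows "W g x * W k x = (if g = k then W g x else 0)"
proof -
  have "W g x * W k x = (\<Sum>f\<in>carrier G. W k x * (D f x * D (f \<otimes> g) (x + 1)))"
    by (subst W_W[OF assms]) (simp add: W_def[of g] sum_distrib_left)
  also have "\<dots> = (\<Sum>f\<in>carrier G. if g = k then D f x * D (f \<otimes> g) (x + 1) else 0)"
  proof (rule sum.cong)
    fix f assume f: "f \<in> carrier G"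
    have "W k x * (D f x * D (f \<otimes> g) (x + 1)) = D f x * W k x * D (f \<otimes> g) (x + 1)"
      using assms f by (simp add: W_D flip: mult.assoc)
    also have "\<dots> = D f x * (D (f \<otimes> k) (x + 1) * D (f \<otimes> g) (x + 1))"
      using f by (simp add: D_W mult.assoc)
    also have "\<dots> = (if g = k then D f x * D (f \<otimes> g) (x + 1) else 0)"
      using assms f by (auto simp: D_mult)
    finally show "W k x * (D f x * D (f \<otimes> g) (x + 1)) = \<dots>" .
  qed simp
  also have "\<dots> = (if g = k then W g x else 0)" by (simp add: W_def)
  finally show ?thesis .
qed

lemma W_sum: "(\<Sum>g\<in>carrier G. W g x) = 1"
proof -
  have "(\<Sum>g\<in>carrier G. W g x) = (\<Sum>f\<in>carrier G. D f x * (\<Sum>g\<in>carrier G. D (f \<otimes> g) (x + 1)))"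
    unfolding W_def by (subst sum.swap) (simp add: sum_distrib_left)
  also have "\<dots> = (\<Sum>f\<in>carrier G. D f x)"
    by (rule sum.cong) (auto simp: sum_left_translate[of _ "\<lambda>g. D g (x + 1)"] D_sum)
  finally show ?thesis by (simp add: D_sum)
qed

lemma W_star: "g \<in> carrier G \<Longrightarrow> star (W g x) = W g x"
  unfolding W_def star_sum
  by (rule sum.cong) (auto simp: star_mult D_star D_comm)

text \<open>\<open>W\<close> tests the quotient of the values at \<open>x\<close> and
  \<open>x + 1\<close>. Translating the site \<open>x\<close> by \<open>inv h\<close> from the right
  multiplies this quotient by \<open>h\<close> on the left, translating \<open>x + 1\<close>
  multiplies it by \<open>inv h\<close> on the right: these are the two twists of the tensor
  product.\<close>

lemma V_W:
  assumes "h \<in> H" "g \<in> carrier G"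
  shows "V h y * W g x = W (if y = x then h \<otimes> g else if y = x + 1 then g \<otimes> inv h else g) x * V h y"
proof -
  have h: "h \<in> carrier G" "inv h \<in> carrier G" using assms by (auto simp: H_carrier)
  have DD: "V h y * (D f x * D k (x + 1)) =
      D (if y = x then f \<otimes> inv h else f) x * D (if y = x + 1 then k \<otimes> inv h else k) (x + 1) * V h y"
    if "f \<in> carrier G" "k \<in> carrier G" for f k
    using that assms by (auto simp: V_D_same V_D_other simp flip: mult.assoc) (auto simp: V_D_same V_D_other mult.assoc)
  have "V h y * W g x = (\<Sum>f\<in>carrier G. D (if y = x then f \<otimes> inv h else f) x *
      D (if y = x + 1 then f \<otimes> g \<otimes> inv h else f \<otimes> g) (x + 1) * V h y)"
    unfolding W_def sum_distrib_left using assms by (intro sum.cong) (auto simp: DD)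
  also have "\<dots> = W (if y = x then h \<otimes> g else if y = x + 1 then g \<otimes> inv h else g) x * V h y"
  proof (cases "y = x")
    case True
    have "(\<Sum>f\<in>carrier G. D (f \<otimes> inv h) x * D (f \<otimes> g) (x + 1) * V h x) =
        (\<Sum>f\<in>carrier G. D (f \<otimes> inv h) x * D ((f \<otimes> inv h) \<otimes> (h \<otimes> g)) (x + 1) * V h x)"
      using assms h by (intro sum.cong) (auto simp: group_word)
    also have "\<dots> = W (h \<otimes> g) x * V h x"
      unfolding W_def sum_distrib_right
      by (rule sum_right_translate[OF h(2), of "\<lambda>f. D f x * D (f \<otimes> (h \<otimes> g)) (x + 1) * V h x"])
    finally show ?thesis using True by simp
  next
    case False
    then show ?thesis
      unfolding W_def sum_distrib_right using assms h by (auto intro!: sum.cong simp: m_assoc)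
  qed
  finally show ?thesis .
qed

text \<open>The slot \<open>2 * x\<close> belongs to the lattice site \<open>x\<close>, the slot
  \<open>2 * x + 1\<close> to the link between \<open>x\<close> and \<open>x + 1\<close>;
  \<open>div\<close> rounds down, so this holds for negative slots too.\<close>

definition observable_gen :: "int \<Rightarrow> 'g \<Rightarrow> 'f" where
  "observable_gen i q = (if even i then V q (i div 2) else W q (i div 2))"

theorem twisted_family_observable_gen: "twisted_family G H observable_gen"
  unfolding twisted_family_def
proof (intro conjI allI ballI impI)
  fix i j :: int and p q
  show "observable_gen i \<one> = 1" if "even i"
    using that by (simp add: observable_gen_def V_one)
  show "(\<Sum>g\<in>carrier G. observable_gen i g) = 1" if "odd i"
    using that by (simp add: observable_gen_def W_sum)
  show "observable_gen i p * observable_gen i q =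
      (if even i then observable_gen i (p \<otimes> q) else if p = q then observable_gen i p else 0)"
    if "p \<in> site_basis G H i" "q \<in> site_basis G H i"
    using that by (simp add: observable_gen_def site_basis_def V_mult W_mult split: if_splits)
  show "star (observable_gen i p) = (if even i then observable_gen i (inv p) else observable_gen i p)"
    if "p \<in> site_basis G H i"
    using that by (simp add: observable_gen_def site_basis_def V_star W_star split: if_splits)
  assume ij: "i < j" and p: "p \<in> site_basis G H j" and q: "q \<in> site_basis G H i"
  define x y where "x = i div 2" and "y = j div 2"
  show "observable_gen j p * observable_gen i q =
      observable_gen i (fst (twist G i j p q)) * observable_gen j (snd (twist G i j p q))"
  proof (cases "even i"; cases "even j")
    assume "even i" "even j"
    then have "x \<noteq> y" "j \<noteq> i + 1" using ij by (auto simp: x_def y_def)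
    then show ?thesis
      using \<open>even i\<close> \<open>even j\<close> p q
      by (simp add: observable_gen_def twist_def site_basis_def V_V_other flip: x_def y_def)
  next
    assume "odd i" "odd j"
    then have "j \<noteq> i + 1" by auto
    then show ?thesis
      using \<open>odd i\<close> \<open>odd j\<close> p q
      by (simp add: observable_gen_def twist_def site_basis_def W_W flip: x_def y_def)
  next
    assume e: "even i" "odd j"
    then have pq: "q \<in> H" "p \<in> carrier G" using p q by (auto simp: site_basis_def)
    show ?thesis
    proof (cases "j = i + 1")
      case True
      then have "y = x" using e by (auto simp: x_def y_def)
      then show ?thesis
        \<comment> \<open>\<open>V_W\<close> is read from right to left: the label
          \<open>inv q \<otimes> p\<close> makes \<open>W p x * V q x\<close> its right
          side.\<close>
        using True e pq V_W[of q "inv q \<otimes> p" x x]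
        by (simp add: observable_gen_def twist_def group_word flip: x_def y_def)
    next
      case False
      then have "x \<noteq> y" "x \<noteq> y + 1" using e ij by (auto simp: x_def y_def elim!: evenE oddE)
      then show ?thesis
        using False e pq V_W[of q p x y]
        by (simp add: observable_gen_def twist_def flip: x_def y_def)
    qed
  next
    assume e: "odd i" "even j"
    then have pq: "p \<in> H" "q \<in> carrier G" using p q by (auto simp: site_basis_def)
    show ?thesis
    proof (cases "j = i + 1")
      case True
      then have "y = x + 1" using e by (auto simp: x_def y_def elim!: oddE)
      then show ?thesis
        using True e pq V_W[of p q y x]
        by (simp add: observable_gen_def twist_def flip: x_def y_def)
    next
      case False
      then have "y \<noteq> x" "y \<noteq> x + 1" using e ij by (auto simp: x_def y_def elim!: evenE oddE)
      then show ?thesis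
        using False e pq V_W[of p q y x]
        by (simp add: observable_gen_def twist_def flip: x_def y_def)
    qed
  qed
qed

end


section \<open>The action and the observables\<close>

lemma intertwine_mult:
  fixes a :: "'c::semigroup_mult"
  assumes "a * b = b' * a" "a * c = c' * a"
  shows "a * (b * c) = b' * c' * a"
proof -
  have "a * (b * c) = b' * (a * c)" by (simp add: assms(1) flip: mult.assoc)
  then show ?thesis by (simp add: assms(2) mult.assoc)
qed

locale field_with_action = field_completion H G j
  for H :: "'g set" and G :: "('g, 'z) monoid_scheme" (structure)
    and j :: "'g field_poly set \<Rightarrow> 'f::cstar_algebra" +
  fixes act :: "('g \<times> 'g \<Rightarrow> complex) \<Rightarrow> 'f \<Rightarrow> 'f"
  assumes action: "field_action G H j act"
begin

section \<open>The action expressed on the basis of the double\<close>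

lemma basis_in_double: "h \<in> H \<Longrightarrow> g \<in> carrier G \<Longrightarrow> double_basis (h, g) \<in> double G H"
  by (auto simp: double_def double_basis_def)

lemma finite_index: "finite (H \<times> carrier G)"
  by (simp add: finite_H finite_carrier)

lemma
  assumes "a \<in> double G H"
  shows act_add: "act a (E + F) = act a E + act a F"
    and act_scale: "act a (c *\<^sub>C F) = c *\<^sub>C act a F"
    and act_continuous: "continuous_on UNIV (act a)"
    and act_one: "act a 1 = double_counit G H a *\<^sub>C 1"
    and act_mult_comult: "act a (E * F) =
        (\<Sum>r\<in>H \<times> carrier G. \<Sum>s\<in>H \<times> carrier G.
           double_comult G H a (r, s) *\<^sub>C (act (double_basis r) E * act (double_basis s) F))"
  using action assms by (simp_all only: field_action_def module_algebra_def)

lemma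
  assumes "a \<in> double G H" "b \<in> double G H"
  shows act_add_left: "act (\<lambda>r. a r + b r) F = act a F + act b F"
    and act_scale_left: "act (\<lambda>r. c * a r) F = c *\<^sub>C act a F"
  using action assms by (simp_all only: field_action_def module_algebra_def)

definition A :: "'g \<Rightarrow> 'g \<Rightarrow> 'f \<Rightarrow> 'f" where
  "A h g F = act (double_basis (h, g)) F"

lemma sum_double_basis:
  fixes X :: "'g \<times> 'g \<Rightarrow> 'c::comm_ring_1"
  assumes "p \<in> H \<times> carrier G"
  shows "(\<Sum>r\<in>H \<times> carrier G. of_bool (r = p) * X r) = X p"
proof -
  have "(\<Sum>r\<in>H \<times> carrier G. of_bool (r = p) * X r) = (\<Sum>r\<in>H \<times> carrier G. if r = p then X r else 0)"
    by (intro sum.cong) auto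
  then show ?thesis using assms by (simp only: sum.delta[OF finite_index] if_True)
qed

lemma double_basis_of_bool: "double_basis p q = of_bool (q = p)"
  by (simp add: double_basis_def)

lemma double_counit_basis:
  assumes "h \<in> H" "g \<in> carrier G"
  shows "double_counit G H (double_basis (h, g)) = of_bool (h = \<one>)"
proof -
  have "double_counit G H (double_basis (h, g)) =
      (\<Sum>r\<in>H \<times> carrier G. of_bool (r = (h, g)) * of_bool (fst r = \<one>))"
    unfolding double_counit_def double_basis_of_bool
    by (rule sum.cong) (auto simp: case_prod_unfold of_bool_def)
  also have "\<dots> = of_bool (fst (h, g) = \<one>)" by (rule sum_double_basis) (use assms in auto)
  finally show ?thesis by simp
qed

lemma double_comult_basis:
  assumes "h \<in> H" "g \<in> carrier G"
  shows "double_comult G H (double_basis (h, g)) (r, s) =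
    (\<Sum>t\<in>H. of_bool (r = (t, g)) * of_bool (s = (inv t \<otimes> h, g)))"
proof -
  have "double_comult G H (double_basis (h, g)) (r, s) = (\<Sum>p\<in>H \<times> carrier G. of_bool (p = (h, g)) *
      (\<Sum>t\<in>H. of_bool (r = (t, snd p)) * of_bool (s = (inv t \<otimes> fst p, snd p))))"
    unfolding double_comult_def double_basis_of_bool case_prod_unfold
    by (simp only: fst_conv snd_conv prod.collapse)
  also have "\<dots> = (\<Sum>t\<in>H. of_bool (r = (t, snd (h, g))) * of_bool (s = (inv t \<otimes> fst (h, g), snd (h, g))))"
    by (rule sum_double_basis) (use assms in auto)
  finally show ?thesis by simp
qed

lemma A_mult:
  assumes h: "h \<in> H" and g: "g \<in> carrier G"
  shows "A h g (E * F) = (\<Sum>t\<in>H. A t g E * A (inv t \<otimes> h) g F)"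
proof -
  define X where "X r s = act (double_basis r) E * act (double_basis s) F" for r s
  have "A h g (E * F) = (\<Sum>r\<in>H \<times> carrier G. \<Sum>s\<in>H \<times> carrier G.
      (\<Sum>t\<in>H. of_bool (r = (t, g)) * of_bool (s = (inv t \<otimes> h, g))) *\<^sub>C X r s)"
    unfolding A_def act_mult_comult[OF basis_in_double[OF assms]] double_comult_basis[OF assms] X_def ..
  also have "\<dots> = (\<Sum>r\<in>H \<times> carrier G. \<Sum>s\<in>H \<times> carrier G. \<Sum>t\<in>H.
      if (t, g) = r then if (inv t \<otimes> h, g) = s then X r s else 0 else 0)"
  proof (intro sum.cong refl)
    fix r s
    have "(\<Sum>t\<in>I. of_bool (r = (t, g)) * of_bool (s = (inv t \<otimes> h, g))) *\<^sub>C X r s =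
      (\<Sum>t\<in>I. if (t, g) = r then if (inv t \<otimes> h, g) = s then X r s else 0 else 0)" for I
      by (induction I rule: infinite_finite_induct) (auto simp: scaleC_add_left)
    then show "(\<Sum>t\<in>H. of_bool (r = (t, g)) * of_bool (s = (inv t \<otimes> h, g))) *\<^sub>C X r s =
      (\<Sum>t\<in>H. if (t, g) = r then if (inv t \<otimes> h, g) = s then X r s else 0 else 0)" .
  qed
  also have "\<dots> = (\<Sum>r\<in>H \<times> carrier G. \<Sum>t\<in>H. \<Sum>s\<in>H \<times> carrier G.
      if (t, g) = r then if (inv t \<otimes> h, g) = s then X r s else 0 else 0)"
    by (intro sum.cong refl sum.swap)
  also have "\<dots> = (\<Sum>t\<in>H. \<Sum>r\<in>H \<times> carrier G. \<Sum>s\<in>H \<times> carrier G.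
      if (t, g) = r then if (inv t \<otimes> h, g) = s then X r s else 0 else 0)"
    by (rule sum.swap)
  also have "\<dots> = (\<Sum>t\<in>H. X (t, g) (inv t \<otimes> h, g))"
  proof (intro sum.cong refl)
    fix t assume t: "t \<in> H"
    have "(\<Sum>r\<in>H \<times> carrier G. \<Sum>s\<in>H \<times> carrier G.
        if (t, g) = r then if (inv t \<otimes> h, g) = s then X r s else 0 else 0) =
        (\<Sum>r\<in>H \<times> carrier G. if (t, g) = r then X r (inv t \<otimes> h, g) else 0)"
    proof (intro sum.cong refl)
      fix r
      show "(\<Sum>s\<in>H \<times> carrier G. if (t, g) = r then if (inv t \<otimes> h, g) = s then X r s else 0 else 0) =
        (if (t, g) = r then X r (inv t \<otimes> h, g) else 0)"
        using t h g sum.delta'[OF finite_index, of "(inv t \<otimes> h, g)" "X r"] by auto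
    qed
    also have "\<dots> = X (t, g) (inv t \<otimes> h, g)"
      using t g sum.delta'[OF finite_index, of "(t, g)" "\<lambda>r. X r (inv t \<otimes> h, g)"] by auto
    finally show "(\<Sum>r\<in>H \<times> carrier G. \<Sum>s\<in>H \<times> carrier G.
        if (t, g) = r then if (inv t \<otimes> h, g) = s then X r s else 0 else 0) =
        X (t, g) (inv t \<otimes> h, g)" .
  qed
  finally show ?thesis by (simp add: X_def A_def)
qed

lemma act_expand:
  assumes "a \<in> double G H"
  shows "act a F = (\<Sum>p\<in>H \<times> carrier G. a p *\<^sub>C act (double_basis p) F)"
proof -
  have "(\<lambda>r. \<Sum>p\<in>P. a p * double_basis p r) \<in> double G H \<and>
      act (\<lambda>r. \<Sum>p\<in>P. a p * double_basis p r) F = (\<Sum>p\<in>P. a p *\<^sub>C act (double_basis p) F)"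
    if "P \<subseteq> H \<times> carrier G" for P
    using finite_subset[OF that finite_index] that
  proof (induction P rule: finite_induct)
    case empty
    show ?case
      using act_scale_left[OF assms assms, of 0 F] by (simp add: double_def)
  next
    case (insert p P)
    have p: "double_basis p \<in> double G H"
      using insert by (auto intro: basis_in_double)
    then have ap: "(\<lambda>r. a p * double_basis p r) \<in> double G H"
      by (simp add: double_def)
    show ?case
      using insert act_add_left[OF ap, of "\<lambda>r. \<Sum>p\<in>P. a p * double_basis p r" F] act_scale_left[OF p p, of "a p" F] ap
      by (auto simp: double_def)
  qed
  then have "act (\<lambda>r. \<Sum>p\<in>H \<times> carrier G. a p * double_basis p r) F =
      (\<Sum>p\<in>H \<times> carrier G. a p *\<^sub>C act (double_basis p) F)"
    by blast
  also have "(\<lambda>r. \<Sum>p\<in>H \<times> carrier G. a p * double_basis p r) = a"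
  proof
    fix r
    show "(\<Sum>p\<in>H \<times> carrier G. a p * double_basis p r) = a r"
    proof (cases "r \<in> H \<times> carrier G")
      case True
      have "(\<Sum>p\<in>H \<times> carrier G. a p * double_basis p r) = (\<Sum>p\<in>H \<times> carrier G. of_bool (p = r) * a p)"
        by (intro sum.cong) (auto simp: double_basis_of_bool)
      then show ?thesis using sum_double_basis[OF True, of a] by simp
    next
      case False
      then have "(\<Sum>p\<in>H \<times> carrier G. a p * double_basis p r) = 0"
        by (intro sum.neutral) (auto simp: double_basis_of_bool)
      moreover have "a r = 0" using False assms unfolding double_def by blast
      ultimately show ?thesis by simp
    qed
  qed
  finally show ?thesis .
qed

abbreviation "observables \<equiv> observable_algebra G H act"

lemma observables_iff:
  "F \<in> observables \<longleftrightarrow> (\<forall>h\<in>H. \<forall>g\<in>carrier G. A h g F = (if h = \<one> then F else 0))"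
proof
  assume F: "F \<in> observables"
  show "\<forall>h\<in>H. \<forall>g\<in>carrier G. A h g F = (if h = \<one> then F else 0)"
  proof (intro ballI)
    fix h g assume hg: "h \<in> H" "g \<in> carrier G"
    then have "A h g F = double_counit G H (double_basis (h, g)) *\<^sub>C F"
      using F basis_in_double[OF hg] by (simp add: observable_algebra_def A_def)
    then show "A h g F = (if h = \<one> then F else 0)"
      by (simp add: double_counit_basis[OF hg])
  qed
next
  assume F: "\<forall>h\<in>H. \<forall>g\<in>carrier G. A h g F = (if h = \<one> then F else 0)"
  have "act a F = double_counit G H a *\<^sub>C F" if a: "a \<in> double G H" for a
  proof -
    have sum: "(\<Sum>p\<in>P. f p) *\<^sub>C F = (\<Sum>p\<in>P. f p *\<^sub>C F)" for f and P :: "('g \<times> 'g) set"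
      by (induction P rule: infinite_finite_induct) (auto simp: scaleC_add_left)
    show ?thesis
      unfolding act_expand[OF a] double_counit_def sum
      using F by (intro sum.cong) (auto simp: A_def)
  qed
  then show "F \<in> observables" by (simp add: observable_algebra_def)
qed

lemma A_add: "h \<in> H \<Longrightarrow> g \<in> carrier G \<Longrightarrow> A h g (E + F) = A h g E + A h g F"
  and A_scale: "h \<in> H \<Longrightarrow> g \<in> carrier G \<Longrightarrow> A h g (c *\<^sub>C F) = c *\<^sub>C A h g F"
  by (auto simp: A_def act_add act_scale basis_in_double)

lemma A_zero: "h \<in> H \<Longrightarrow> g \<in> carrier G \<Longrightarrow> A h g 0 = 0"
  using A_scale[of h g 0 0] by simp

lemma A_sum: "h \<in> H \<Longrightarrow> g \<in> carrier G \<Longrightarrow> A h g (\<Sum>i\<in>I. F i) = (\<Sum>i\<in>I. A h g (F i))"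
  by (induction I rule: infinite_finite_induct) (auto simp: A_zero A_add)

lemma A_D:
  assumes "h \<in> H" "g \<in> carrier G" "f \<in> carrier G"
  shows "A h g (D f x) = (if h = \<one> then D (g \<otimes> f) x else 0)"
  using action assms unfolding field_action_def A_def D_def val_def by blast

lemma A_R:
  assumes "h \<in> H" "g \<in> carrier G" "t \<in> H"
  shows "A h g (R t k) = (if h = g \<otimes> t \<otimes> inv g then R h k else 0)"
  using action assms half_odd_of_int unfolding field_action_def A_def R_def val_def by blast

text \<open>If \<open>A t g E\<close> vanishes for every \<open>t\<close> other than the unit, so
  that \<open>E\<close> has trivial H-degree, one term of the coproduct survives. This covers
  observables, with \<open>E' = E\<close>, and the projections \<delta>, with \<open>E'\<close> the
  translated projection.\<close>

lemma A_mult_invariant: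
  assumes "h \<in> H" "g \<in> carrier G" and E: "\<And>t. t \<in> H \<Longrightarrow> A t g E = (if t = \<one> then E' else 0)"
  shows "A h g (E * F) = E' * A h g F"
proof -
  have "A h g (E * F) = (\<Sum>t\<in>H. if t = \<one> then E' * A (inv t \<otimes> h) g F else 0)"
    unfolding A_mult[OF assms(1,2)] by (intro sum.cong) (auto simp: E)
  also have "\<dots> = E' * A h g F"
    using assms finite_H by (simp add: H_carrier)
  finally show ?thesis .
qed

lemma A_D_mult:
  assumes "h \<in> H" "g \<in> carrier G" "f \<in> carrier G"
  shows "A h g (D f x * F) = D (g \<otimes> f) x * A h g F"
  by (rule A_mult_invariant) (use assms in \<open>auto simp: A_D\<close>)

lemma A_observable_mult:
  assumes "h \<in> H" "g \<in> carrier G" "E \<in> observables"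
  shows "A h g (E * F) = E * A h g F"
  by (rule A_mult_invariant) (use assms in \<open>auto simp: observables_iff\<close>)

lemma observables_one: "1 \<in> observables"
  by (simp add: observable_algebra_def act_one)

lemma observables_mult: "E \<in> observables \<Longrightarrow> F \<in> observables \<Longrightarrow> E * F \<in> observables"
  using A_observable_mult[of _ _ E F] by (auto simp: observables_iff)

lemma observables_add: "E \<in> observables \<Longrightarrow> F \<in> observables \<Longrightarrow> E + F \<in> observables"
  by (auto simp: observables_iff A_add)

lemma observables_scale: "F \<in> observables \<Longrightarrow> c *\<^sub>C F \<in> observables"
  by (auto simp: observables_iff A_scale)

lemma observables_zero: "0 \<in> observables"
  by (simp add: observables_iff A_zero)

lemma observables_sum: "(\<And>i. i \<in> I \<Longrightarrow> F i \<in> observables) \<Longrightarrow> (\<Sum>i\<in>I. F i) \<in> observables"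
  by (induction I rule: infinite_finite_induct) (auto intro: observables_zero observables_add)

lemma observables_closed: "closed observables"
proof -
  have "continuous_on UNIV (\<lambda>F. c *\<^sub>C (F :: 'f))" for c
    unfolding continuous_on_def by (auto intro: tendsto_scaleC)
  then have "closed {F. act a F = double_counit G H a *\<^sub>C F}" if "a \<in> double G H" for a
    using act_continuous[OF that] by (intro closed_Collect_eq)
  moreover have "observables = (\<Inter>a\<in>double G H. {F. act a F = double_counit G H a *\<^sub>C F})"
    by (auto simp: observable_algebra_def)
  ultimately show ?thesis by (simp add: closed_INT)
qed

text \<open>After conjugation by \<open>g\<close> the H-degrees of the two factors are inverse to
  each other, so the total degree is trivial and only the conjugation of the parameter
  remains.\<close>

lemma A_T:
  assumes "h \<in> H" "g \<in> carrier G" "s \<in> H"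
  shows "A h g (T s x) = (if h = \<one> then T (g \<otimes> s \<otimes> inv g) x else 0)"
proof -
  let ?s = "g \<otimes> s \<otimes> inv g"
  have s: "?s \<in> H" using assms by (simp add: conj_H)
  have "A h g (T s x) = (\<Sum>t\<in>H. if t = ?s then
      R ?s (x - 1) * (if inv ?s \<otimes> h = g \<otimes> inv s \<otimes> inv g then R (inv ?s \<otimes> h) x else 0) else 0)"
    unfolding T_def A_mult[OF assms(1,2)]
    by (intro sum.cong) (use assms s in \<open>auto simp: A_R\<close>)
  also have "\<dots> = R ?s (x - 1) * (if inv ?s \<otimes> h = g \<otimes> inv s \<otimes> inv g then R (inv ?s \<otimes> h) x else 0)"
    using s finite_H by simp
  also have "g \<otimes> inv s \<otimes> inv g = inv ?s"
    using assms by (simp add: group_word)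
  also have "inv ?s \<otimes> h = inv ?s \<longleftrightarrow> h = \<one>"
    using assms s by (simp add: H_carrier)
  finally show ?thesis using s by (auto simp: T_def H_carrier)
qed

text \<open>The group acts on the projections by sending f to g f and on \<open>T\<close> by
  conjugating its parameter. The parameter f h^{-1} f^{-1} follows \<open>f\<close>, so the sum is
  merely reindexed.\<close>

lemma V_observable:
  assumes h: "h \<in> H"
  shows "V h x \<in> observables"
  unfolding observables_iff
proof (intro ballI)
  fix k g assume kg: "k \<in> H" "g \<in> carrier G"
  have "A k g (V h x) = (\<Sum>f\<in>carrier G. if k = \<one> then
      D (g \<otimes> f) x * T ((g \<otimes> f) \<otimes> inv h \<otimes> inv (g \<otimes> f)) x else 0)"
    unfolding V_def A_sum[OF kg]
  proof (intro sum.cong refl)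
    fix f assume f: "f \<in> carrier G"
    have "A k g (D f x * T (f \<otimes> inv h \<otimes> inv f) x) = D (g \<otimes> f) x *
        (if k = \<one> then T (g \<otimes> (f \<otimes> inv h \<otimes> inv f) \<otimes> inv g) x else 0)"
      using f kg h by (simp only: A_D_mult A_T conj_inv_H)
    also have "g \<otimes> (f \<otimes> inv h \<otimes> inv f) \<otimes> inv g = (g \<otimes> f) \<otimes> inv h \<otimes> inv (g \<otimes> f)"
      using f kg h by (simp add: group_word)
    finally show "A k g (D f x * T (f \<otimes> inv h \<otimes> inv f) x) = (if k = \<one> then
      D (g \<otimes> f) x * T ((g \<otimes> f) \<otimes> inv h \<otimes> inv (g \<otimes> f)) x else 0)"
      by simp
  qed
  also have "\<dots> = (if k = \<one> then V h x else 0)"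
    using sum_left_translate[OF kg(2), of "\<lambda>f. D f x * T (f \<otimes> inv h \<otimes> inv f) x"]
    by (simp add: V_def)
  finally show "A k g (V h x) = (if k = \<one> then V h x else 0)" .
qed

lemma W_observable:
  assumes h: "h \<in> carrier G"
  shows "W h x \<in> observables"
  unfolding observables_iff
proof (intro ballI)
  fix k g assume kg: "k \<in> H" "g \<in> carrier G"
  have "A k g (W h x) = (\<Sum>f\<in>carrier G. if k = \<one> then D (g \<otimes> f) x * D ((g \<otimes> f) \<otimes> h) (x + 1) else 0)"
    unfolding W_def A_sum[OF kg]
    by (intro sum.cong) (use kg h in \<open>auto simp: A_D_mult A_D m_assoc\<close>)
  also have "\<dots> = (if k = \<one> then W h x else 0)"
    using sum_left_translate[OF kg(2), of "\<lambda>f. D f x * D (f \<otimes> h) (x + 1)"]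
    by (simp add: W_def)
  finally show "A k g (W h x) = (if k = \<one> then W h x else 0)" .
qed

lemma observable_gen_observable: "q \<in> site_basis G H i \<Longrightarrow> observable_gen i q \<in> observables"
  by (simp add: observable_gen_def site_basis_def V_observable W_observable split: if_splits)

lemma ordered_product_observable:
  assumes "\<And>i. i \<in> {n..m} \<Longrightarrow> b i \<in> site_basis G H i"
  shows "ordered_product observable_gen n m b \<in> observables"
proof -
  have "foldr (\<lambda>i z. observable_gen i (b i) * z) is 1 \<in> observables" if "set is \<subseteq> {n..m}" for "is"
    using that by (induction "is")
      (auto intro!: observables_one observables_mult observable_gen_observable assms)
  then show ?thesis by (simp add: ordered_product_def)
qed

text \<open>The left module over \<open>B\<close> generated by finitely many elements;
  \<open>R t 0\<close> is the image of \<rho> at 1/2. For an algebra \<open>B\<close> scalars are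
  absorbed into the coefficient, so sums are the only closure rule.\<close>

inductive_set field_span :: "'f set \<Rightarrow> 'f set" for B where
  base: "b \<in> B \<Longrightarrow> f \<in> carrier G \<Longrightarrow> t \<in> H \<Longrightarrow> b * (D f 0 * R t 0) \<in> field_span B"
| add: "E \<in> field_span B \<Longrightarrow> F \<in> field_span B \<Longrightarrow> E + F \<in> field_span B"

text \<open>The definition of \<open>V\<close> inverted: on the value \<open>f\<close> the parameter
  conjugated back by \<open>f\<close> reproduces \<open>T s x\<close>, and the projections sum to
  1.\<close>

lemma T_conv_V:
  assumes "s \<in> H"
  shows "T s x = (\<Sum>f\<in>carrier G. D f x * V (inv f \<otimes> inv s \<otimes> f) x)"
proof -
  have "(\<Sum>f\<in>carrier G. D f x * V (inv f \<otimes> inv s \<otimes> f) x) = (\<Sum>f\<in>carrier G. D f x * T s x)"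
    by (intro sum.cong) (use assms in \<open>auto simp: D_V group_word\<close>)
  then show ?thesis by (simp add: D_sum flip: sum_distrib_right)
qed

text \<open>A link operator transports the value at \<open>x\<close> to \<open>x + 1\<close>.
  Together with \<open>T_conv_V\<close> and the three lemmas that follow, it reaches all generators
  of the field algebra from \<open>D f 0\<close>, \<open>R t 0\<close>, \<open>V\<close> and
  \<open>W\<close>.\<close>

lemma D_step_up:
  assumes "g \<in> carrier G"
  shows "D g (x + 1) = (\<Sum>f\<in>carrier G. D f x * W (inv f \<otimes> g) x)"
proof -
  have "(\<Sum>f\<in>carrier G. D f x * W (inv f \<otimes> g) x) = (\<Sum>f\<in>carrier G. D f x * D g (x + 1))"
    by (intro sum.cong) (use assms in \<open>auto simp: D_W group_word\<close>)
  then show ?thesis by (simp add: D_sum flip: sum_distrib_right)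
qed

lemma D_step_down:
  assumes g: "g \<in> carrier G"
  shows "D g x = (\<Sum>f\<in>carrier G. W (inv g \<otimes> f) x * D f (x + 1))"
proof -
  have "W (inv g \<otimes> f) x * D f (x + 1) = D g x * D f (x + 1)" if f: "f \<in> carrier G" for f
  proof -
    have eq: "e \<otimes> (inv g \<otimes> f) = f \<longleftrightarrow> g = e" if e: "e \<in> carrier G" for e
    proof
      assume "e \<otimes> (inv g \<otimes> f) = f"
      then have "e \<otimes> (inv g \<otimes> f) \<otimes> inv f \<otimes> g = f \<otimes> inv f \<otimes> g" by simp
      then show "g = e" using e f g by (simp add: group_word)
    qed (use f g in \<open>auto simp: group_word\<close>)
    have "W (inv g \<otimes> f) x * D f (x + 1) = (\<Sum>e\<in>carrier G. if g = e then D g x * D f (x + 1) else 0)"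
      unfolding W_def sum_distrib_right
      by (intro sum.cong refl) (use f g eq in \<open>auto simp: mult.assoc D_mult cancel_inv\<close>)
    then show ?thesis using g finite_carrier by simp
  qed
  then have "(\<Sum>f\<in>carrier G. W (inv g \<otimes> f) x * D f (x + 1)) = (\<Sum>f\<in>carrier G. D g x * D f (x + 1))"
    by (intro sum.cong) auto
  then show ?thesis by (simp add: D_sum flip: sum_distrib_left)
qed

text \<open>\<open>T\<close> at \<open>k + 1\<close> undoes the translation of this one site and so
  moves the start of the half-line by one.\<close>

lemma R_step_up:
  assumes "s \<in> H"
  shows "R s (k + 1) = T (inv s) (k + 1) * R s k"
proof -
  have "T (inv s) (k + 1) * R s k = R (inv s) k * (R s (k + 1) * R s k)"
    using assms by (simp add: T_def mult.assoc H_carrier)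
  also have "R s (k + 1) * R s k = R s k * R (inv s \<otimes> s \<otimes> s) (k + 1)"
    using assms by (intro R_R_greater) auto
  also have "R (inv s) k * (R s k * R (inv s \<otimes> s \<otimes> s) (k + 1)) = R s (k + 1)"
    using assms by (simp add: R_mult R_one H_carrier flip: mult.assoc)
  finally show ?thesis by simp
qed

lemma R_step_down:
  assumes "s \<in> H"
  shows "R s (k - 1) = T s k * R s k"
  using assms by (simp add: T_def mult.assoc R_mult R_one H_carrier)

text \<open>\<open>R t 0\<close> translates the sites beyond 0, so it preserves the quotient along
  every link on one side of 1/2. Only the link from 0 to 1 is changed, by a group element depending
  on the value at 0, and \<open>D f 0\<close> fixes that value.\<close>

lemma D_R_W:
  assumes f: "f \<in> carrier G" and t: "t \<in> H" and g: "g \<in> carrier G"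
  shows "\<exists>g'\<in>carrier G. D f 0 * R t 0 * W g x = W g' x * (D f 0 * R t 0)"
proof -
  have tc: "t \<in> carrier G" using t by (rule H_carrier)
  have comm: "D f 0 * (W k x * R t 0) = W k x * (D f 0 * R t 0)" if "k \<in> carrier G" for k
    using f that by (simp add: W_D flip: mult.assoc)
  consider "x < 0" | "x = 0" | "x > 0" by linarith
  then show ?thesis
  proof cases
    case 1
    have "R t 0 * (D e x * D (e \<otimes> g) (x + 1)) = D e x * D (e \<otimes> g) (x + 1) * R t 0"
      if "e \<in> carrier G" for e
      using 1 t g that by (intro intertwine_mult R_D_ge) auto
    then have "R t 0 * W g x = W g x * R t 0"
      unfolding W_def sum_distrib_left sum_distrib_right by (intro sum.cong) auto
    then show ?thesis using g comm by (auto simp: mult.assoc)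
  next
    case 2
    have "R t 0 * (D e 0 * D (e \<otimes> g) 1) = D e 0 * D (t \<otimes> e \<otimes> g) 1 * R t 0"
      if "e \<in> carrier G" for e
      using t tc g that R_D_less[of t "e \<otimes> g" 0 1]
      by (intro intertwine_mult) (auto simp: R_D_ge m_assoc)
    then have "R t 0 * W g 0 = (\<Sum>e\<in>carrier G. D e 0 * (D (t \<otimes> e \<otimes> g) 1 * R t 0))"
      unfolding W_def sum_distrib_left by (intro sum.cong) (auto simp: mult.assoc)
    then have "D f 0 * R t 0 * W g 0 = D f 0 * D (t \<otimes> f \<otimes> g) 1 * R t 0"
      using D_mult_sum[OF f, of 0 "\<lambda>e. D (t \<otimes> e \<otimes> g) 1 * R t 0"] by (simp add: mult.assoc)
    also have "D f 0 * D (t \<otimes> f \<otimes> g) 1 = D f 0 * W (inv f \<otimes> t \<otimes> f \<otimes> g) 0"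
      using f tc g by (simp add: D_W group_word)
    finally show ?thesis
      using 2 f tc g comm[of "inv f \<otimes> t \<otimes> f \<otimes> g"]
      by (intro bexI[of _ "inv f \<otimes> t \<otimes> f \<otimes> g"]) (auto simp: mult.assoc)
  next
    case 3
    have "R t 0 * (D e x * D (e \<otimes> g) (x + 1)) = D (t \<otimes> e) x * D ((t \<otimes> e) \<otimes> g) (x + 1) * R t 0"
      if e: "e \<in> carrier G" for e
    proof -
      have "R t 0 * D e x = D (t \<otimes> e) x * R t 0"
        using 3 t e by (intro R_D_less)
      moreover have "R t 0 * D (e \<otimes> g) (x + 1) = D (t \<otimes> (e \<otimes> g)) (x + 1) * R t 0"
        using 3 t e g by (intro R_D_less) auto
      ultimately show ?thesis
        using tc e g by (intro intertwine_mult) (auto simp: m_assoc)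
    qed
    then have "R t 0 * W g x = (\<Sum>e\<in>carrier G. D (t \<otimes> e) x * D ((t \<otimes> e) \<otimes> g) (x + 1) * R t 0)"
      unfolding W_def sum_distrib_left by (intro sum.cong) auto
    also have "\<dots> = W g x * R t 0"
      unfolding W_def sum_distrib_right
      by (rule sum_left_translate[OF tc, of "\<lambda>e. D e x * D (e \<otimes> g) (x + 1) * R t 0"])
    finally show ?thesis using g comm by (auto simp: mult.assoc)
  qed
qed

text \<open>\<open>V\<close> commutes with \<open>R\<close> and with projections away from its own
  site; at site 0 it shifts the value, hence the new \<open>f'\<close>.\<close>

lemma D_R_V:
  assumes f: "f \<in> carrier G" and t: "t \<in> H" and h: "h \<in> H"
  shows "\<exists>f'\<in>carrier G. D f 0 * R t 0 * V h x = V h x * (D f' 0 * R t 0)"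
proof -
  have hc: "h \<in> carrier G" using h by (rule H_carrier)
  have "D f 0 * R t 0 * V h x = D f 0 * V h x * R t 0"
    using t h by (simp add: V_R mult.assoc)
  moreover obtain f' where "f' \<in> carrier G" "D f 0 * V h x = V h x * D f' 0"
  proof (cases "x = 0")
    case True
    then show ?thesis
      using V_D_same[OF h, of "f \<otimes> h" x] f hc by (intro that[of "f \<otimes> h"]) (auto simp: group_word)
  next
    case False
    then show ?thesis using V_D_other[OF h f, of 0 x] f by (intro that[of f]) auto
  qed
  ultimately show ?thesis by (intro bexI[of _ f']) (simp_all add: mult.assoc)
qed

text \<open>The field algebra is spanned over \<open>B\<close> by the products \<open>D f 0 * R t 0\<close>, and averaging over
  the group maps this span into \<open>B\<close>.\<close>

theorem observables_subset_closure:
  assumes one: "1 \<in> B" and add: "\<And>E F. E \<in> B \<Longrightarrow> F \<in> B \<Longrightarrow> E + F \<in> B"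
    and mult: "\<And>E F. E \<in> B \<Longrightarrow> F \<in> B \<Longrightarrow> E * F \<in> B"
    and scale: "\<And>c F. F \<in> B \<Longrightarrow> c *\<^sub>C F \<in> B"
    and gen: "\<And>i q. q \<in> site_basis G H i \<Longrightarrow> observable_gen i q \<in> B"
    and obs: "B \<subseteq> observables"
  shows "observables \<subseteq> closure B"
proof -
  \<comment> \<open>The right multipliers of the span. They form an algebra, so it is enough to
    place the generators of the field algebra in \<open>N\<close>; applying them to 1, which lies in
    the span, then brings every local element into the span.\<close>
  define N where "N = {y. \<forall>x\<in>field_span B. x * y \<in> field_span B}"
  have VB: "V h x \<in> B" if "h \<in> H" for h x
    using gen[of h "2 * x"] that by (simp add: observable_gen_def site_basis_def)
  have WB: "W g x \<in> B" if "g \<in> carrier G" for g x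
    using gen[of g "2 * x + 1"] that by (simp add: observable_gen_def site_basis_def)
  have zero: "0 \<in> B" using scale[OF one, of 0] by simp
  have span_zero: "0 \<in> field_span B"
    using field_span.base[OF zero one_closed subgroup.one_closed[OF subgroup_axioms]] by simp
  have span_sum: "(\<Sum>i\<in>I. F i) \<in> field_span B" if "\<And>i. i \<in> I \<Longrightarrow> F i \<in> field_span B"
    for I and F :: "'g \<Rightarrow> 'f"
    using that by (induction I rule: infinite_finite_induct) (auto intro: span_zero field_span.add)
  have span_scale: "c *\<^sub>C F \<in> field_span B" if "F \<in> field_span B" for c F
    using that
  proof induction
    case (base b f t)
    then show ?case
      using field_span.base[OF scale[OF base(1), of c] base(2,3)] by (simp add: scaleC_mult_left)
  qed (auto simp: scaleC_add_right intro: field_span.add)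
  have N_add: "E + F \<in> N" if "E \<in> N" "F \<in> N" for E F
    using that by (auto simp: N_def distrib_left intro: field_span.add)
  have N_mult: "E * F \<in> N" if "E \<in> N" "F \<in> N" for E F
    using that by (auto simp: N_def simp flip: mult.assoc)
  have N_scale: "c *\<^sub>C F \<in> N" if "F \<in> N" for c F
    using that by (auto simp: N_def scaleC_mult_right intro: span_scale)
  have N_zero: "0 \<in> N" using span_zero by (simp add: N_def)
  have N_one: "1 \<in> N" by (simp add: N_def)
  have N_sum: "(\<Sum>i\<in>I. F i) \<in> N" if "\<And>i. i \<in> I \<Longrightarrow> F i \<in> N" for I and F :: "'g \<Rightarrow> 'f"
    using that by (induction I rule: infinite_finite_induct) (auto intro: N_zero N_add)
  have NI: "y \<in> N" if y: "\<And>b f t. b \<in> B \<Longrightarrow> f \<in> carrier G \<Longrightarrow> t \<in> H \<Longrightarrow>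
      b * (D f 0 * R t 0 * y) \<in> field_span B" for y
  proof -
    have "x * y \<in> field_span B" if "x \<in> field_span B" for x
      using that
    proof induction
      case (base b f t)
      then show ?case using y[of b f t] by (simp add: mult.assoc)
    qed (auto simp: distrib_right intro: field_span.add)
    then show ?thesis by (simp add: N_def)
  qed
  have N_D0: "D g 0 \<in> N" if g: "g \<in> carrier G" for g
  proof (rule NI)
    fix b f t assume *: "b \<in> B" "f \<in> carrier G" "t \<in> H"
    have "D f 0 * R t 0 * D g 0 = D f 0 * D g 0 * R t 0"
      using * g by (simp add: mult.assoc R_D_ge)
    then show "b * (D f 0 * R t 0 * D g 0) \<in> field_span B"
      using * g by (auto simp: D_mult intro: span_zero field_span.base)
  qed
  have N_R0: "R s 0 \<in> N" if s: "s \<in> H" for s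
    by (rule NI) (use s in \<open>auto simp: mult.assoc R_mult intro: field_span.base\<close>)
  have N_W: "W g x \<in> N" if g: "g \<in> carrier G" for g x
  proof (rule NI)
    fix b f t assume *: "b \<in> B" "f \<in> carrier G" "t \<in> H"
    then obtain g' where "g' \<in> carrier G" "D f 0 * R t 0 * W g x = W g' x * (D f 0 * R t 0)"
      using D_R_W g by blast
    then show "b * (D f 0 * R t 0 * W g x) \<in> field_span B"
      using field_span.base[OF mult[OF *(1) WB] *(2,3), of g' x] by (simp add: mult.assoc)
  qed
  have N_V: "V h x \<in> N" if h: "h \<in> H" for h x
  proof (rule NI)
    fix b f t assume *: "b \<in> B" "f \<in> carrier G" "t \<in> H"
    then obtain f' where "f' \<in> carrier G" "D f 0 * R t 0 * V h x = V h x * (D f' 0 * R t 0)"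
      using D_R_V h by blast
    then show "b * (D f 0 * R t 0 * V h x) \<in> field_span B"
      using field_span.base[OF mult[OF *(1) VB[OF h]] _ *(3), of f' x] by (simp add: mult.assoc)
  qed
  \<comment> \<open>The value at site 0 is transported along the links in both directions.\<close>
  have N_D: "\<forall>g\<in>carrier G. D g x \<in> N" for x
  proof (induction x rule: int_induct[where k = 0])
    case base
    then show ?case using N_D0 by blast
  next
    case (step1 x)
    then show ?case by (auto simp: D_step_up intro!: N_sum N_mult N_W)
  next
    case (step2 x)
    then show ?case
      using D_step_down[of _ "x - 1"] by (auto intro!: N_sum N_mult N_W)
  qed
  have N_T: "T s x \<in> N" if "s \<in> H" for s x
    unfolding T_conv_V[OF that] using N_D that by (intro N_sum N_mult N_V conj_H') auto
  have N_R: "\<forall>s\<in>H. R s k \<in> N" for k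
  proof (induction k rule: int_induct[where k = 0])
    case base
    then show ?case using N_R0 by blast
  next
    case (step1 k)
    then show ?case by (auto simp: R_step_up intro!: N_mult N_T)
  next
    case (step2 k)
    then show ?case by (auto simp: R_step_down intro!: N_mult N_T)
  qed
  have N_val: "val p \<in> N" if p: "p \<in> field_free" for p
  proof -
    have "p \<in> field_free \<and> val p \<in> N"
    proof (induction p rule: poly_mapping_single_induct)
      case (single w c)
      then have "set w \<subseteq> field_gens G H" using p by (simp add: field_free_iff)
      then show ?case
      proof (induction w)
        case Nil
        then show ?case
          using val_scale[OF field_free_one, of c] N_scale[OF N_one]
          by (simp add: val_one field_free_single)
      next
        case (Cons a w)
        have a: "Poly_Mapping.single [a] 1 \<in> field_free"
          using Cons by (intro field_free_single) auto
        have "Poly_Mapping.single (a # w) c = Poly_Mapping.single [a] 1 * Poly_Mapping.single w c"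
          by (simp add: mult_single plus_list_def)
        moreover have "val (Poly_Mapping.single [a] 1) \<in> N"
        proof -
          have "a \<in> field_gens G H" using Cons by simp
          then show ?thesis
            using N_D N_R by (auto simp: field_gens_def D_def R_def half_odd_iff)
        qed
        ultimately show ?case
          using Cons a by (auto simp: val_mult intro: field_free_mult N_mult)
      qed
    qed (auto simp: val_zero val_add intro: N_zero N_add field_free_zero field_free_add)
    then show ?thesis ..
  qed
  have "(\<Sum>f\<in>carrier G. 1 * (D f 0 * R \<one> 0)) \<in> field_span B"
    using one by (intro span_sum field_span.base) auto
  then have "1 \<in> field_span B" by (simp add: R_one D_sum)
  then have val_span: "val p \<in> field_span B" if "p \<in> field_free" for p
    using N_val[OF that] by (auto simp: N_def)
  \<comment> \<open>The sum of the basis vectors (e, g) of the double is |G| times its Haar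
    integral: it projects to trivial H-degree and sums over the group. The constant \<open>c\<close>
    below removes the factor |G|.\<close>
  define Ex where "Ex F = (\<Sum>g\<in>carrier G. A \<one> g F)" for F
  have Ex_span: "Ex F \<in> B" if "F \<in> field_span B" for F
    using that
  proof induction
    case (base b f t)
    have t: "t \<in> carrier G" using base by (simp add: H_carrier)
    have "A \<one> g (b * (D f 0 * R t 0)) = (if t = \<one> then b * D (g \<otimes> f) 0 else 0)"
      if g: "g \<in> carrier G" for g
    proof -
      have "\<one> = g \<otimes> t \<otimes> inv g \<longleftrightarrow> t = \<one>"
      proof
        assume "\<one> = g \<otimes> t \<otimes> inv g"
        then have "inv g \<otimes> \<one> \<otimes> g = inv g \<otimes> (g \<otimes> t \<otimes> inv g) \<otimes> g" by simp
        then show "t = \<one>" using g t by (simp add: group_word)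
      qed (use g in simp)
      moreover have "A \<one> g (b * (D f 0 * R t 0)) = b * (D (g \<otimes> f) 0 * A \<one> g (R t 0))"
      proof -
        have "A \<one> g (b * (D f 0 * R t 0)) = b * A \<one> g (D f 0 * R t 0)"
          using base(1) obs g by (intro A_observable_mult) auto
        then show ?thesis using g base(2) by (simp only: A_D_mult one_closed subgroup.one_closed[OF subgroup_axioms])
      qed
      ultimately show ?thesis using g base(3) by (simp add: A_R R_one)
    qed
    then have "Ex (b * (D f 0 * R t 0)) = (\<Sum>g\<in>carrier G. if t = \<one> then b * D (g \<otimes> f) 0 else 0)"
      unfolding Ex_def by (intro sum.cong) auto
    \<comment> \<open>As \<open>g\<close> runs through the group, so does
      \<open>g \<otimes> f\<close>; the projections add up to 1 and \<open>b\<close> itself comes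
      back.\<close>
    also have "\<dots> = (if t = \<one> then b else 0)"
      using sum_right_translate[OF base(2), of "\<lambda>g. D g 0"]
      by (simp add: D_sum flip: sum_distrib_left)
    finally show ?case using base zero by simp
  next
    case (add E F)
    then show ?case
      using assms(2)[of "Ex E" "Ex F"] by (simp add: Ex_def A_add sum.distrib)
  qed
  have "continuous_on UNIV Ex"
    unfolding Ex_def A_def by (intro continuous_on_sum act_continuous basis_in_double) auto
  show ?thesis
  proof
    fix F assume F: "F \<in> observables"
    define c :: complex where "c = 1 / of_nat (card (carrier G))"
    have card: "card (carrier G) \<noteq> 0" using finite_carrier by auto
    have "F \<in> closure (val ` field_free)" using val_dense by simp
    then obtain X where X: "\<And>n. X n \<in> val ` field_free" "X \<longlonglongrightarrow> F"
      unfolding closure_sequential by blast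
    \<comment> \<open>The approximants \<open>X n\<close> may fail to be invariant, but their
      normalised averages lie in \<open>B\<close> and still converge to \<open>F\<close>, because
      averaging is continuous and fixes observables.\<close>
    have "(\<lambda>n. Ex (X n)) \<longlonglongrightarrow> Ex F"
      using \<open>continuous_on UNIV Ex\<close> X(2) by (auto simp: continuous_on_sequentially o_def)
    then have "(\<lambda>n. c *\<^sub>C Ex (X n)) \<longlonglongrightarrow> c *\<^sub>C Ex F" by (rule tendsto_scaleC)
    moreover have "c *\<^sub>C Ex F = F"
    proof -
      have "Ex F = (\<Sum>g\<in>carrier G. F)"
        unfolding Ex_def using F by (intro sum.cong) (auto simp: observables_iff)
      also have "\<dots> = of_nat (card (carrier G)) *\<^sub>C F"
        using scaleC_of_real[of "real (card (carrier G))" F]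
        by (simp add: sum_constant_scaleR del: sum_constant)
      finally show ?thesis using card by (simp add: c_def scaleC_scaleC)
    qed
    moreover have "c *\<^sub>C Ex (X n) \<in> B" for n
      using X(1)[of n] val_span Ex_span scale by auto
    ultimately show "F \<in> closure B"
      unfolding closure_sequential by (intro exI[of _ "\<lambda>n. c *\<^sub>C Ex (X n)"]) auto
  qed
qed

end


section \<open>Faithfulness on configurations\<close>

text \<open>A representation of the field algebra by operators on functions of configurations
  \<open>s :: int \<Rightarrow> 'g\<close>: $\delta_g(x)$ is the projection onto \<open>s x = g\<close>, and $\rho_h(l)$ translates all sites
  \<open>x > l\<close> by \<open>h\<close>.  It is faithful on the observables, which is all that is needed.\<close>

primrec letter_op ::
  "('g, 'z) monoid_scheme \<Rightarrow> 'g field_gen \<Rightarrow> ((int \<Rightarrow> 'g) \<Rightarrow> complex) \<Rightarrow> (int \<Rightarrow> 'g) \<Rightarrow> complex" where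
  "letter_op G (Delta g x) \<psi> = (\<lambda>s. if s x = g then \<psi> s else 0)"
| "letter_op G (Rho h l) \<psi> = (\<lambda>s. \<psi> (\<lambda>y. if l < of_int y then inv\<^bsub>G\<^esub> h \<otimes>\<^bsub>G\<^esub> s y else s y))"

definition poly_op ::
  "('g, 'z) monoid_scheme \<Rightarrow> 'g field_poly \<Rightarrow> ((int \<Rightarrow> 'g) \<Rightarrow> complex) \<Rightarrow> (int \<Rightarrow> 'g) \<Rightarrow> complex" where
  "poly_op G p \<psi> s =
     (\<Sum>w\<in>Poly_Mapping.keys p. Poly_Mapping.lookup p w * foldr (letter_op G) w \<psi> s)"

lemma poly_op_single: "poly_op G (Poly_Mapping.single w c) \<psi> s = c * foldr (letter_op G) w \<psi> s"
  by (simp add: poly_op_def)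

lemma poly_op_zero: "poly_op G 0 \<psi> s = 0"
  by (simp add: poly_op_def)

lemma poly_op_add: "poly_op G (p + q) \<psi> s = poly_op G p \<psi> s + poly_op G q \<psi> s"
  unfolding poly_op_def by (rule setsum_keys_plus_distrib) (auto simp: distrib_right)

lemma poly_op_one: "poly_op G 1 \<psi> s = \<psi> s"
  using poly_op_single[of G "[]" 1] by (simp add: single_Nil_one)

lemma poly_op_diff: "poly_op G (p - q) \<psi> s = poly_op G p \<psi> s - poly_op G q \<psi> s"
  using poly_op_add[of G "p - q" q] by simp

lemma poly_op_sum: "poly_op G (\<Sum>i\<in>I. f i) \<psi> s = (\<Sum>i\<in>I. poly_op G (f i) \<psi> s)"
  by (induction I rule: infinite_finite_induct) (auto simp: poly_op_zero poly_op_add)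

lemma letter_op_add:
  "letter_op G a (\<lambda>s. \<phi> s + \<psi> s) = (\<lambda>s. letter_op G a \<phi> s + letter_op G a \<psi> s)"
  by (cases a) auto

lemma letter_op_scale: "letter_op G a (\<lambda>s. c * \<psi> s) = (\<lambda>s. c * letter_op G a \<psi> s)"
  by (cases a) auto

lemma word_op_add:
  "foldr (letter_op G) w (\<lambda>s. \<phi> s + \<psi> s) =
     (\<lambda>s. foldr (letter_op G) w \<phi> s + foldr (letter_op G) w \<psi> s)"
  by (induction w) (auto simp: letter_op_add)

lemma word_op_scale:
  "foldr (letter_op G) w (\<lambda>s. c * \<psi> s) = (\<lambda>s. c * foldr (letter_op G) w \<psi> s)"
  by (induction w) (auto simp: letter_op_scale)

lemma word_op_zero: "foldr (letter_op G) w (\<lambda>s. 0) = (\<lambda>s. 0)"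
  using word_op_scale[of G w 0] by simp

lemma poly_op_mult: "poly_op G (p * q) \<psi> s = poly_op G p (poly_op G q \<psi>) s"
proof (induction p rule: poly_mapping_single_induct)
  case (single w c)
  show ?case
  proof (induction q rule: poly_mapping_single_induct)
    case (single v d)
    have "poly_op G (Poly_Mapping.single v d) \<psi> = (\<lambda>s. d * foldr (letter_op G) v \<psi> s)"
      by (rule ext) (rule poly_op_single)
    then show ?case
      by (simp add: mult_single plus_list_def poly_op_single word_op_scale)
  next
    case zero
    have "poly_op G 0 \<psi> = (\<lambda>s. 0)" by (rule ext) (rule poly_op_zero)
    then show ?case by (simp add: poly_op_single word_op_zero poly_op_zero)
  next
    case (add a b)
    have "poly_op G (a + b) \<psi> = (\<lambda>s. poly_op G a \<psi> s + poly_op G b \<psi> s)"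
      by (rule ext) (rule poly_op_add)
    with add show ?case
      by (simp add: poly_op_single word_op_add poly_op_add distrib_left)
  qed
qed (simp_all add: poly_op_zero poly_op_add distrib_right)

lemma poly_op_zero_right: "poly_op G p (\<lambda>s. 0) s = 0"
  by (simp add: poly_op_def word_op_zero)

lemma poly_op_dl: "poly_op G (dl g x) \<psi> s = (if s x = g then \<psi> s else 0)"
  by (simp add: poly_op_single)

lemma poly_op_rh:
  "poly_op G (rh h l) \<psi> s = \<psi> (\<lambda>y. if l < of_int y then inv\<^bsub>G\<^esub> h \<otimes>\<^bsub>G\<^esub> s y else s y)"
  by (simp add: poly_op_single)

section \<open>The relations on configurations and the action of ordered products\<close>

context finite_normal
begin

definition states :: "(int \<Rightarrow> 'g) set" where
  "states = {s. \<forall>x. s x \<in> carrier G}"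

text \<open>The relations are checked at configurations with values in the group, while functions
  live on all of \<open>int \<Rightarrow> 'g\<close>. Letters evaluate at configurations of
  \<open>states\<close> again, so values elsewhere have no influence.\<close>

lemma poly_op_cong:
  assumes p: "p \<in> field_free" and eq: "\<And>s. s \<in> states \<Longrightarrow> \<phi> s = \<psi> s" and s: "s \<in> states"
  shows "poly_op G p \<phi> s = poly_op G p \<psi> s"
proof -
  have letter: "letter_op G a \<phi> s = letter_op G a \<psi> s"
    if "a \<in> field_gens G H" "\<And>s. s \<in> states \<Longrightarrow> \<phi> s = \<psi> s" "s \<in> states" for a \<phi> \<psi> s
    using that by (auto simp: field_gens_def states_def H_carrier)
  have "\<forall>s\<in>states. foldr (letter_op G) w \<phi> s = foldr (letter_op G) w \<psi> s"
    if "set w \<subseteq> field_gens G H" for w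
    using that by (induction w) (auto intro: letter eq)
  then show ?thesis
    using p s unfolding poly_op_def field_free_iff by (intro sum.cong) auto
qed

text \<open>The polynomials acting by 0 on \<open>states\<close> form an ideal, so it is enough to
  check the relators. \<open>poly_op_cong\<close> enters for left multiples, where the inner
  function is known to vanish on \<open>states\<close>.\<close>

lemma field_ideal_poly_op:
  assumes "p \<in> field_ideal G H" "s \<in> states"
  shows "poly_op G p \<psi> s = 0"
proof -
  define J where "J = {p \<in> field_free. \<forall>\<psi>. \<forall>s\<in>states. poly_op G p \<psi> s = 0}"
  have "ideal J (free_field G H)"
  proof (rule ideal_freeI)
    fix p q assume p: "p \<in> J" and q: "q \<in> field_free"
    have "poly_op G q (poly_op G p \<psi>) s = 0" if "s \<in> states" for \<psi> s
      using poly_op_cong[OF q _ that, of "poly_op G p \<psi>" "\<lambda>s. 0"] p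
      by (simp add: J_def poly_op_zero_right)
    then show "q * p \<in> J"
      using p q by (auto simp: J_def poly_op_mult intro: field_free_mult)
    show "p * q \<in> J"
      using p q by (auto simp: J_def poly_op_mult intro: field_free_mult)
  qed (auto simp: J_def poly_op_zero poly_op_add intro: field_free_zero field_free_add)
  moreover have "field_relators G H \<subseteq> J"
  proof
    fix r assume r: "r \<in> field_relators G H"
    have "poly_op G r \<psi> s = 0" if s: "s \<in> states" for \<psi> s
    proof -
      note ops = poly_op_diff poly_op_mult poly_op_sum poly_op_one poly_op_zero poly_op_dl poly_op_rh
      have sc: "s y \<in> carrier G" for y using s by (simp add: states_def)
      have move: "inv h \<otimes> s x = g \<longleftrightarrow> s x = h \<otimes> g" if "h \<in> H" "g \<in> carrier G" for h g x
        using that sc[of x] by (metis H_carrier inv_solve_left)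
      have "poly_op G ((\<Sum>g\<in>carrier G. dl g x) - 1) \<psi> s = 0" for x
        using sc finite_carrier by (simp add: ops)
      moreover have "poly_op G (rh \<one> l - 1) \<psi> s = 0" for l
        using sc by (simp add: ops cong: if_cong)
      moreover have "poly_op G (dl g1 x * dl g2 x - (if g1 = g2 then dl g1 x else 0)) \<psi> s = 0"
        for g1 g2 x
        by (auto simp: ops)
      moreover have "poly_op G (rh h1 l * rh h2 l - rh (h1 \<otimes> h2) l) \<psi> s = 0"
        if "h1 \<in> H" "h2 \<in> H" for h1 h2 l
      proof -
        have "inv (h1 \<otimes> h2) \<otimes> s y = inv h2 \<otimes> (inv h1 \<otimes> s y)" for y
          using that sc by (simp add: group_word)
        then show ?thesis by (simp add: ops if_distrib cong: if_cong)
      qed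
      moreover have "poly_op G (dl g1 x * dl g2 x' - dl g2 x' * dl g1 x) \<psi> s = 0" for g1 g2 x x'
        by (auto simp: ops)
      moreover have "poly_op G (rh h l * dl g x - dl (h \<otimes> g) x * rh h l) \<psi> s = 0"
        if "h \<in> H" "g \<in> carrier G" "l < of_int x" for h g l x
        using that by (simp add: ops move)
      moreover have "poly_op G (rh h l * dl g x - dl g x * rh h l) \<psi> s = 0"
        if "of_int x < l" for h g l x
        using that by (simp add: ops)
      moreover have "poly_op G (rh h1 l * rh h2 l' - rh h2 l' * rh (inv h2 \<otimes> h1 \<otimes> h2) l) \<psi> s = 0"
        if "h1 \<in> H" "h2 \<in> H" "l' < l" for h1 h2 l l'
      proof -
        have "(\<lambda>y. if l' < of_int y then inv h2 \<otimes> (if l < of_int y then inv h1 \<otimes> s y else s y)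
            else if l < of_int y then inv h1 \<otimes> s y else s y) =
          (\<lambda>y. if l < of_int y then inv (inv h2 \<otimes> h1 \<otimes> h2) \<otimes> (if l' < of_int y then inv h2 \<otimes> s y else s y)
            else if l' < of_int y then inv h2 \<otimes> s y else s y)"
          using that sc by (auto simp: fun_eq_iff group_word)
        then show ?thesis by (simp add: ops)
      qed
      moreover have "poly_op G (rh h1 l * rh h2 l' - rh (h1 \<otimes> h2 \<otimes> inv h1) l' * rh h1 l) \<psi> s = 0"
        if "h1 \<in> H" "h2 \<in> H" "l < l'" for h1 h2 l l'
      proof -
        have "(\<lambda>y. if l' < of_int y then inv h2 \<otimes> (if l < of_int y then inv h1 \<otimes> s y else s y)
            else if l < of_int y then inv h1 \<otimes> s y else s y) =
          (\<lambda>y. if l < of_int y then inv h1 \<otimes> (if l' < of_int y then inv (h1 \<otimes> h2 \<otimes> inv h1) \<otimes> s y else s y)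
            else if l' < of_int y then inv (h1 \<otimes> h2 \<otimes> inv h1) \<otimes> s y else s y)"
          using that sc by (auto simp: fun_eq_iff group_word)
        then show ?thesis by (simp add: ops)
      qed
      ultimately show ?thesis
        using r unfolding field_relators_def by (elim UnE CollectE exE conjE) simp_all
    qed
    then show "r \<in> J" using r relators_subset by (auto simp: J_def)
  qed
  ultimately have "field_ideal G H \<subseteq> J" by (rule field_ideal_minimal)
  then show ?thesis using assms by (auto simp: J_def)
qed

text \<open>The operator by which \<open>observable_gen i q\<close> acts: right translation of a
  site for even \<open>i\<close>, projection onto a link value for odd \<open>i\<close>.\<close>

definition gen_op :: "int \<Rightarrow> 'g \<Rightarrow> ((int \<Rightarrow> 'g) \<Rightarrow> complex) \<Rightarrow> (int \<Rightarrow> 'g) \<Rightarrow> complex" where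
  "gen_op i q \<psi> s = (if even i then \<psi> (s(i div 2 := s (i div 2) \<otimes> q))
     else if s (i div 2 + 1) = s (i div 2) \<otimes> q then \<psi> s else 0)"

definition move :: "int \<Rightarrow> int \<Rightarrow> (int \<Rightarrow> 'g) \<Rightarrow> (int \<Rightarrow> 'g) \<Rightarrow> int \<Rightarrow> 'g" where
  "move n m b s x = (if n \<le> 2 * x \<and> 2 * x \<le> m then s x \<otimes> b (2 * x) else s x)"

text \<open>The condition that no projection in the ordered product vanishes at \<open>s\<close>.
  When slot \<open>2 * x + 1\<close> is tested, the factor of slot \<open>2 * x\<close> to its left
  has already translated the site \<open>x\<close>, provided that slot lies in the interval; the
  site \<open>x + 1\<close> is still in its original state.\<close>

definition admissible :: "int \<Rightarrow> int \<Rightarrow> (int \<Rightarrow> 'g) \<Rightarrow> (int \<Rightarrow> 'g) \<Rightarrow> bool" where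
  "admissible n m b s \<longleftrightarrow> (\<forall>x. n \<le> 2 * x + 1 \<and> 2 * x + 1 \<le> m \<longrightarrow>
     s (x + 1) = (if n \<le> 2 * x then s x \<otimes> b (2 * x) else s x) \<otimes> b (2 * x + 1))"

text \<open>An ordered product evaluates its argument at one translated configuration or gives 0.
  The leftmost factor changes \<open>s\<close> first, so \<open>s\<close> varies in the
  induction.\<close>

lemma product_gen_op:
  assumes "n \<le> m + 1"
  shows "foldr (\<lambda>i. gen_op i (b i)) [n..m] \<psi> s =
    (if admissible n m b s then \<psi> (move n m b s) else 0)"
  using assms
proof (induction n arbitrary: s rule: int_le_induct[where k = "m + 1", case_names base step])
  case base
  have "move (m + 1) m b s = s" by (auto simp: move_def fun_eq_iff)
  then show ?case by (auto simp: admissible_def)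
next
  case (step n)
  have "foldr (\<lambda>i. gen_op i (b i)) [n - 1..m] \<psi> s =
      gen_op (n - 1) (b (n - 1)) (foldr (\<lambda>i. gen_op i (b i)) [n..m] \<psi>) s"
    using step(1) by (simp add: upto_rec1)
  also have "\<dots> = (if admissible (n - 1) m b s then \<psi> (move (n - 1) m b s) else 0)"
  proof (cases "even (n - 1)")
    case True
    then obtain y where y: "n - 1 = 2 * y" by (rule evenE)
    then have n: "n = 2 * y + 1" by simp
    define s1 where "s1 = s(y := s y \<otimes> b (2 * y))"
    \<comment> \<open>The new factor translates the site \<open>y\<close>, which among the links
      tested only the one from \<open>y\<close> to \<open>y + 1\<close> sees; this is where the case
      distinction in \<open>admissible\<close> switches.\<close>
    have "admissible n m b s1 \<longleftrightarrow> admissible (n - 1) m b s"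
      unfolding admissible_def n
    proof (intro iff_allI)
      fix x
      show "(2 * y + 1 \<le> 2 * x + 1 \<and> 2 * x + 1 \<le> m \<longrightarrow>
          s1 (x + 1) = (if 2 * y + 1 \<le> 2 * x then s1 x \<otimes> b (2 * x) else s1 x) \<otimes> b (2 * x + 1)) \<longleftrightarrow>
        (2 * y + 1 - 1 \<le> 2 * x + 1 \<and> 2 * x + 1 \<le> m \<longrightarrow>
          s (x + 1) = (if 2 * y + 1 - 1 \<le> 2 * x then s x \<otimes> b (2 * x) else s x) \<otimes> b (2 * x + 1))"
        by (cases "x = y") (auto simp: s1_def)
    qed
    moreover have "move n m b s1 = move (n - 1) m b s"
      using step(1) unfolding move_def n s1_def by (intro ext) auto
    ultimately show ?thesis
      unfolding gen_op_def step.IH using y by (simp add: s1_def)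
  next
    case False
    then obtain y where y: "n - 1 = 2 * y + 1" by (rule oddE)
    then have n: "n = 2 * y + 2" by simp
    have "admissible (n - 1) m b s \<longleftrightarrow> s (y + 1) = s y \<otimes> b (2 * y + 1) \<and> admissible n m b s"
    proof
      assume *: "admissible (n - 1) m b s"
      have "s (y + 1) = s y \<otimes> b (2 * y + 1)"
        using *[unfolded admissible_def, rule_format, of y] step(1) by (simp add: n)
      moreover have "admissible n m b s"
        unfolding admissible_def
      proof (intro allI impI)
        fix x assume x: "n \<le> 2 * x + 1 \<and> 2 * x + 1 \<le> m"
        have "n - 1 \<le> 2 * x \<longleftrightarrow> n \<le> 2 * x" using n by presburger
        with x show "s (x + 1) = (if n \<le> 2 * x then s x \<otimes> b (2 * x) else s x) \<otimes> b (2 * x + 1)"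
          using *[unfolded admissible_def, rule_format, of x] by simp
      qed
      ultimately show "s (y + 1) = s y \<otimes> b (2 * y + 1) \<and> admissible n m b s" ..
    next
      assume *: "s (y + 1) = s y \<otimes> b (2 * y + 1) \<and> admissible n m b s"
      show "admissible (n - 1) m b s"
        unfolding admissible_def
      proof (intro allI impI)
        fix x assume x: "n - 1 \<le> 2 * x + 1 \<and> 2 * x + 1 \<le> m"
        show "s (x + 1) = (if n - 1 \<le> 2 * x then s x \<otimes> b (2 * x) else s x) \<otimes> b (2 * x + 1)"
        proof (cases "x = y")
          case True
          then show ?thesis using * n by simp
        next
          case False
          then have "n \<le> 2 * x" using x n by simp
          then show ?thesis
            using *[THEN conjunct2, unfolded admissible_def, rule_format, of x] x by simp
        qed
      qed
    qed
    moreover have "move n m b s = move (n - 1) m b s"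
    proof
      fix x
      have "n \<le> 2 * x \<longleftrightarrow> n - 1 \<le> 2 * x" using n by presburger
      then show "move n m b s x = move (n - 1) m b s x" by (simp add: move_def)
    qed
    moreover have "gen_op (2 * y + 1) q \<phi> s = (if s (y + 1) = s y \<otimes> q then \<phi> s else 0)" for q \<phi>
      by (simp add: gen_op_def)
    ultimately show ?thesis
      unfolding y step.IH by simp
  qed
  finally show ?case .
qed

lemma tensor_basis_carrier: "b \<in> tensor_basis G H n m \<Longrightarrow> i \<in> {n..m} \<Longrightarrow> b i \<in> carrier G"
  unfolding tensor_basis_def
  using PiE_mem[of b "{n..m}" "site_basis G H" i] site_basis_carrier by blast

text \<open>Let the value at \<open>x\<close> be the product of all labels up to slot
  \<open>2 * x - 1\<close>. Then each step from \<open>x\<close> to \<open>x + 1\<close> multiplies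
  by the labels of slots \<open>2 * x\<close> and \<open>2 * x + 1\<close>, which is
  admissibility.\<close>

lemma admissible_exists:
  assumes b: "b \<in> tensor_basis G H n m"
  shows "\<exists>s\<in>states. admissible n m b s"
proof -
  \<comment> \<open>Slots outside the interval get the unit, so that \<open>s\<close> has a value in
    the group at every site.\<close>
  define c where "c i = (if i \<in> {n..m} then b i else \<one>)" for i
  have c: "c i \<in> carrier G" for i
    using b tensor_basis_carrier by (auto simp: c_def)
  define s where "s x = foldl (\<lambda>z i. z \<otimes> c i) \<one> [n..2 * x - 1]" for x
  have s: "s x \<in> carrier G" for x
  proof -
    have "foldl (\<lambda>z i. z \<otimes> c i) z xs \<in> carrier G" if "z \<in> carrier G" for z xs
      using that by (induction xs arbitrary: z) (auto simp: c)
    then show ?thesis by (simp add: s_def)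
  qed
  have "s (x + 1) = (if n \<le> 2 * x then s x \<otimes> b (2 * x) else s x) \<otimes> b (2 * x + 1)"
    if x: "n \<le> 2 * x + 1" "2 * x + 1 \<le> m" for x
  proof (cases "n \<le> 2 * x")
    case True
    have "[n..2 * (x + 1) - 1] = [n..2 * x - 1] @ [2 * x, 2 * x + 1]"
      using True upto_rec2[of n "2 * x + 1"] upto_rec2[of n "2 * x"]
      by (simp add: algebra_simps)
    then show ?thesis using True x by (simp add: s_def c_def)
  next
    case False
    then have n: "n = 2 * x + 1" using x by simp
    have "2 * (x + 1) - 1 = 2 * x + 1" by simp
    then have "[n..2 * (x + 1) - 1] = [2 * x + 1]" "[n..2 * x - 1] = []"
      unfolding n by (simp_all only: upto_single) simp
    then show ?thesis using False x by (simp add: s_def c_def)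
  qed
  then show ?thesis using s by (intro bexI[of _ s]) (auto simp: admissible_def states_def)
qed

text \<open>Labels of even slots are read off from the translation, those of odd slots then from the
  link conditions, by cancellation in the group.\<close>

lemma admissible_determines:
  assumes "b \<in> tensor_basis G H n m" "b' \<in> tensor_basis G H n m" "s \<in> states"
    and "admissible n m b s" "admissible n m b' s" and move: "move n m b s = move n m b' s"
  shows "b = b'"
proof (rule PiE_ext[of b "{n..m}" "site_basis G H" b'])
  show "b \<in> PiE {n..m} (site_basis G H)" "b' \<in> PiE {n..m} (site_basis G H)"
    using assms by (auto simp: tensor_basis_def)
  fix i assume i: "i \<in> {n..m}"
  have carr: "b i \<in> carrier G" "b' i \<in> carrier G" if "i \<in> {n..m}" for i
    using assms(1,2) that tensor_basis_carrier by auto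
  have s: "s x \<in> carrier G" for x using assms(3) by (simp add: states_def)
  have even: "b (2 * x) = b' (2 * x)" if "n \<le> 2 * x" "2 * x \<le> m" for x
    using fun_cong[OF move, of x] that carr[of "2 * x"] s[of x] by (simp add: move_def)
  show "b i = b' i"
  proof (cases "even i")
    case True
    then show ?thesis using even i by (auto elim!: evenE)
  next
    case False
    then obtain x where x: "i = 2 * x + 1" by (auto elim: oddE)
    define z where "z = (if n \<le> 2 * x then s x \<otimes> b (2 * x) else s x)"
    have z: "z \<in> carrier G" using s[of x] carr[of "2 * x"] i x by (auto simp: z_def)
    have "z \<otimes> b i = z \<otimes> b' i"
      using assms(4,5)[unfolded admissible_def, rule_format, of x] i x even[of x]
      by (auto simp: z_def split: if_splits)
    then show ?thesis using z carr[OF i] by simp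
  qed
qed

end

section \<open>Operators attached to elements of the field algebra\<close>

context field_completion
begin

text \<open>A relation through a representing polynomial, so that no operator has to be assigned to
  elements of the completion. Uniqueness of the operator is used at 0, where it follows from the
  kernel of \<open>val\<close>.\<close>

definition represents :: "'f \<Rightarrow> (((int \<Rightarrow> 'g) \<Rightarrow> complex) \<Rightarrow> (int \<Rightarrow> 'g) \<Rightarrow> complex) \<Rightarrow> bool" where
  "represents F P \<longleftrightarrow> (\<exists>p\<in>field_free. val p = F \<and> (\<forall>\<psi>. \<forall>s\<in>states. poly_op G p \<psi> s = P \<psi> s))"

lemma represents_zero:
  assumes "represents 0 P" "s \<in> states"
  shows "P \<psi> s = 0"
proof -
  obtain p where p: "p \<in> field_free" "val p = 0" "\<forall>\<psi>. \<forall>s\<in>states. poly_op G p \<psi> s = P \<psi> s"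
    using assms(1) unfolding represents_def by blast
  then have "poly_op G p \<psi> s = 0"
    using field_ideal_poly_op[OF _ assms(2)] val_eq_zero_iff by blast
  then show ?thesis using p(3) assms(2) by simp
qed

lemma represents_cong:
  "represents F P \<Longrightarrow> (\<And>\<psi> s. s \<in> states \<Longrightarrow> P \<psi> s = Q \<psi> s) \<Longrightarrow> represents F Q"
  unfolding represents_def by force

lemma represents_one: "represents 1 (\<lambda>\<psi>. \<psi>)"
  unfolding represents_def by (intro bexI[of _ 1]) (auto simp: val_one poly_op_one field_free_one)

lemma represents_scale:
  assumes "represents F P"
  shows "represents (c *\<^sub>C F) (\<lambda>\<psi> s. c * P \<psi> s)"
proof -
  obtain p where "p \<in> field_free" "val p = F" "\<forall>\<psi>. \<forall>s\<in>states. poly_op G p \<psi> s = P \<psi> s"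
    using assms unfolding represents_def by blast
  then show ?thesis
    unfolding represents_def
    by (intro bexI[of _ "Poly_Mapping.single [] c * p"])
       (auto simp: val_scale poly_op_mult poly_op_single intro!: field_free_mult field_free_single)
qed

lemma represents_add:
  assumes "represents E P" "represents F Q"
  shows "represents (E + F) (\<lambda>\<psi> s. P \<psi> s + Q \<psi> s)"
proof -
  obtain p q where "p \<in> field_free" "val p = E" "\<forall>\<psi>. \<forall>s\<in>states. poly_op G p \<psi> s = P \<psi> s"
    "q \<in> field_free" "val q = F" "\<forall>\<psi>. \<forall>s\<in>states. poly_op G q \<psi> s = Q \<psi> s"
    using assms unfolding represents_def by blast
  then show ?thesis
    unfolding represents_def
    by (intro bexI[of _ "p + q"]) (auto simp: val_add poly_op_add intro: field_free_add)
qed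

lemma represents_mult:
  assumes "represents E P" "represents F Q"
  shows "represents (E * F) (\<lambda>\<psi>. P (Q \<psi>))"
proof -
  obtain p q where *: "p \<in> field_free" "val p = E" "\<forall>\<psi>. \<forall>s\<in>states. poly_op G p \<psi> s = P \<psi> s"
    "q \<in> field_free" "val q = F" "\<forall>\<psi>. \<forall>s\<in>states. poly_op G q \<psi> s = Q \<psi> s"
    using assms unfolding represents_def by blast
  have "poly_op G (p * q) \<psi> s = P (Q \<psi>) s" if "s \<in> states" for \<psi> s
    unfolding poly_op_mult using * that poly_op_cong[OF *(1) _ that, of "poly_op G q \<psi>" "Q \<psi>"] by simp
  with * show ?thesis
    unfolding represents_def by (intro bexI[of _ "p * q"]) (auto simp: val_mult intro: field_free_mult)
qed

lemma represents_sum: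
  assumes "\<And>i. i \<in> I \<Longrightarrow> represents (F i) (P i)"
  shows "represents (\<Sum>i\<in>I. F i) (\<lambda>\<psi> s. \<Sum>i\<in>I. P i \<psi> s)"
proof -
  have "represents 0 (\<lambda>\<psi> s. 0)"
    using represents_scale[OF represents_one, of 0] by simp
  then show ?thesis
    using assms by (induction I rule: infinite_finite_induct) (auto intro: represents_add)
qed

lemma represents_D: "g \<in> carrier G \<Longrightarrow> represents (D g x) (\<lambda>\<psi> s. if s x = g then \<psi> s else 0)"
  unfolding represents_def D_def by (intro bexI[of _ "dl g x"]) (auto simp: poly_op_dl intro: field_free_dl)

lemma represents_R:
  "h \<in> H \<Longrightarrow> represents (R h k) (\<lambda>\<psi> s. \<psi> (\<lambda>y. if k < y then inv h \<otimes> s y else s y))"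
  unfolding represents_def R_def
  by (intro bexI[of _ "rh h (of_int k + 1 / 2)"]) (auto simp: poly_op_rh half_odd_less_of_int intro: R_free)

lemma represents_T:
  assumes "t \<in> H"
  shows "represents (T t x) (\<lambda>\<psi> s. \<psi> (s(x := inv t \<otimes> s x)))"
proof -
  have t: "inv t \<in> H" using assms by simp
  show ?thesis
    unfolding T_def
  proof (rule represents_cong[OF represents_mult[OF represents_R[OF assms] represents_R[OF t]]])
    fix \<psi> :: "(int \<Rightarrow> 'g) \<Rightarrow> complex" and s assume "s \<in> states"
    then have "(\<lambda>y. if x < y then inv (inv t) \<otimes> (if x - 1 < y then inv t \<otimes> s y else s y)
        else if x - 1 < y then inv t \<otimes> s y else s y) = s(x := inv t \<otimes> s x)"
      using assms by (auto simp: fun_eq_iff states_def group_word)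
    then show "\<psi> (\<lambda>y. if x < y then inv (inv t) \<otimes> (if x - 1 < y then inv t \<otimes> s y else s y)
        else if x - 1 < y then inv t \<otimes> s y else s y) = \<psi> (s(x := inv t \<otimes> s x))"
      by simp
  qed
qed

text \<open>At a configuration \<open>s\<close> only the term with \<open>f = s x\<close> survives,
  and there the conjugated left translation becomes multiplication by \<open>h\<close> on the
  right.\<close>

lemma represents_V:
  assumes h: "h \<in> H"
  shows "represents (V h x) (\<lambda>\<psi> s. \<psi> (s(x := s x \<otimes> h)))"
proof -
  have "represents (V h x) (\<lambda>\<psi> s. \<Sum>f\<in>carrier G. if s x = f then
      \<psi> (s(x := inv (f \<otimes> inv h \<otimes> inv f) \<otimes> s x)) else 0)"
    unfolding V_def
    by (intro represents_sum represents_mult[OF represents_D represents_T] conj_inv_H h)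
  then show ?thesis
  proof (rule represents_cong)
    fix \<psi> :: "(int \<Rightarrow> 'g) \<Rightarrow> complex" and s assume "s \<in> states"
    then have s: "s x \<in> carrier G" by (simp add: states_def)
    then have "inv (s x \<otimes> inv h \<otimes> inv (s x)) \<otimes> s x = s x \<otimes> h"
      using h by (simp add: group_word)
    then show "(\<Sum>f\<in>carrier G. if s x = f then \<psi> (s(x := inv (f \<otimes> inv h \<otimes> inv f) \<otimes> s x)) else 0) =
        \<psi> (s(x := s x \<otimes> h))"
      using s finite_carrier by simp
  qed
qed

lemma represents_W:
  assumes g: "g \<in> carrier G"
  shows "represents (W g x) (\<lambda>\<psi> s. if s (x + 1) = s x \<otimes> g then \<psi> s else 0)"
proof -
  have "represents (W g x) (\<lambda>\<psi> s. \<Sum>f\<in>carrier G. if s x = f then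
      if s (x + 1) = f \<otimes> g then \<psi> s else 0 else 0)"
    unfolding W_def
    by (intro represents_sum represents_mult[OF represents_D represents_D] m_closed g)
  then show ?thesis
  proof (rule represents_cong)
    fix \<psi> :: "(int \<Rightarrow> 'g) \<Rightarrow> complex" and s assume "s \<in> states"
    then have s: "s x \<in> carrier G" by (simp add: states_def)
    then show "(\<Sum>f\<in>carrier G. if s x = f then if s (x + 1) = f \<otimes> g then \<psi> s else 0 else 0) =
        (if s (x + 1) = s x \<otimes> g then \<psi> s else 0)"
      using finite_carrier by simp
  qed
qed

lemma represents_observable_gen:
  "q \<in> site_basis G H i \<Longrightarrow> represents (observable_gen i q) (gen_op i q)"
  unfolding gen_op_def[abs_def]
  by (auto simp: observable_gen_def site_basis_def intro: represents_V represents_W split: if_splits)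

lemma represents_ordered_product:
  assumes "b \<in> tensor_basis G H n m"
  shows "represents (ordered_product observable_gen n m b) (foldr (\<lambda>i. gen_op i (b i)) [n..m])"
proof -
  have "represents (foldr (\<lambda>i z. observable_gen i (b i) * z) is 1) (foldr (\<lambda>i. gen_op i (b i)) is)"
    if "set is \<subseteq> {n..m}" for "is"
    using that
  proof (induction "is")
    case Nil
    then show ?case using represents_one by simp
  next
    case (Cons i "is")
    then have "b i \<in> site_basis G H i" using assms by (auto simp: tensor_basis_def)
    from represents_mult[OF represents_observable_gen[OF this] Cons.IH] Cons.prems
    show ?case by (simp add: o_def)
  qed
  then show ?thesis by (simp add: ordered_product_def)
qed

text \<open>A vanishing combination is applied to a point mass and evaluated at one configuration,
  chosen so that among all ordered products only the one with label \<open>b0\<close>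
  contributes.\<close>

theorem observable_gen_independent:
  assumes "n \<le> m + 1"
  shows "complex_independent (tensor_basis G H n m) (ordered_product observable_gen n m)"
  unfolding complex_independent_def
proof (intro allI impI ballI)
  fix c b0
  assume zero: "(\<Sum>b\<in>tensor_basis G H n m. c b *\<^sub>C ordered_product observable_gen n m b) = 0"
    and b0: "b0 \<in> tensor_basis G H n m"
  define P where "P b = foldr (\<lambda>i. gen_op i (b i)) [n..m]" for b
  have rep: "represents 0 (\<lambda>\<psi> s. \<Sum>b\<in>tensor_basis G H n m. c b * P b \<psi> s)"
    unfolding zero[symmetric] P_def
    by (intro represents_sum represents_scale represents_ordered_product)
  obtain s where s: "s \<in> states" "admissible n m b0 s"
    using admissible_exists[OF b0] by blast
  \<comment> \<open>The point mass sits where the product with label \<open>b0\<close> sends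
    \<open>s\<close>; by \<open>admissible_determines\<close> another label admissible at
    \<open>s\<close> with the same image would equal \<open>b0\<close>.\<close>
  define \<psi> :: "(int \<Rightarrow> 'g) \<Rightarrow> complex" where "\<psi> s' = of_bool (s' = move n m b0 s)" for s'
  have "P b \<psi> s = (if b = b0 then 1 else 0)" if b: "b \<in> tensor_basis G H n m" for b
    unfolding P_def product_gen_op[OF assms]
    using s b b0 admissible_determines[OF b b0 s(1) _ s(2)] by (auto simp: \<psi>_def)
  then have "(\<Sum>b\<in>tensor_basis G H n m. c b * P b \<psi> s) =
      (\<Sum>b\<in>tensor_basis G H n m. if b = b0 then c b else 0)"
    by (intro sum.cong) auto
  also have "\<dots> = c b0" using b0 finite_tensor_basis by simp
  finally show "c b0 = 0" using represents_zero[OF rep s(1)] by simp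
qed

end


section \<open>The infinite twisted tensor product\<close>

locale twisted_limit = finite_normal H G
  for H :: "'g set" and G :: "('g, 'z) monoid_scheme" (structure) +
  fixes A :: "int \<times> int \<Rightarrow> ((int \<Rightarrow> 'g) \<Rightarrow> complex) star_alg"
    and \<kappa> :: "int \<times> int \<Rightarrow> ((int \<Rightarrow> 'g) \<Rightarrow> complex) \<Rightarrow> 'a::cstar_algebra"
  assumes limit: "infinite_twisted_tensor_product G H A \<kappa>"
begin

lemma ttp: "n < m \<Longrightarrow> twisted_tensor_product G H n m (A (n, m))"
  using limit unfolding infinite_twisted_tensor_product_def by blast

lemma
  assumes "n < m"
  shows star_algebra_A: "star_algebra (A (n, m))"
    and carrier_A: "carrier (A (n, m)) = {u. \<forall>b. b \<notin> tensor_basis G H n m \<longrightarrow> u b = 0}"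
    and add_A: "u \<oplus>\<^bsub>A (n, m)\<^esub> v = (\<lambda>b. u b + v b)"
    and smult_A: "c \<odot>\<^bsub>A (n, m)\<^esub> u = (\<lambda>b. c * u b)"
    and slot_hom: "i \<in> {n..m} \<Longrightarrow> star_alg_hom (site_alg G H i) (A (n, m)) (slot G H n m i)"
    and pure_tensor_foldr: "\<forall>i\<in>{n..m}. x i \<in> carrier (site_alg G H i) \<Longrightarrow>
        pure_tensor G H n m x = foldr (\<lambda>i u. slot G H n m i (x i) \<otimes>\<^bsub>A (n, m)\<^esub> u) [n..m] \<one>\<^bsub>A (n, m)\<^esub>"
    and slot_exchange: "i \<in> {n..m} \<Longrightarrow> j \<in> {n..m} \<Longrightarrow> i < j \<Longrightarrow>
        p \<in> site_basis G H j \<Longrightarrow> q \<in> site_basis G H i \<Longrightarrow>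
        slot G H n m j (site_vec p) \<otimes>\<^bsub>A (n, m)\<^esub> slot G H n m i (site_vec q) =
          (let (r, s) = twist G i j p q
           in slot G H n m i (site_vec r) \<otimes>\<^bsub>A (n, m)\<^esub> slot G H n m j (site_vec s))"
  using ttp[OF assms] by (simp_all only: twisted_tensor_product_def)

lemma ind_limit: "cstar_inductive_limit {(n, m). n < m} (\<lambda>(n', m') (n, m). n \<le> n' \<and> m' \<le> m)
       A (insert_units G H) \<kappa>"
  using limit unfolding infinite_twisted_tensor_product_def by blast

lemma
  assumes "n < m"
  shows kappa_rep: "cstar_rep (A (n, m)) (\<kappa> (n, m))"
    and kappa_inj: "inj_on (\<kappa> (n, m)) (carrier (A (n, m)))"
  using ind_limit assms unfolding cstar_inductive_limit_def by auto

lemma kappa_compat: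
  assumes "n' < m'" "n < m" "n \<le> n'" "m' \<le> m" "x \<in> carrier (A (n', m'))"
  shows "\<kappa> (n, m) (insert_units G H (n', m') (n, m) x) = \<kappa> (n', m') x"
  using ind_limit assms unfolding cstar_inductive_limit_def by auto

lemma kappa_dense: "closure (\<Union>(n, m)\<in>{(n, m). n < m}. \<kappa> (n, m) ` carrier (A (n, m))) = UNIV"
  using ind_limit unfolding cstar_inductive_limit_def by (simp add: case_prod_unfold)

lemma
  assumes "n < m" "x \<in> carrier (A (n, m))"
  shows kappa_add: "y \<in> carrier (A (n, m)) \<Longrightarrow> \<kappa> (n, m) (\<lambda>b. x b + y b) = \<kappa> (n, m) x + \<kappa> (n, m) y"
    and kappa_mult: "y \<in> carrier (A (n, m)) \<Longrightarrow>
      \<kappa> (n, m) (x \<otimes>\<^bsub>A (n, m)\<^esub> y) = \<kappa> (n, m) x * \<kappa> (n, m) y"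
    and kappa_scale: "\<kappa> (n, m) (\<lambda>b. c * x b) = c *\<^sub>C \<kappa> (n, m) x"
    and kappa_adj: "\<kappa> (n, m) (adj (A (n, m)) x) = star (\<kappa> (n, m) x)"
  using kappa_rep[OF assms(1)] assms
  by (auto simp: cstar_rep_def simp flip: add_A[OF assms(1)] smult_A[OF assms(1)])

lemma kappa_one: "n < m \<Longrightarrow> \<kappa> (n, m) \<one>\<^bsub>A (n, m)\<^esub> = 1"
  using kappa_rep by (simp add: cstar_rep_def)

lemma slot_insert_units:
  assumes "n \<le> n'" "m' \<le> m" "i \<in> {n'..m'}"
  shows "insert_units G H (n', m') (n, m) (slot G H n' m' i x) = slot G H n m i x"
proof
  fix b
  show "insert_units G H (n', m') (n, m) (slot G H n' m' i x) b = slot G H n m i x b"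
  proof (cases "b \<in> tensor_basis G H n m")
    case True
    then have r: "restrict b {n'..m'} \<in> tensor_basis G H n' m'"
      using assms by (auto simp: tensor_basis_def)
    let ?f = "\<lambda>k. ((\<lambda>k. one (site_alg G H k))(i := x)) k (b k)"
    have "(\<Prod>k\<in>{n'..m'}. ((\<lambda>k. one (site_alg G H k))(i := x)) k (restrict b {n'..m'} k)) = prod ?f {n'..m'}"
      by (intro prod.cong) auto
    moreover have "(\<Prod>k\<in>{n..m} - {n'..m'}. one (site_alg G H k) (b k)) = prod ?f ({n..m} - {n'..m'})"
      using assms by (intro prod.cong) auto
    moreover have "prod ?f {n..m} = prod ?f ({n..m} - {n'..m'}) * prod ?f {n'..m'}"
      using assms by (intro prod.subset_diff) auto
    ultimately show ?thesis
      using True r by (simp add: insert_units_def slot_def pure_tensor_def)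
  next
    case False
    then show ?thesis by (simp add: insert_units_def slot_def pure_tensor_def)
  qed
qed

text \<open>The interval from \<open>i - 1\<close> to \<open>i + 1\<close> is an arbitrary
  nondegenerate interval around \<open>i\<close>; \<open>emb_eq\<close> removes the dependence on
  this choice.\<close>

definition emb :: "int \<Rightarrow> ('g \<Rightarrow> complex) \<Rightarrow> 'a" where
  "emb i x = \<kappa> (i - 1, i + 1) (slot G H (i - 1) (i + 1) i x)"

lemma slot_carrier:
  "n < m \<Longrightarrow> i \<in> {n..m} \<Longrightarrow> x \<in> carrier (site_alg G H i) \<Longrightarrow> slot G H n m i x \<in> carrier (A (n, m))"
  using slot_hom unfolding star_alg_hom_def by (blast dest: ring_hom_closed)

text \<open>Both intervals lie in a common hull, and inserting units carries slot vectors to slot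
  vectors.\<close>

lemma emb_eq:
  assumes "n < m" "i \<in> {n..m}" "x \<in> carrier (site_alg G H i)"
  shows "\<kappa> (n, m) (slot G H n m i x) = emb i x"
proof -
  let ?n = "min n (i - 1)" and ?m = "max m (i + 1)"
  have "\<kappa> (?n, ?m) (slot G H ?n ?m i x) = \<kappa> (n, m) (slot G H n m i x)"
    using kappa_compat[of n m ?n ?m "slot G H n m i x"] slot_insert_units[of ?n n m ?m i x]
      slot_carrier[OF assms] assms by simp
  moreover have "\<kappa> (?n, ?m) (slot G H ?n ?m i x) = emb i x"
    using kappa_compat[of "i - 1" "i + 1" ?n ?m "slot G H (i - 1) (i + 1) i x"]
      slot_insert_units[of ?n "i - 1" "i + 1" ?m i x] slot_carrier[of "i - 1" "i + 1" i x] assms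
    by (simp add: emb_def)
  ultimately show ?thesis by simp
qed

lemma site_alg_simps:
  "carrier (site_alg G H i) = {x. \<forall>k. k \<notin> site_basis G H i \<longrightarrow> x k = 0}"
  "x \<oplus>\<^bsub>site_alg G H i\<^esub> y = (\<lambda>k. x k + y k)"
  by (simp_all add: site_alg_def)

lemma emb_add:
  assumes "x \<in> carrier (site_alg G H i)" "y \<in> carrier (site_alg G H i)"
  shows "emb i (\<lambda>k. x k + y k) = emb i x + emb i y"
proof -
  have nm: "i - 1 < i + 1" "i \<in> {i - 1..i + 1}" by auto
  have "slot G H (i - 1) (i + 1) i (\<lambda>k. x k + y k) =
      (\<lambda>b. slot G H (i - 1) (i + 1) i x b + slot G H (i - 1) (i + 1) i y b)"
    using slot_hom[OF nm] assms ring_hom_add[of "slot G H (i - 1) (i + 1) i" "site_alg G H i" "A (i - 1, i + 1)" x y]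
    by (simp add: star_alg_hom_def site_alg_simps(2) add_A[OF nm(1)])
  then show ?thesis
    unfolding emb_def by (simp only: kappa_add[OF nm(1) slot_carrier[OF nm assms(1)] slot_carrier[OF nm assms(2)]])
qed

lemma emb_mult:
  assumes "x \<in> carrier (site_alg G H i)" "y \<in> carrier (site_alg G H i)"
  shows "emb i (x \<otimes>\<^bsub>site_alg G H i\<^esub> y) = emb i x * emb i y"
proof -
  have nm: "i - 1 < i + 1" "i \<in> {i - 1..i + 1}" by auto
  have "slot G H (i - 1) (i + 1) i (x \<otimes>\<^bsub>site_alg G H i\<^esub> y) =
      slot G H (i - 1) (i + 1) i x \<otimes>\<^bsub>A (i - 1, i + 1)\<^esub> slot G H (i - 1) (i + 1) i y"
    using slot_hom[OF nm] assms by (simp add: star_alg_hom_def ring_hom_mult)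
  then show ?thesis
    unfolding emb_def by (simp only: kappa_mult[OF nm(1) slot_carrier[OF nm assms(1)] slot_carrier[OF nm assms(2)]])
qed

lemma emb_one: "emb i \<one>\<^bsub>site_alg G H i\<^esub> = 1"
proof -
  have nm: "i - 1 < i + 1" "i \<in> {i - 1..i + 1}" by auto
  have "slot G H (i - 1) (i + 1) i \<one>\<^bsub>site_alg G H i\<^esub> = \<one>\<^bsub>A (i - 1, i + 1)\<^esub>"
    using slot_hom[OF nm] by (simp add: star_alg_hom_def ring_hom_one)
  then show ?thesis unfolding emb_def by (simp only: kappa_one[OF nm(1)])
qed

lemma emb_adj:
  assumes "x \<in> carrier (site_alg G H i)"
  shows "emb i (adj (site_alg G H i) x) = star (emb i x)"
proof -
  have nm: "i - 1 < i + 1" "i \<in> {i - 1..i + 1}" by auto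
  have "slot G H (i - 1) (i + 1) i (adj (site_alg G H i) x) =
      adj (A (i - 1, i + 1)) (slot G H (i - 1) (i + 1) i x)"
    using slot_hom[OF nm] assms by (simp add: star_alg_hom_def)
  then show ?thesis
    unfolding emb_def by (simp only: kappa_adj[OF nm(1) slot_carrier[OF nm assms]])
qed

definition tensor_gen :: "int \<Rightarrow> 'g \<Rightarrow> 'a" where
  "tensor_gen i q = emb i (site_vec q)"

lemma site_vec_carrier: "q \<in> site_basis G H i \<Longrightarrow> site_vec q \<in> carrier (site_alg G H i)"
  by (auto simp: site_alg_simps site_vec_def)

lemma site_vec_mult:
  assumes "p \<in> site_basis G H i" "q \<in> site_basis G H i"
  shows "site_vec p \<otimes>\<^bsub>site_alg G H i\<^esub> site_vec q =
    (if even i then site_vec (p \<otimes> q) else if p = q then site_vec p else (\<lambda>k. 0))"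
proof (cases "even i")
  case True
  then have pq: "p \<in> H" "q \<in> H" using assms by (auto simp: site_basis_def)
  have "(\<Sum>(h1, h2)\<in>{(h1, h2) \<in> H \<times> H. h1 \<otimes> h2 = k}. site_vec p h1 * site_vec q h2) =
      site_vec (p \<otimes> q) k" for k
  proof -
    have fin: "finite {(h1, h2) \<in> H \<times> H. h1 \<otimes> h2 = k}"
      by (rule finite_subset[of _ "H \<times> H"]) (auto simp: finite_H)
    have "(\<Sum>(h1, h2)\<in>{(h1, h2) \<in> H \<times> H. h1 \<otimes> h2 = k}. site_vec p h1 * site_vec q h2) =
        (\<Sum>r\<in>{(h1, h2) \<in> H \<times> H. h1 \<otimes> h2 = k}. if r = (p, q) then 1 else 0)"
      by (intro sum.cong) (auto simp: site_vec_def split: if_splits)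
    also have "\<dots> = (if (p, q) \<in> {(h1, h2) \<in> H \<times> H. h1 \<otimes> h2 = k} then 1 else 0)"
      by (rule sum.delta[OF fin])
    also have "\<dots> = site_vec (p \<otimes> q) k" using pq by (auto simp: site_vec_def)
    finally show ?thesis .
  qed
  then show ?thesis using True by (simp add: site_alg_def)
next
  case False
  then show ?thesis by (auto simp: site_alg_def site_vec_def fun_eq_iff)
qed

lemma emb_zero: "emb i (\<lambda>k. 0) = 0"
  using emb_add[of "\<lambda>k. 0" i "\<lambda>k. 0"] by (simp add: site_alg_simps)

text \<open>Relations at one site are transported along the slot homomorphism. For two sites both
  factors are computed in the algebra over the interval from \<open>i\<close> to \<open>j\<close>,
  where the exchange relation is given.\<close>

theorem twisted_family_tensor_gen: "twisted_family G H tensor_gen"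
  unfolding twisted_family_def
proof (intro conjI allI ballI impI)
  fix i j :: int and p q
  show "tensor_gen i \<one> = 1" if "even i"
  proof -
    have "\<one>\<^bsub>site_alg G H i\<^esub> = site_vec \<one>" using that by (simp add: site_alg_def site_vec_def)
    then show ?thesis using emb_one[of i] by (simp add: tensor_gen_def)
  qed
  show "(\<Sum>g\<in>carrier G. tensor_gen i g) = 1" if "odd i"
  proof -
    have "emb i (\<lambda>k. if k \<in> S then 1 else 0) = (\<Sum>g\<in>S. tensor_gen i g)" if "S \<subseteq> carrier G" for S
      using finite_subset[OF that finite_carrier] that
    proof (induction S rule: finite_induct)
      case empty
      then show ?case by (simp add: emb_zero)
    next
      case (insert g S)
      have "(\<lambda>k. if k \<in> insert g S then 1 else 0) = (\<lambda>k. site_vec g k + (if k \<in> S then 1 else 0 :: complex))"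
        using insert(2) by (auto simp: site_vec_def fun_eq_iff)
      moreover have "site_vec g \<in> carrier (site_alg G H i)"
          "(\<lambda>k. if k \<in> S then 1 else 0) \<in> carrier (site_alg G H i)"
        using insert \<open>odd i\<close> by (auto simp: site_alg_simps(1) site_basis_def site_vec_def)
      ultimately have "emb i (\<lambda>k. if k \<in> insert g S then 1 else 0) =
          emb i (site_vec g) + emb i (\<lambda>k. if k \<in> S then 1 else 0)"
        using emb_add[of "site_vec g" i "\<lambda>k. if k \<in> S then 1 else 0"]
        by (simp only:)
      then show ?case using insert by (simp add: tensor_gen_def)
    qed
    moreover have "\<one>\<^bsub>site_alg G H i\<^esub> = (\<lambda>k. if k \<in> carrier G then 1 else 0)"
      using that by (simp add: site_alg_def)
    ultimately show ?thesis using emb_one[of i] by simp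
  qed
  show "tensor_gen i p * tensor_gen i q =
      (if even i then tensor_gen i (p \<otimes> q) else if p = q then tensor_gen i p else 0)"
    if "p \<in> site_basis G H i" "q \<in> site_basis G H i"
    unfolding tensor_gen_def
    using emb_mult[OF site_vec_carrier[OF that(1)] site_vec_carrier[OF that(2)]] site_vec_mult[OF that]
    by (auto simp: emb_zero)
  show "star (tensor_gen i p) = (if even i then tensor_gen i (inv p) else tensor_gen i p)"
    if p: "p \<in> site_basis G H i"
  proof -
    have "adj (site_alg G H i) (site_vec p) = (if even i then site_vec (inv p) else site_vec p)"
    proof (cases "even i")
      case True
      then have pH: "p \<in> H" using p by (simp add: site_basis_def)
      have "inv k = p \<longleftrightarrow> k = inv p" if "k \<in> H" for k
        using that pH by (auto simp: H_carrier)
      then show ?thesis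
        using True pH by (auto simp: site_alg_def site_vec_def fun_eq_iff)
    qed (auto simp: site_alg_def site_vec_def fun_eq_iff)
    then show ?thesis
      using emb_adj[OF site_vec_carrier[OF p]] by (simp add: tensor_gen_def split: if_splits)
  qed
  assume ij: "i < j" and p: "p \<in> site_basis G H j" and q: "q \<in> site_basis G H i"
  obtain r s where rs: "twist G i j p q = (r, s)" by fastforce
  have r: "r \<in> site_basis G H i" and s: "s \<in> site_basis G H j"
    using twist_closed[OF p q] rs by auto
  have mem: "i \<in> {i..j}" "j \<in> {i..j}" using ij by auto
  note carr = slot_carrier[OF ij mem(1) site_vec_carrier] slot_carrier[OF ij mem(2) site_vec_carrier]
  note eq = emb_eq[OF ij mem(1) site_vec_carrier] emb_eq[OF ij mem(2) site_vec_carrier]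
  have "slot G H i j j (site_vec p) \<otimes>\<^bsub>A (i, j)\<^esub> slot G H i j i (site_vec q) =
      slot G H i j i (site_vec r) \<otimes>\<^bsub>A (i, j)\<^esub> slot G H i j j (site_vec s)"
    using slot_exchange[OF ij mem ij p q] rs by simp
  then have "\<kappa> (i, j) (slot G H i j j (site_vec p) \<otimes>\<^bsub>A (i, j)\<^esub> slot G H i j i (site_vec q)) =
      \<kappa> (i, j) (slot G H i j i (site_vec r) \<otimes>\<^bsub>A (i, j)\<^esub> slot G H i j j (site_vec s))"
    by simp
  then show "tensor_gen j p * tensor_gen i q =
      tensor_gen i (fst (twist G i j p q)) * tensor_gen j (snd (twist G i j p q))"
    using p q r s by (simp add: rs tensor_gen_def kappa_mult[OF ij] carr eq)
qed

lemma pure_tensor_site_vec: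
  assumes b: "b \<in> tensor_basis G H n m"
  shows "pure_tensor G H n m (\<lambda>i. site_vec (b i)) = (\<lambda>b'. if b' = b then 1 else 0)"
proof
  fix b'
  show "pure_tensor G H n m (\<lambda>i. site_vec (b i)) b' = (if b' = b then 1 else 0)"
  proof (cases "b' \<in> tensor_basis G H n m \<and> b' \<noteq> b")
    case True
    then obtain i where "i \<in> {n..m}" "b' i \<noteq> b i"
      using b PiE_ext[of b' "{n..m}" "site_basis G H" b] by (auto simp: tensor_basis_def)
    then have "(\<Prod>i\<in>{n..m}. site_vec (b i) (b' i)) = 0"
      by (intro prod_zero) (auto simp: site_vec_def)
    then show ?thesis using True by (simp add: pure_tensor_def)
  next
    case False
    then consider "b' = b" | "b' \<noteq> b" "b' \<notin> tensor_basis G H n m" by blast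
    then show ?thesis
    proof cases
      case 1
      then show ?thesis using b by (simp add: pure_tensor_def site_vec_def)
    next
      case 2
      then show ?thesis by (simp add: pure_tensor_def)
    qed
  qed
qed

text \<open>A basis vector of the tensor space is a pure tensor of basis vectors, which the
  factorisation axiom writes as an ordered product of slot vectors; \<kappa> is
  multiplicative.\<close>

lemma kappa_basis:
  assumes nm: "n < m" and b: "b \<in> tensor_basis G H n m"
  shows "\<kappa> (n, m) (\<lambda>b'. if b' = b then 1 else 0) = ordered_product tensor_gen n m b"
proof -
  interpret A: star_algebra "A (n, m)" by (rule star_algebra_A[OF nm])
  have bi: "site_vec (b i) \<in> carrier (site_alg G H i)" if "i \<in> {n..m}" for i
    using b that by (intro site_vec_carrier) (auto simp: tensor_basis_def)
  let ?F = "foldr (\<lambda>i u. slot G H n m i (site_vec (b i)) \<otimes>\<^bsub>A (n, m)\<^esub> u)"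
  have "?F is \<one>\<^bsub>A (n, m)\<^esub> \<in> carrier (A (n, m)) \<and>
      \<kappa> (n, m) (?F is \<one>\<^bsub>A (n, m)\<^esub>) = foldr (\<lambda>i z. tensor_gen i (b i) * z) is 1"
    if "set is \<subseteq> {n..m}" for "is"
    using that
  proof (induction "is")
    case Nil
    then show ?case using kappa_one[OF nm] by simp
  next
    case (Cons i "is")
    then have i: "i \<in> {n..m}" and IH: "?F is \<one>\<^bsub>A (n, m)\<^esub> \<in> carrier (A (n, m))"
      "\<kappa> (n, m) (?F is \<one>\<^bsub>A (n, m)\<^esub>) = foldr (\<lambda>i z. tensor_gen i (b i) * z) is 1"
      by auto
    show ?case
      using kappa_mult[OF nm slot_carrier[OF nm i bi[OF i]] IH(1)] emb_eq[OF nm i bi[OF i]]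
        slot_carrier[OF nm i bi[OF i]] IH
      by (simp add: tensor_gen_def)
  qed
  from this[of "[n..m]"] show ?thesis
    using pure_tensor_foldr[OF nm, of "\<lambda>i. site_vec (b i)"] bi pure_tensor_site_vec[OF b]
    by (simp add: ordered_product_def)
qed

lemma kappa_expand:
  assumes nm: "n < m" and w: "w \<in> carrier (A (n, m))"
  shows "\<kappa> (n, m) w = (\<Sum>b\<in>tensor_basis G H n m. w b *\<^sub>C ordered_product tensor_gen n m b)"
proof -
  have ind: "(\<lambda>b'. if b' = b then 1 else 0) \<in> carrier (A (n, m))" if "b \<in> tensor_basis G H n m" for b
    using that by (auto simp: carrier_A[OF nm])
  have "\<kappa> (n, m) (\<lambda>b. if b \<in> B then w b else 0) = (\<Sum>b\<in>B. w b *\<^sub>C ordered_product tensor_gen n m b)"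
    if "B \<subseteq> tensor_basis G H n m" for B
    using finite_subset[OF that finite_tensor_basis] that
  proof (induction B rule: finite_induct)
    case empty
    have "\<kappa> (n, m) (\<lambda>b. 0) = 0"
      using kappa_scale[OF nm w, of 0] by simp
    then show ?case by simp
  next
    case (insert b B)
    have b: "b \<in> tensor_basis G H n m" using insert by simp
    have c1: "(\<lambda>b'. w b * (if b' = b then 1 else 0)) \<in> carrier (A (n, m))"
      using b by (auto simp: carrier_A[OF nm])
    have c2: "(\<lambda>b. if b \<in> B then w b else 0) \<in> carrier (A (n, m))"
      using insert by (auto simp: carrier_A[OF nm])
    have "(\<lambda>b'. if b' \<in> insert b B then w b' else 0) =
        (\<lambda>b'. w b * (if b' = b then 1 else 0) + (if b' \<in> B then w b' else 0))"
      using insert(2) by (intro ext) auto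
    then have "\<kappa> (n, m) (\<lambda>b'. if b' \<in> insert b B then w b' else 0) =
        \<kappa> (n, m) (\<lambda>b'. w b * (if b' = b then 1 else 0)) + \<kappa> (n, m) (\<lambda>b. if b \<in> B then w b else 0)"
      by (simp only: kappa_add[OF nm c1 c2])
    also have "\<kappa> (n, m) (\<lambda>b'. w b * (if b' = b then 1 else 0)) = w b *\<^sub>C ordered_product tensor_gen n m b"
      unfolding kappa_scale[OF nm ind[OF b]] kappa_basis[OF nm b] ..
    finally show ?case using insert by simp
  qed
  then have "\<kappa> (n, m) (\<lambda>b. if b \<in> tensor_basis G H n m then w b else 0) =
      (\<Sum>b\<in>tensor_basis G H n m. w b *\<^sub>C ordered_product tensor_gen n m b)"
    by blast
  also have "(\<lambda>b. if b \<in> tensor_basis G H n m then w b else 0) = w"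
    using w by (intro ext) (auto simp: carrier_A[OF nm])
  finally show ?thesis .
qed

lemma kappa_range:
  assumes nm: "n < m"
  shows "\<kappa> (n, m) ` carrier (A (n, m)) =
    range (\<lambda>c. \<Sum>b\<in>tensor_basis G H n m. c b *\<^sub>C ordered_product tensor_gen n m b)"
proof
  show "\<kappa> (n, m) ` carrier (A (n, m)) \<subseteq>
      range (\<lambda>c. \<Sum>b\<in>tensor_basis G H n m. c b *\<^sub>C ordered_product tensor_gen n m b)"
    using kappa_expand[OF nm] by auto
  show "range (\<lambda>c. \<Sum>b\<in>tensor_basis G H n m. c b *\<^sub>C ordered_product tensor_gen n m b)
      \<subseteq> \<kappa> (n, m) ` carrier (A (n, m))"
  proof (clarify)
    fix c :: "(int \<Rightarrow> 'g) \<Rightarrow> complex"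
    define w where "w b = (if b \<in> tensor_basis G H n m then c b else 0)" for b
    have w: "w \<in> carrier (A (n, m))" by (simp add: carrier_A[OF nm] w_def)
    have "(\<Sum>b\<in>tensor_basis G H n m. c b *\<^sub>C ordered_product tensor_gen n m b) = \<kappa> (n, m) w"
      unfolding kappa_expand[OF nm w] by (intro sum.cong) (auto simp: w_def)
    with w show "(\<Sum>b\<in>tensor_basis G H n m. c b *\<^sub>C ordered_product tensor_gen n m b)
        \<in> \<kappa> (n, m) ` carrier (A (n, m))" by blast
  qed
qed

text \<open>The coefficients are the coordinates of a tensor, and \<kappa> is injective on
  tensors.\<close>

lemma tensor_gen_independent:
  assumes nm: "n < m"
  shows "complex_independent (tensor_basis G H n m) (ordered_product tensor_gen n m)"
  unfolding complex_independent_def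
proof (intro allI impI)
  fix c :: "(int \<Rightarrow> 'g) \<Rightarrow> complex"
  assume zero: "(\<Sum>b\<in>tensor_basis G H n m. c b *\<^sub>C ordered_product tensor_gen n m b) = 0"
  define w where "w b = (if b \<in> tensor_basis G H n m then c b else 0)" for b
  have w: "w \<in> carrier (A (n, m))" "(\<lambda>b. 0) \<in> carrier (A (n, m))"
    by (simp_all add: carrier_A[OF nm] w_def)
  have "\<kappa> (n, m) w = (\<Sum>b\<in>tensor_basis G H n m. c b *\<^sub>C ordered_product tensor_gen n m b)"
    unfolding kappa_expand[OF nm w(1)] by (intro sum.cong) (auto simp: w_def)
  also have "\<dots> = \<kappa> (n, m) (\<lambda>b. 0)"
    using zero kappa_expand[OF nm w(2)] by simp
  finally have "w = (\<lambda>b. 0)"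
    using kappa_inj[OF nm] w by (auto dest: inj_onD)
  then show "\<forall>b\<in>tensor_basis G H n m. c b = 0"
    by (metis w_def)
qed

end

section \<open>Assembly of the isomorphism and identification of its image\<close>

theorem theorem3p1:
  fixes G :: "('g, 'z) monoid_scheme" and H :: "'g set"
    and A :: "int \<times> int \<Rightarrow> ((int \<Rightarrow> 'g) \<Rightarrow> complex) star_alg"
    and \<kappa> :: "int \<times> int \<Rightarrow> ((int \<Rightarrow> 'g) \<Rightarrow> complex) \<Rightarrow> 'a::cstar_algebra"
    and j :: "'g field_poly set \<Rightarrow> 'f::cstar_algebra"
    and act :: "('g \<times> 'g \<Rightarrow> complex) \<Rightarrow> 'f \<Rightarrow> 'f"
  assumes "group G" and "finite (carrier G)" and "H \<lhd> G"
    and "infinite_twisted_tensor_product G H A \<kappa>"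
    and "cstar_completion (field_loc G H) j"
    and "field_action G H j act"
  shows "\<exists>\<Phi> :: 'a \<Rightarrow> 'f. cstar_isomorphism \<Phi> UNIV (observable_algebra G H act)"
proof -
  have fn: "finite_normal H G"
    using assms by (simp add: finite_normal_def finite_normal_axioms_def)
  interpret F: field_with_action H G j act
    using fn assms by (simp add: field_with_action_def field_completion_def
      field_completion_axioms_def field_with_action_axioms_def)
  interpret L: twisted_limit H G A \<kappa>
    using fn assms by (simp add: twisted_limit_def twisted_limit_axioms_def)
  interpret P: twisted_pair H G L.tensor_gen F.observable_gen
    using fn L.twisted_family_tensor_gen F.twisted_family_observable_gen
    by (simp add: twisted_pair_def twisted_pair_axioms_def)
  define B where "B = snd ` P.all_pairs"
  have eq: "fst ` P.product_pairs n m = \<kappa> (n, m) ` carrier (A (n, m))" if "n < m" for n m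
    unfolding L.kappa_range[OF that] P.product_pairs_def by (simp add: image_image)
  \<comment> \<open>The left components are exactly the images of the algebras over all intervals,
    so their density is that of the inductive limit.\<close>
  have "fst ` P.all_pairs = (\<Union>(n, m)\<in>{(n, m). n < m}. \<kappa> (n, m) ` carrier (A (n, m)))"
    unfolding P.all_pairs_def image_UN by (rule SUP_cong) (clarsimp simp: eq)+
  then have "\<exists>\<Phi> :: 'a \<Rightarrow> 'f. cstar_isomorphism \<Phi> UNIV (closure B)"
    unfolding B_def using L.kappa_dense
    by (intro P.isomorphism_of_independent_families L.tensor_gen_independent F.observable_gen_independent) auto
  moreover have "closure B = observable_algebra G H act"
  proof
    have B_obs: "B \<subseteq> observable_algebra G H act"
    proof
      fix y assume "y \<in> B"
      then obtain n m c where "y = (\<Sum>b\<in>tensor_basis G H n m. c b *\<^sub>C ordered_product F.observable_gen n m b)"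
        by (auto simp: B_def P.all_pairs_def P.product_pairs_def)
      then show "y \<in> observable_algebra G H act"
        by (auto intro!: F.observables_sum F.observables_scale F.ordered_product_observable simp: tensor_basis_def)
    qed
    then show "closure B \<subseteq> observable_algebra G H act"
      using F.observables_closed by (rule closure_minimal)
    have pair: "\<exists>n m x x'. n < m \<and> (x, y) \<in> P.product_pairs n m \<and> (x', y') \<in> P.product_pairs n m"
      if y: "y \<in> B" "y' \<in> B" for y y'
    proof -
      obtain x x' where "(x, y) \<in> P.all_pairs" "(x', y') \<in> P.all_pairs"
        using y by (auto simp: B_def)
      then show ?thesis by (rule P.all_pairs_common) blast
    qed
    have BI: "y \<in> B" if "n < m" "(x, y) \<in> P.product_pairs n m" for n m x y
      using P.all_pairsI[OF that] by (force simp: B_def)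
    show "observable_algebra G H act \<subseteq> closure B"
    proof (rule F.observables_subset_closure)
      show "1 \<in> B" by (rule BI[of 0 1]) (auto intro: P.pairs_one)
      \<comment> \<open>A generator is its product with the unit pair over the interval from
        \<open>i\<close> to \<open>i + 1\<close>, the shortest one that starts at \<open>i\<close>
        and has \<open>n < m\<close>.\<close>
      show "F.observable_gen i q \<in> B" if q: "q \<in> site_basis G H i" for i q
        using P.pairs_generator[OF P.pairs_one, of i "i + 1" i q] q by (intro BI[of i "i + 1"]) auto
      show "y + y' \<in> B" "y * y' \<in> B" if yB: "y \<in> B" "y' \<in> B" for y y'
      proof -
        obtain n m x x' where *: "n < m" "(x, y) \<in> P.product_pairs n m" "(x', y') \<in> P.product_pairs n m"
          using pair[OF yB] by blast
        show "y + y' \<in> B" by (rule BI[OF *(1) P.pairs_add[OF *(2,3)]])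
        show "y * y' \<in> B" using *(1) by (intro BI[OF *(1) P.pairs_mult[OF _ *(2,3)]]) simp
      qed
      show "c *\<^sub>C y \<in> B" if "y \<in> B" for c y
        using pair[OF that that] by (blast intro: BI P.pairs_scale)
    qed (rule B_obs)
  qed
  ultimately show ?thesis by simp
qed

end
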